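(* Let $\Omega\subsetneq\mathbb C$ be a simply connected domain, $b,b'\in\partial\Omega$ two distinct boundary points (prime ends), and $a,u\in\Omega$. Then each of the four functions $$\mathcal F_\Omega(w;\dots)=\ \langle T(w)\rangle^+_\Omega,\quad \langle T(w)\rangle^{b,b'}_\Omega,\quad \frac{\langle T(w)\varepsilon(a)\rangle^+_\Omega}{\langle\varepsilon(a)\rangle^+_\Omega},\quad \frac{\langle T(w)\sigma(u)\rangle^+_\Omega}{\langle\sigma(u)\rangle^+_\Omega}$$ is holomorphic in $w\in\Omega$ (except at the point $a$ for the third one and at the point $u$ for the fourth one), and obeys the Schwarzian covariance $$\mathcal F_\Omega(w;\dots)=\mathcal F_{\Omega'}(\varphi(w);\dots)\cdot(\varphi'(w))^2+\tfrac1{24}[\mathcal S\varphi](w)$$ under conformal maps $\varphi:\Omega\to\Omega'$ (on the right-hand side the points $b,b',a,u$ are replaced by their images $\varphi(b),\varphi(b'),\varphi(a),\varphi(u)$), where $[\mathcal S\varphi]=\frac{\varphi'''}{\varphi'}-\frac32\big(\frac{\varphi''}{\varphi'}\big)^2$ is the Schwarzian derivative.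
   Context: Let $\phi$ be any conformal map from $\Omega$ onto the upper half-plane $\mathbb H$ and fix a branch of $(\phi')^{1/2}$ on $\Omega$. Put $$f_\Omega(a,z)=\frac{2(\phi'(a))^{1/2}(\phi'(z))^{1/2}}{\phi(z)-\phi(a)},\qquad f^\star_\Omega(a,z)=\frac{2\,\overline{(\phi'(a))^{1/2}}\,(\phi'(z))^{1/2}}{\phi(z)-\overline{\phi(a)}},\qquad f^\dagger_\Omega(a,z)=f_\Omega(a,z)-\frac2{z-a}$$ (independent of the choice of $\phi$). Define: - $\langle T(w)\rangle^+_\Omega=\frac14\partial_zf^\dagger_\Omega(w,z)|_{z=w}$ and $\langle\varepsilon(a)\rangle^+_\Omega=\frac i2f^\star_\Omega(a,a)$; - $\langle T(w)\rangle^{b,b'}_\Omega=\langle T(w)\rangle^+_\Omega+\dfrac{f_\Omega(b',w)\partial_wf_\Omega(b,w)-f_\Omega(b,w)\partial_wf_\Omega(b',w)}{4f_\Omega(b,b')}$, where the possibly ill-defined common factor $(\phi'(b)\phi'(b'))^{1/2}$ cancels, i.e. the second term is $\frac12\left[\frac{\phi'(w)(\phi(b')-\phi(b))}{(\phi(b')-\phi(w))(\phi(b)-\phi(w))}\right]^2$ (a limit being taken if $\phi(b)$ or $\phi(b')$ is $\infty$); - $\langle T(w)\varepsilon(a)\rangle^+_\Omega=\langle T(w)\rangle^+_\Omega\langle\varepsilon(a)\rangle^+_\Omega+\frac i8\big(f_\Omega(a,w)\partial_wf^\star_\Omega(a,w)-f^\star_\Omega(a,w)\partial_wf_\Omega(a,w)\big)$;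 - $\langle\sigma(u)\rangle^+_\Omega=(2|\phi'(u)|)^{1/8}(\mathrm{Im}\,\phi(u))^{-1/8}$; - for $u\in\mathbb H$ and $a,z\in\mathbb H\setminus\{u\}$ close to each other, $f_{[\mathbb H,u]}(a,z)=\Big[\frac{(a-u)(a-\bar u)}{(z-u)(z-\bar u)}\Big]^{1/2}\Big[\frac2{z-a}+\frac1{a-u}+\frac1{a-\bar u}\Big]$ (square root equal to $1$ at $z=a$); for general $\Omega$, $f_{[\Omega,u]}(a,z)=f_{[\mathbb H,\phi(u)]}(\phi(a),\phi(z))(\phi'(a))^{1/2}(\phi'(z))^{1/2}$ and $f^\dagger_{[\Omega,u]}(a,z)=f_{[\Omega,u]}(a,z)-\frac2{z-a}$; then $\langle T(w)\sigma(u)\rangle^+_\Omega=\langle\sigma(u)\rangle^+_\Omega\cdot\frac14\partial_zf^\dagger_{[\Omega,u]}(w,z)|_{z=w}$. *)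

theory Defs
  imports "HOL-Complex_Analysis.Complex_Analysis"
begin

section \<open>Conformal maps and the Schwarzian derivative\<close>

definition conformal_map :: "(complex \<Rightarrow> complex) \<Rightarrow> complex set \<Rightarrow> complex set \<Rightarrow> bool" where
  "conformal_map f U V \<longleftrightarrow> f holomorphic_on U \<and> bij_betw f U V"

definition upper_half_plane :: "complex set" where
  "upper_half_plane = {z. Im z > 0}"

text \<open>A conformal map \<open>\<phi>\<close> of \<open>\<Omega>\<close> onto the upper half-plane, together with a branch \<open>s\<close> of the
  square root of its derivative.  The correlation functions below are computed from such a pair;
  that they depend on \<open>\<Omega>\<close> alone is to be understood as independence of the choice of the pair.\<close>

definition half_plane_chart ::
  "complex set \<Rightarrow> (complex \<Rightarrow> complex) \<Rightarrow> (complex \<Rightarrow> complex) \<Rightarrow> bool" where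
  "half_plane_chart \<Omega> \<phi> s \<longleftrightarrow>
     conformal_map \<phi> \<Omega> upper_half_plane \<and> s holomorphic_on \<Omega> \<and> (\<forall>z\<in>\<Omega>. (s z)\<^sup>2 = deriv \<phi> z)"

definition schwarzian :: "(complex \<Rightarrow> complex) \<Rightarrow> complex \<Rightarrow> complex" where
  "schwarzian f z =
     (deriv ^^ 3) f z / deriv f z - 3 / 2 * ((deriv ^^ 2) f z / deriv f z)\<^sup>2"


section \<open>Prime ends\<close>

text \<open>Stereographic projection to the unit sphere of \<open>\<complex> \<times> \<real>\<close>.  Closures and diameters of images
  under it are closures in the Riemann sphere and spherical (chordal) diameters, so that boundary
  points at infinity of unbounded domains are included.\<close>

definition stereo :: "complex \<Rightarrow> complex \<times> real" where
  "stereo z = ((2 / (1 + (norm z)\<^sup>2)) *\<^sub>R z, ((norm z)\<^sup>2 - 1) / ((norm z)\<^sup>2 + 1))"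

text \<open>For open \<open>\<Omega>\<close> this is the boundary of \<open>\<Omega>\<close> in the Riemann sphere.\<close>

definition sphere_boundary :: "complex set \<Rightarrow> (complex \<times> real) set" where
  "sphere_boundary \<Omega> = closure (stereo ` \<Omega>) - stereo ` \<Omega>"

text \<open>A crosscut is an open Jordan arc in \<open>\<Omega>\<close> with both end points on the boundary; following
  Pommerenke, the end points may coincide.\<close>

definition crosscut :: "complex set \<Rightarrow> complex set \<Rightarrow> bool" where
  "crosscut \<Omega> C \<longleftrightarrow> C \<subseteq> \<Omega> \<and>
     (\<exists>g. simple_path g \<and> g 0 \<in> sphere_boundary \<Omega> \<and> g 1 \<in> sphere_boundary \<Omega> \<and>
          stereo ` C = g ` {0<..<1})"

definition separates_in :: "complex set \<Rightarrow> complex set \<Rightarrow> complex set \<Rightarrow> complex set \<Rightarrow> bool" where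
  "separates_in \<Omega> C A B \<longleftrightarrow>
     (\<exists>U\<in>components (\<Omega> - C). \<exists>V\<in>components (\<Omega> - C). U \<noteq> V \<and> A \<subseteq> U \<and> B \<subseteq> V)"

definition null_chain :: "complex set \<Rightarrow> (nat \<Rightarrow> complex set) \<Rightarrow> bool" where
  "null_chain \<Omega> C \<longleftrightarrow>
     (\<forall>n. crosscut \<Omega> (C n)) \<and>
     (\<forall>n. closure (stereo ` C n) \<inter> closure (stereo ` C (Suc n)) = {}) \<and>
     (\<forall>n\<ge>1. separates_in \<Omega> (C n) (C 0) (C (Suc n))) \<and>
     (\<lambda>n. diameter (stereo ` C n)) \<longlonglongrightarrow> 0"

text \<open>The component of \<open>\<Omega> - C n\<close> that contains \<open>C (Suc n)\<close>, hence not \<open>C 0\<close> (for \<open>n \<ge> 1\<close>).\<close>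

definition inner_domain :: "complex set \<Rightarrow> (nat \<Rightarrow> complex set) \<Rightarrow> nat \<Rightarrow> complex set" where
  "inner_domain \<Omega> C n = \<Union>{V \<in> components (\<Omega> - C n). C (Suc n) \<subseteq> V}"

text \<open>Caratheodory's prime ends are the equivalence classes of null chains, where two null chains
  are equivalent if every inner domain of either contains an inner domain of the other.  As the
  inner domains decrease, this says precisely that they generate the same filter; the equivalence
  class is represented by that filter.  Accordingly, the image of a prime end \<open>b\<close> under a conformal
  map \<open>f\<close> is \<open>filtermap f b\<close>, and the value of a function at \<open>b\<close> is its limit along \<open>b\<close>.\<close>

definition prime_end :: "complex set \<Rightarrow> complex filter \<Rightarrow> bool" where
  "prime_end \<Omega> b \<longleftrightarrow>
     (\<exists>C. null_chain \<Omega> C \<and> b = (INF n\<in>{1..}. principal (inner_domain \<Omega> C n)))"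


section \<open>Fermionic two-point functions\<close>

definition f_dom :: "(complex \<Rightarrow> complex) \<Rightarrow> (complex \<Rightarrow> complex) \<Rightarrow> complex \<Rightarrow> complex \<Rightarrow> complex" where
  "f_dom \<phi> s a z = 2 * s a * s z / (\<phi> z - \<phi> a)"

definition f_star :: "(complex \<Rightarrow> complex) \<Rightarrow> (complex \<Rightarrow> complex) \<Rightarrow> complex \<Rightarrow> complex \<Rightarrow> complex" where
  "f_star \<phi> s a z = 2 * cnj (s a) * s z / (\<phi> z - cnj (\<phi> a))"

definition f_dag :: "(complex \<Rightarrow> complex) \<Rightarrow> (complex \<Rightarrow> complex) \<Rightarrow> complex \<Rightarrow> complex \<Rightarrow> complex" where
  "f_dag \<phi> s a z = f_dom \<phi> s a z - 2 / (z - a)"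

text \<open>Only the values for \<open>z\<close> near \<open>a\<close> matter; there the principal root is the branch that equals 1
  at \<open>z = a\<close>.\<close>

definition f_spin_H :: "complex \<Rightarrow> complex \<Rightarrow> complex \<Rightarrow> complex" where
  "f_spin_H u a z =
     csqrt (((a - u) * (a - cnj u)) / ((z - u) * (z - cnj u))) *
     (2 / (z - a) + 1 / (a - u) + 1 / (a - cnj u))"

definition f_spin :: "(complex \<Rightarrow> complex) \<Rightarrow> (complex \<Rightarrow> complex) \<Rightarrow> complex \<Rightarrow>
    complex \<Rightarrow> complex \<Rightarrow> complex" where
  "f_spin \<phi> s u a z = f_spin_H (\<phi> u) (\<phi> a) (\<phi> z) * s a * s z"

definition f_spin_dag :: "(complex \<Rightarrow> complex) \<Rightarrow> (complex \<Rightarrow> complex) \<Rightarrow> complex \<Rightarrow>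
    complex \<Rightarrow> complex \<Rightarrow> complex" where
  "f_spin_dag \<phi> s u a z = f_spin \<phi> s u a z - 2 / (z - a)"


section \<open>Correlation functions\<close>

text \<open>\<open>f_dag\<close> and \<open>f_spin_dag\<close> have a removable singularity on the diagonal \<open>z = a\<close>, where the
  formulas above take meaningless values because of division by zero; it has to be removed
  before differentiating there.\<close>

definition corr_T :: "(complex \<Rightarrow> complex) \<Rightarrow> (complex \<Rightarrow> complex) \<Rightarrow> complex \<Rightarrow> complex" where
  "corr_T \<phi> s w = 1 / 4 * deriv (remove_sings (f_dag \<phi> s w)) w"

text \<open>The second term is evaluated at the boundary points \<open>b\<close>, \<open>b'\<close> by passing to the limit from
  inside the domain.  This is substitution of \<open>\<phi>(b)\<close> and \<open>\<phi>(b')\<close> if both are finite, and the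
  required limit if one of them is infinite.\<close>

definition corr_T_bdry :: "(complex \<Rightarrow> complex) \<Rightarrow> (complex \<Rightarrow> complex) \<Rightarrow>
    complex filter \<Rightarrow> complex filter \<Rightarrow> complex \<Rightarrow> complex" where
  "corr_T_bdry \<phi> s b b' w = corr_T \<phi> s w +
     Lim (b \<times>\<^sub>F b') (\<lambda>(x, x').
       1 / 2 * (deriv \<phi> w * (\<phi> x' - \<phi> x) / ((\<phi> x' - \<phi> w) * (\<phi> x - \<phi> w)))\<^sup>2)"

definition corr_eps :: "(complex \<Rightarrow> complex) \<Rightarrow> (complex \<Rightarrow> complex) \<Rightarrow> complex \<Rightarrow> complex" where
  "corr_eps \<phi> s a = \<i> / 2 * f_star \<phi> s a a"

definition corr_T_eps :: "(complex \<Rightarrow> complex) \<Rightarrow> (complex \<Rightarrow> complex) \<Rightarrow> complex \<Rightarrow> complex \<Rightarrow> complex" where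
  "corr_T_eps \<phi> s a w = corr_T \<phi> s w * corr_eps \<phi> s a +
     \<i> / 8 * (f_dom \<phi> s a w * deriv (f_star \<phi> s a) w - f_star \<phi> s a w * deriv (f_dom \<phi> s a) w)"

definition corr_sigma :: "(complex \<Rightarrow> complex) \<Rightarrow> complex \<Rightarrow> complex" where
  "corr_sigma \<phi> u =
     complex_of_real ((2 * norm (deriv \<phi> u)) powr (1 / 8) * Im (\<phi> u) powr (- 1 / 8))"

definition corr_T_sigma :: "(complex \<Rightarrow> complex) \<Rightarrow> (complex \<Rightarrow> complex) \<Rightarrow> complex \<Rightarrow> complex \<Rightarrow> complex" where
  "corr_T_sigma \<phi> s u w =
     corr_sigma \<phi> u * (1 / 4 * deriv (remove_sings (f_spin_dag \<phi> s u w)) w)"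

end

(*
  By the Taylor expansion of the two-point functions on the diagonal, each of the four functions is
  S(phi)/24 plus a multiple of [phi'(w) J(phi(w); P, Q)]^2, where J(W; P, Q) = (Q - P)/((Q - W)(P - W))
  and (P, Q) is (phi(b), phi(b')), (phi(a), cnj(phi(a))) or (phi(u), cnj(phi(u))).  Two half-plane charts
  differ by a real Moebius map, which has vanishing Schwarzian and leaves phi'(w) J(phi(w); P, Q)
  unchanged, so covariance is the chain rule for the Schwarzian.

  The boundary term requires that phi has a limit along every prime end.  This is a length-area
  argument: if the images of the crosscuts did not shrink, one could take the strip as target and find
  images crossing a rectangle [x1, x2] x (0, pi) arbitrarily close to its horizontal edges.  A bounded
  holomorphic function built from the inverse map is small on them, and as its total variation along
  vertical lines near the edges is small in the mean (finite area), its boundary values vanish on an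
  interval.  Hence it vanishes identically, which is absurd.
*)
theory Submission
  imports Defs
begin

text \<open>The images of the crosscuts under \<open>\<phi>\<close> are not known to have end
  points; all that is known is that they leave every compact set. The crossing argument therefore
  works with the inverse map, which is nearly constant on these images because the crosscuts shrink
  in the spherical metric. The inverse map may be unbounded and of infinite area, so it enters only
  through a bounded injective \<open>G\<close>. The small function \<open>P\<close> is a quadratic
  polynomial in \<open>G\<close>: it need not be injective, but its derivative is dominated by that
  of \<open>G\<close>, whose square integrates to an area. The strip is a logarithmic chart centred
  at a real point \<open>t\<close>, so that a rectangle across it is a half-annulus about
  \<open>t\<close>. An image that cannot cross such a half-annulus lies entirely inside its larger
  circle or entirely outside its smaller one, and separation from \<open>C 0\<close> then confines
  the inner domain in the same way.\<close>

section \<open>The Schwarzian derivative\<close>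

lemma schwarzian_eqI:
  assumes "open U" "w \<in> U"
    and F: "\<And>x. x \<in> U \<Longrightarrow> (F has_field_derivative F1 x) (at x)"
    and F1: "\<And>x. x \<in> U \<Longrightarrow> (F1 has_field_derivative F2 x) (at x)"
    and F2: "\<And>x. x \<in> U \<Longrightarrow> (F2 has_field_derivative F3 x) (at x)"
  shows "schwarzian F w = F3 w / F1 w - 3 / 2 * (F2 w / F1 w)\<^sup>2"
proof -
  have 1: "deriv F x = F1 x" if "x \<in> U" for x
    using F that by (simp add: DERIV_imp_deriv)
  have 2: "deriv (deriv F) x = F2 x" if "x \<in> U" for x
    by (rule DERIV_imp_deriv, rule has_field_derivative_transform_within_open[OF F1])
       (use that 1 assms in auto)
  have 3: "deriv (deriv (deriv F)) x = F3 x" if "x \<in> U" for x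
    by (rule DERIV_imp_deriv, rule has_field_derivative_transform_within_open[OF F2])
       (use that 2 assms in auto)
  show ?thesis
    using 1 2 3 assms(2) by (simp add: schwarzian_def numeral_2_eq_2 numeral_3_eq_3)
qed

lemma holomorphic_iterated_derivs:
  assumes "open U" "f holomorphic_on U" "x \<in> U"
  shows "(f has_field_derivative deriv f x) (at x)"
    "(deriv f has_field_derivative deriv (deriv f) x) (at x)"
    "(deriv (deriv f) has_field_derivative deriv (deriv (deriv f)) x) (at x)"
  using assms holomorphic_derivI holomorphic_deriv by blast+

lemma schwarzian_altdef:
  "schwarzian f w = deriv (deriv (deriv f)) w / deriv f w
     - 3 / 2 * (deriv (deriv f) w / deriv f w)\<^sup>2"
  by (simp add: schwarzian_def numeral_2_eq_2 numeral_3_eq_3)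

lemma schwarzian_compose:
  assumes U: "open U" "f holomorphic_on U" and V: "open V" "g holomorphic_on V"
    and fUV: "f ` U \<subseteq> V" and w: "w \<in> U"
    and nz: "deriv f w \<noteq> 0" "deriv g (f w) \<noteq> 0"
  shows "schwarzian (\<lambda>z. g (f z)) w = schwarzian g (f w) * (deriv f w)\<^sup>2 + schwarzian f w"
proof -
  have g: "((\<lambda>z. h (f z)) has_field_derivative deriv h (f x) * deriv f x) (at x)"
    if "x \<in> U" "h holomorphic_on V" for x h
    by (rule DERIV_chain2[OF holomorphic_derivI[OF that(2) V(1)] holomorphic_iterated_derivs(1)[OF U]]) (use that fUV in auto)
  have hol: "deriv g holomorphic_on V" "deriv (deriv g) holomorphic_on V"
    using V holomorphic_deriv by blast+
  note g' = g[OF _ V(2)] g[OF _ hol(1)] g[OF _ hol(2)]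
  define F1 where "F1 = (\<lambda>z. deriv g (f z) * deriv f z)"
  define F2 where "F2 = (\<lambda>z. deriv (deriv g) (f z) * (deriv f z)\<^sup>2
      + deriv g (f z) * deriv (deriv f) z)"
  define F3 where "F3 = (\<lambda>z. deriv (deriv (deriv g)) (f z) * deriv f z ^ 3
        + 3 * deriv (deriv g) (f z) * deriv f z * deriv (deriv f) z
        + deriv g (f z) * deriv (deriv (deriv f)) z)"
  have "schwarzian (\<lambda>z. g (f z)) w = F3 w / F1 w - 3 / 2 * (F2 w / F1 w)\<^sup>2"
  proof (rule schwarzian_eqI[OF U(1) w])
    fix x assume x: "x \<in> U"
    note f = holomorphic_iterated_derivs[OF U x]
    show "((\<lambda>z. g (f z)) has_field_derivative F1 x) (at x)"
      unfolding F1_def by (rule g'[OF x])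
    show "(F1 has_field_derivative F2 x) (at x)"
      unfolding F1_def F2_def
      by (rule DERIV_cong[OF DERIV_mult[OF g'(2)[OF x] f(2)]]) (simp add: power2_eq_square mult_ac)
    show "(F2 has_field_derivative F3 x) (at x)"
      unfolding F2_def F3_def power2_eq_square
      by (rule DERIV_cong[OF DERIV_add[OF DERIV_mult[OF g'(3)[OF x] DERIV_mult[OF f(2) f(2)]]
              DERIV_mult[OF g'(2)[OF x] f(3)]]]) (simp add: power3_eq_cube algebra_simps)
  qed
  also have "\<dots> = schwarzian g (f w) * (deriv f w)\<^sup>2 + schwarzian f w"
  proof -
    \<comment> \<open>The mixed terms cancel: the first quotient contributes
      \<open>3 * g2 * f2 / g1\<close>, and the cross term of the square contributes the same with
      the opposite sign.\<close>
    have "(g3 * f1 ^ 3 + 3 * g2 * f1 * f2 + g1 * f3) / (g1 * f1)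
        - 3 / 2 * ((g2 * f1\<^sup>2 + g1 * f2) / (g1 * f1))\<^sup>2
      = (g3 / g1 - 3 / 2 * (g2 / g1)\<^sup>2) * f1\<^sup>2 + (f3 / f1 - 3 / 2 * (f2 / f1)\<^sup>2)"
      if "f1 \<noteq> 0" "g1 \<noteq> 0" for f1 f2 f3 g1 g2 g3 :: complex
      using that by (simp add: field_simps power2_eq_square power3_eq_cube)
    then show ?thesis
      unfolding schwarzian_altdef F1_def F2_def F3_def using nz by blast
  qed
  finally show ?thesis .
qed

lemma schwarzian_moebius:
  assumes "\<alpha> * \<delta> - \<beta> * \<gamma> \<noteq> 0" "\<gamma> * w + \<delta> \<noteq> 0"
  shows "schwarzian (\<lambda>z. (\<alpha> * z + \<beta>) / (\<gamma> * z + \<delta>)) w = 0"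
proof -
  define N where "N = \<alpha> * \<delta> - \<beta> * \<gamma>"
  \<comment> \<open>As \<open>v' = - \<gamma> * v^2\<close>, the three derivatives are multiples of
    \<open>v^2\<close>, \<open>v^3\<close> and \<open>v^4\<close>, and the common factor
    \<open>N\<close> drops out of the Schwarzian.\<close>
  define v where "v = (\<lambda>z. inverse (\<gamma> * z + \<delta>))"
  define U where "U = {z. \<gamma> * z + \<delta> \<noteq> 0}"
  have U: "open U"
    unfolding U_def by (intro open_Collect_neq continuous_intros)
  have v: "(v has_field_derivative - \<gamma> * (v x)\<^sup>2) (at x)" if "x \<in> U" for x
    using that unfolding v_def U_def
    by (auto intro!: derivative_eq_intros simp: power2_eq_square field_simps)
  have "schwarzian (\<lambda>z. (\<alpha> * z + \<beta>) / (\<gamma> * z + \<delta>)) w =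
     (6 * \<gamma>\<^sup>2 * N * v w ^ 4) / (N * (v w)\<^sup>2)
     - 3 / 2 * ((- 2 * \<gamma> * N * v w ^ 3) / (N * (v w)\<^sup>2))\<^sup>2"
  proof (rule schwarzian_eqI[OF U, where ?F1.0 = "\<lambda>x. N * (v x)\<^sup>2"
        and ?F2.0 = "\<lambda>x. - 2 * \<gamma> * N * v x ^ 3" and ?F3.0 = "\<lambda>x. 6 * \<gamma>\<^sup>2 * N * v x ^ 4"])
    show "w \<in> U" using assms by (simp add: U_def)
  next
    fix x assume x: "x \<in> U"
    then have nz: "\<gamma> * x + \<delta> \<noteq> 0" by (simp add: U_def)
    show "((\<lambda>z. (\<alpha> * z + \<beta>) / (\<gamma> * z + \<delta>)) has_field_derivative N * (v x)\<^sup>2) (at x)"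
      using nz by (auto intro!: derivative_eq_intros simp: N_def v_def power2_eq_square field_simps)
    show "((\<lambda>x. N * (v x)\<^sup>2) has_field_derivative - 2 * \<gamma> * N * v x ^ 3) (at x)"
      by (auto intro!: derivative_eq_intros v[OF x] simp: power2_eq_square power3_eq_cube)
    show "((\<lambda>x. - 2 * \<gamma> * N * v x ^ 3) has_field_derivative 6 * \<gamma>\<^sup>2 * N * v x ^ 4) (at x)"
      by (auto intro!: derivative_eq_intros v[OF x] simp: power2_eq_square power4_eq_xxxx)
  qed
  also have "\<dots> = 0"
  proof -
    have "v w \<noteq> 0" "N \<noteq> 0" using assms by (auto simp: v_def N_def)
    then show ?thesis
      by (simp add: divide_simps power2_eq_square power3_eq_cube power4_eq_xxxx)
  qed
  finally show ?thesis .
qed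

section \<open>Derivatives of quotients at a removable singularity\<close>

lemma deriv_add_const: "deriv (\<lambda>z. f z + c) = deriv f"
proof -
  have "((\<lambda>z. f z + c) has_field_derivative D) (at x) \<longleftrightarrow> (f has_field_derivative D) (at x)" for D x
    using DERIV_add[OF _ DERIV_const, of "\<lambda>z. f z + c" D x UNIV "- c"]
      DERIV_add[OF _ DERIV_const, of f D x UNIV c] by auto
  then show ?thesis by (intro ext) (simp add: deriv_def)
qed

text \<open>By the Leibniz rule the n-th derivative of \<open>(z - w) * g z\<close> at
  \<open>w\<close> is n times the (n-1)-st derivative of \<open>g\<close>. Read backwards, this
  gives the Taylor coefficients of a filled-in difference quotient.\<close>

lemma deriv_difference_quotient:
  assumes U: "open U" "w \<in> U" and g: "g holomorphic_on U"
    and h: "\<And>z. z \<in> U \<Longrightarrow> h z = c + (z - w) * g z"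
  shows "deriv h w = g w" "deriv (deriv h) w = 2 * deriv g w"
    "deriv (deriv (deriv h)) w = 3 * deriv (deriv g) w"
proof -
  note dg = holomorphic_iterated_derivs[OF U(1) g]
  have 1: "deriv h z = g z + (z - w) * deriv g z" if "z \<in> U" for z
    by (rule DERIV_imp_deriv, rule has_field_derivative_transform_within_open[OF _ U(1) that,
          of "\<lambda>z. c + (z - w) * g z"])
       (use dg[OF that] h in \<open>auto intro!: derivative_eq_intros\<close>)
  have 2: "deriv (deriv h) z = 2 * deriv g z + (z - w) * deriv (deriv g) z" if "z \<in> U" for z
    by (rule DERIV_imp_deriv, rule has_field_derivative_transform_within_open[OF _ U(1) that,
          of "\<lambda>z. g z + (z - w) * deriv g z"])
       (use dg[OF that] 1 in \<open>auto intro!: derivative_eq_intros\<close>)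
  have 3: "deriv (deriv (deriv h)) w = 3 * deriv (deriv g) w"
    by (rule DERIV_imp_deriv, rule has_field_derivative_transform_within_open[OF _ U,
          of "\<lambda>z. 2 * deriv g z + (z - w) * deriv (deriv g) z"])
       (use dg[OF U(2)] 2 in \<open>auto intro!: derivative_eq_intros\<close>)
  show "deriv h w = g w" "deriv (deriv h) w = 2 * deriv g w"
    "deriv (deriv (deriv h)) w = 3 * deriv (deriv g) w"
    using 1 2 3 U by auto
qed

text \<open>Both \<open>f_dag\<close> and \<open>f_spin_dag\<close> have the form
  \<open>T z / (z - w)\<close> with \<open>T w = 0\<close>; after removal of the singularity their
  first Taylor coefficient is the second one of \<open>T\<close>.\<close>

lemma deriv_remove_sings_quotient:
  assumes U: "open U" "w \<in> U" and T: "T holomorphic_on U" "T w = 0"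
    and f: "\<And>z. z \<in> U - {w} \<Longrightarrow> f z = T z / (z - w)"
  shows "deriv (remove_sings f) w = deriv (deriv T) w / 2"
proof -
  define g where "g = (\<lambda>z. if z = w then deriv T w else (T z - T w) / (z - w))"
  have g: "g holomorphic_on U"
    unfolding g_def using T U pole_lemma_open by blast
  have fg: "f z = g z" if "z \<in> U - {w}" for z
    using f[OF that] that T by (simp add: g_def)
  have rs: "remove_sings f z = g z" if z: "z \<in> U" for z
  proof -
    \<comment> \<open>\<open>remove_sings\<close> looks at punctured neighbourhoods of
      \<open>z\<close>; the point \<open>w\<close> has to be kept out of them also when it differs
      from \<open>z\<close>.\<close>
    have "eventually (\<lambda>x. x \<in> U - {w}) (at z)"
    proof (cases "z = w")
      case True
      then show ?thesis using eventually_at_in_open[OF U(1) z] by simp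
    next
      case False
      then have "eventually (\<lambda>x. x \<in> (U - {w}) - {z}) (at z)"
        using U z by (intro eventually_at_in_open) auto
      then show ?thesis by eventually_elim auto
    qed
    then have "remove_sings f z = remove_sings g z"
      by (intro remove_sings_cong) (auto elim!: eventually_mono simp: fg)
    also have "\<dots> = g z"
      using g U z by (intro remove_sings_at_analytic) (auto simp: analytic_at)
    finally show ?thesis .
  qed
  have "deriv (remove_sings f) w = deriv g w"
    using U rs by (intro deriv_cong_ev) (auto simp: eventually_nhds)
  moreover have "deriv (deriv T) w = 2 * deriv g w"
    by (rule deriv_difference_quotient(2)[OF U g, of T 0]) (simp add: g_def T)
  ultimately show ?thesis by simp
qed

lemma deriv_product:
  assumes U: "open U" "w \<in> U" and f: "f holomorphic_on U" and g: "g holomorphic_on U"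
    and h: "\<And>z. z \<in> U \<Longrightarrow> h z = f z * g z"
  shows "deriv h w = deriv f w * g w + f w * deriv g w"
    "deriv (deriv h) w = deriv (deriv f) w * g w + 2 * deriv f w * deriv g w + f w * deriv (deriv g) w"
proof -
  note df = holomorphic_iterated_derivs[OF U(1) f] and dg = holomorphic_iterated_derivs[OF U(1) g]
  have 1: "deriv h z = deriv f z * g z + f z * deriv g z" if "z \<in> U" for z
    by (rule DERIV_imp_deriv, rule has_field_derivative_transform_within_open[OF _ U(1) that,
          of "\<lambda>z. f z * g z"])
       (use df(1)[OF that] dg(1)[OF that] in \<open>auto intro!: derivative_eq_intros simp: h\<close>)
  then show "deriv h w = deriv f w * g w + f w * deriv g w" using U by simp
  show "deriv (deriv h) w = deriv (deriv f) w * g w + 2 * deriv f w * deriv g w + f w * deriv (deriv g) w"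
    by (rule DERIV_imp_deriv, rule has_field_derivative_transform_within_open[OF _ U,
          of "\<lambda>z. deriv f z * g z + f z * deriv g z"])
       (use df[OF U(2)] dg[OF U(2)] 1 in \<open>auto intro!: derivative_eq_intros simp: algebra_simps\<close>)
qed

section \<open>Two-point functions near the diagonal\<close>

text \<open>\<open>T\<close> is determined by \<open>(T + 2) D = 2 s(w) s\<close>, where \<open>D\<close> is the difference quotient of \<open>\<phi>\<close>
  at \<open>w\<close>; differentiating this twice at \<open>w\<close> gives the Taylor coefficients of \<open>T\<close>.\<close>

lemma f_dom_expansion:
  assumes U: "open U" "w \<in> U" and \<phi>: "\<phi> holomorphic_on U" "inj_on \<phi> U"
    and s: "s holomorphic_on U" "\<And>z. z \<in> U \<Longrightarrow> (s z)\<^sup>2 = deriv \<phi> z"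
  obtains T where "T holomorphic_on U" "T w = 0" "deriv T w = 0"
    "deriv (deriv T) w = schwarzian \<phi> w / 3"
    "\<And>z. z \<in> U - {w} \<Longrightarrow> f_dom \<phi> s w z = (T z + 2) / (z - w)"
proof -
  define D where "D = (\<lambda>z. if z = w then deriv \<phi> w else (\<phi> z - \<phi> w) / (z - w))"
  have D: "D holomorphic_on U"
    unfolding D_def using \<phi> U pole_lemma_open by blast
  have d0: "deriv \<phi> w \<noteq> 0"
    using holomorphic_injective_imp_regular[OF \<phi>(1) U(1) \<phi>(2) U(2)] .
  have D0: "D z \<noteq> 0" if "z \<in> U" for z
    using d0 that \<phi>(2) U by (auto simp: D_def inj_on_def)
  have D': "D w = deriv \<phi> w" "deriv D w = deriv (deriv \<phi>) w / 2"
    "deriv (deriv D) w = deriv (deriv (deriv \<phi>)) w / 3"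
    using deriv_difference_quotient[OF U D, of \<phi> "\<phi> w"] by (auto simp: D_def)
  define T where "T = (\<lambda>z. 2 * s w * s z / D z - 2)"
  have T: "T holomorphic_on U"
    unfolding T_def using D0 by (intro holomorphic_intros D s) auto
  have Tw: "T w = 0"
    using s(2)[OF U(2)] d0 by (simp add: T_def D' power2_eq_square field_simps)
  have s0: "s w \<noteq> 0" using s(2)[OF U(2)] d0 by auto
  \<comment> \<open>Differentiating \<open>s^2 = deriv \<phi>\<close> once and twice expresses the
    higher derivatives of \<open>\<phi>\<close>, and with them the Schwarzian, in terms of
    \<open>s\<close>.\<close>
  have s12: "deriv (deriv \<phi>) w = 2 * s w * deriv s w"
    "deriv (deriv (deriv \<phi>)) w = 2 * s w * deriv (deriv s) w + 2 * (deriv s w)\<^sup>2"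
    using deriv_product[OF U s(1) s(1), of "deriv \<phi>"] s(2)
    by (auto simp: power2_eq_square algebra_simps)
  have TD: "2 * s w * s z - 2 * D z = T z * D z" if "z \<in> U" for z
    using D0[OF that] by (simp add: T_def field_simps)
  have L: "deriv (\<lambda>z. 2 * s w * s z - 2 * D z) z = 2 * s w * deriv s z - 2 * deriv D z" if "z \<in> U" for z
    using holomorphic_iterated_derivs(1)[OF U(1) s(1) that] holomorphic_iterated_derivs(1)[OF U(1) D that]
    by (intro DERIV_imp_deriv) (auto intro!: derivative_eq_intros)
  have L2: "deriv (deriv (\<lambda>z. 2 * s w * s z - 2 * D z)) w = 2 * s w * deriv (deriv s) w - 2 * deriv (deriv D) w"
    by (rule DERIV_imp_deriv, rule has_field_derivative_transform_within_open[OF _ U,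
          of "\<lambda>z. 2 * s w * deriv s z - 2 * deriv D z"])
       (use holomorphic_iterated_derivs(2)[OF U(1) s(1) U(2)]
           holomorphic_iterated_derivs(2)[OF U(1) D U(2)] L in
         \<open>auto intro!: derivative_eq_intros\<close>)
  note TD' = deriv_product[OF U T D TD]
  have T1: "deriv T w = 0"
    using TD'(1) L[OF U(2)] Tw d0 by (simp add: D' s12)
  have "deriv (deriv T) w * deriv \<phi> w = 2 * s w * deriv (deriv s) w - 2 / 3 * deriv (deriv (deriv \<phi>)) w"
    using TD'(2) L2 Tw T1 by (simp add: D')
  moreover have "schwarzian \<phi> w / 3 * deriv \<phi> w = 2 * s w * deriv (deriv s) w - 2 / 3 * deriv (deriv (deriv \<phi>)) w"
    using s0 unfolding schwarzian_altdef s12 s(2)[OF U(2), symmetric]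
    by (simp add: field_simps power2_eq_square)
  ultimately have T2: "deriv (deriv T) w = schwarzian \<phi> w / 3"
    using d0 by (metis mult_cancel_right)
  have "f_dom \<phi> s w z = (T z + 2) / (z - w)" if "z \<in> U - {w}" for z
    using that by (simp add: f_dom_def T_def D_def)
  with T Tw T1 T2 show ?thesis using that by blast
qed

text \<open>The constant is \<open>24 = 4 * 2 * 3\<close>: 1/4 comes from the definition of
  \<open>corr_T\<close>, 1/2 from the Taylor coefficient and 1/3 from the expansion of
  \<open>f_dom\<close>.\<close>

lemma corr_T_eq:
  assumes U: "open U" "w \<in> U" and \<phi>: "\<phi> holomorphic_on U" "inj_on \<phi> U"
    and s: "s holomorphic_on U" "\<And>z. z \<in> U \<Longrightarrow> (s z)\<^sup>2 = deriv \<phi> z"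
  shows "corr_T \<phi> s w = schwarzian \<phi> w / 24"
proof -
  obtain T where T: "T holomorphic_on U" "T w = 0" "deriv T w = 0"
    "deriv (deriv T) w = schwarzian \<phi> w / 3"
    "\<And>z. z \<in> U - {w} \<Longrightarrow> f_dom \<phi> s w z = (T z + 2) / (z - w)"
    using f_dom_expansion[OF assms] by blast
  have "deriv (remove_sings (f_dag \<phi> s w)) w = deriv (deriv T) w / 2"
    by (rule deriv_remove_sings_quotient[OF U T(1,2)])
       (simp add: f_dag_def T(5) diff_divide_distrib[symmetric])
  then have "corr_T \<phi> s w = 1 / 4 * (schwarzian \<phi> w / 3 / 2)"
    by (simp only: corr_T_def T(4))
  then show ?thesis by simp
qed

text \<open>The spin factor splits off: near \<open>w\<close>, \<open>f_spin\<close> is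
  \<open>f_dom\<close> times a function \<open>E\<close> with value 1 and derivative 0 at
  \<open>w\<close>, so that only the second derivative of \<open>E\<close> is added to the
  coefficient of \<open>f_dom\<close>. It is a quarter of the square in the statement; with the
  factor 1/4 in \<open>corr_T_sigma\<close> this makes 1/16.\<close>

lemma corr_T_sigma_eq:
  assumes U: "open U" "w \<in> U" and \<phi>: "\<phi> holomorphic_on U" "inj_on \<phi> U"
    and s: "s holomorphic_on U" "\<And>z. z \<in> U \<Longrightarrow> (s z)\<^sup>2 = deriv \<phi> z"
    and q0: "\<phi> w \<noteq> \<phi> u" "\<phi> w \<noteq> cnj (\<phi> u)"
  shows "corr_T_sigma \<phi> s u w = corr_sigma \<phi> u * (schwarzian \<phi> w / 24 +
    1 / 16 * (deriv \<phi> w * (cnj (\<phi> u) - \<phi> u) / ((cnj (\<phi> u) - \<phi> w) * (\<phi> u - \<phi> w)))\<^sup>2)"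
proof -
  define q where "q = (\<phi> w - \<phi> u) * (\<phi> w - cnj (\<phi> u))"
  define m where "m = 1 / (\<phi> w - \<phi> u) + 1 / (\<phi> w - cnj (\<phi> u))"
  define R where "R = (cnj (\<phi> u) - \<phi> u) / ((cnj (\<phi> u) - \<phi> w) * (\<phi> u - \<phi> w))"
  \<comment> \<open>The inverse of the ratio under the root in \<open>f_spin_H\<close>, as a
    polynomial in \<open>\<phi> z - \<phi> w\<close>. Its linear coefficient \<open>m\<close> is
    also the sum of reciprocals in \<open>f_spin_H\<close>; this coincidence makes the derivative of
    \<open>E\<close> vanish at \<open>w\<close>.\<close>
  define P where "P = (\<lambda>z. 1 + m * (\<phi> z - \<phi> w) + (\<phi> z - \<phi> w)\<^sup>2 / q)"
  have q: "q \<noteq> 0" using q0 by (simp add: q_def)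
  have mq: "m * q = 2 * \<phi> w - \<phi> u - cnj (\<phi> u)"
  proof -
    have "(1 / x + 1 / y) * (x * y) = x + y" if "x \<noteq> 0" "y \<noteq> 0" for x y :: complex
      using that by (simp add: field_simps)
    from this[of "\<phi> w - \<phi> u" "\<phi> w - cnj (\<phi> u)"] q0 show ?thesis
      unfolding m_def q_def by simp
  qed
  have Pq: "P z * q = (\<phi> z - \<phi> u) * (\<phi> z - cnj (\<phi> u))" for z
  proof -
    have "P z * q = q + (m * q) * (\<phi> z - \<phi> w) + (\<phi> z - \<phi> w)\<^sup>2"
      using q by (simp add: P_def field_simps)
    then show ?thesis unfolding mq by (simp add: q_def algebra_simps power2_eq_square)
  qed
  have P: "P holomorphic_on U"
    unfolding P_def using q by (intro holomorphic_intros \<phi>) auto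
  \<comment> \<open>Where \<open>P\<close> has positive real part, the principal root of
    \<open>inverse (P z)\<close> is holomorphic.\<close>
  define V where "V = U \<inter> P -` {p. 0 < Re p}"
  have VU: "V \<subseteq> U" by (auto simp: V_def)
  have V: "open V"
    unfolding V_def using U(1) holomorphic_on_imp_continuous_on[OF P]
    by (intro continuous_open_preimage open_halfspace_Re_gt)
  have w: "w \<in> V"
    using U by (simp add: V_def P_def)
  note V = V w
  have PV: "P holomorphic_on V" and \<phi>V: "\<phi> holomorphic_on V" "inj_on \<phi> V" and sV: "s holomorphic_on V"
    using P \<phi> s VU holomorphic_on_subset inj_on_subset by blast+
  obtain T where T: "T holomorphic_on V" "T w = 0" "deriv T w = 0"
    "deriv (deriv T) w = schwarzian \<phi> w / 3"
    "\<And>z. z \<in> V - {w} \<Longrightarrow> f_dom \<phi> s w z = (T z + 2) / (z - w)"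
    using f_dom_expansion[OF V \<phi>V sV] s(2) VU by blast
  define E where "E = (\<lambda>z. csqrt (inverse (P z)) * (1 + m * (\<phi> z - \<phi> w) / 2))"
  have "P z \<notin> \<real>\<^sub>\<le>\<^sub>0" "P z \<noteq> 0" if "z \<in> V" for z
    using that by (auto simp: V_def complex_nonpos_Reals_iff)
  then have E: "E holomorphic_on V"
    unfolding E_def by (intro holomorphic_intros PV \<phi>V holomorphic_on_csqrt') auto
  have "deriv (remove_sings (f_spin_dag \<phi> s u w)) w = deriv (deriv (\<lambda>z. (T z + 2) * E z - 2)) w / 2"
  proof (rule deriv_remove_sings_quotient[OF V])
    show "(\<lambda>z. (T z + 2) * E z - 2) holomorphic_on V"
      by (intro holomorphic_intros T E)
    show "(T w + 2) * E w - 2 = 0" by (simp add: T E_def P_def)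
    fix z assume z: "z \<in> V - {w}"
    have y: "\<phi> z - \<phi> w \<noteq> 0" using z V \<phi>V by (auto simp: inj_on_def)
    have "f_spin \<phi> s u w z =
        csqrt (q / (P z * q)) * (2 / (\<phi> z - \<phi> w) + m) * s w * s z"
      unfolding f_spin_def f_spin_H_def Pq by (simp add: q_def m_def add.assoc)
    also have "2 / (\<phi> z - \<phi> w) + m = 2 / (\<phi> z - \<phi> w) * (1 + m * (\<phi> z - \<phi> w) / 2)"
      using y by (simp add: field_simps)
    also have "q / (P z * q) = inverse (P z)" using q by (simp add: field_simps)
    finally have "f_spin \<phi> s u w z = f_dom \<phi> s w z * E z"
      by (simp add: E_def f_dom_def)
    then show "f_spin_dag \<phi> s u w z = ((T z + 2) * E z - 2) / (z - w)"
      using T(5)[OF z] by (simp add: f_spin_dag_def diff_divide_distrib)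
  qed
  also have "\<dots> = schwarzian \<phi> w / 6 + deriv (deriv E) w"
  proof -
    have T2: "(\<lambda>z. T z + 2) holomorphic_on V" by (intro holomorphic_intros T)
    have "E w = 1" by (simp add: E_def P_def)
    then show ?thesis
      using deriv_product(2)[OF V T2 E, of "\<lambda>z. (T z + 2) * E z"]
        deriv_add_const[of "\<lambda>z. (T z + 2) * E z" "-2"] deriv_add_const[of T 2] T
      by simp
  qed
  also have "deriv (deriv E) w = (deriv \<phi> w)\<^sup>2 * (m\<^sup>2 / 4 - 1 / q)"
  proof -
    have EE: "(\<lambda>z. E z * E z) holomorphic_on V" by (intro holomorphic_intros E)
    \<comment> \<open>The root itself is never differentiated: the derivatives of \<open>E\<close>
      at \<open>w\<close> are read off from \<open>(E z * E z) * P z = Q z\<close>. Both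
      \<open>P\<close> and \<open>Q\<close> are quadratic in \<open>\<phi> z - \<phi> w\<close> and
      differ only in the leading coefficient.\<close>
    define Q where "Q = (\<lambda>z. (1 + m * (\<phi> z - \<phi> w) / 2)\<^sup>2)"
    have Q: "Q z = (E z * E z) * P z" if "z \<in> V" for z
    proof -
      have "P z \<noteq> 0" using that by (auto simp: V_def)
      moreover have "E z * E z = inverse (P z) * Q z"
        by (simp add: E_def Q_def power_mult_distrib flip: power2_eq_square)
      ultimately show ?thesis by simp
    qed
    have Ew: "E w = 1" "P w = 1" by (simp_all add: E_def P_def)
    note d\<phi> = holomorphic_iterated_derivs[OF V(1) \<phi>V(1)]
    have PQ: "deriv (\<lambda>z. 1 + m * (\<phi> z - \<phi> w) + k * (\<phi> z - \<phi> w)\<^sup>2) w = m * deriv \<phi> w"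
      "deriv (deriv (\<lambda>z. 1 + m * (\<phi> z - \<phi> w) + k * (\<phi> z - \<phi> w)\<^sup>2)) w
         = m * deriv (deriv \<phi>) w + 2 * k * (deriv \<phi> w)\<^sup>2" for k
    proof -
      have 1: "deriv (\<lambda>z. 1 + m * (\<phi> z - \<phi> w) + k * (\<phi> z - \<phi> w)\<^sup>2) z =
          m * deriv \<phi> z + 2 * k * (\<phi> z - \<phi> w) * deriv \<phi> z" if "z \<in> V" for z
        by (rule DERIV_imp_deriv)
           (use d\<phi>[OF that] in \<open>auto intro!: derivative_eq_intros simp: algebra_simps\<close>)
      show "deriv (\<lambda>z. 1 + m * (\<phi> z - \<phi> w) + k * (\<phi> z - \<phi> w)\<^sup>2) w = m * deriv \<phi> w"
        using 1 V by simp
      show "deriv (deriv (\<lambda>z. 1 + m * (\<phi> z - \<phi> w) + k * (\<phi> z - \<phi> w)\<^sup>2)) w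
         = m * deriv (deriv \<phi>) w + 2 * k * (deriv \<phi> w)\<^sup>2"
        by (rule DERIV_imp_deriv, rule has_field_derivative_transform_within_open[OF _ V,
              of "\<lambda>z. m * deriv \<phi> z + 2 * k * (\<phi> z - \<phi> w) * deriv \<phi> z"])
           (use d\<phi>[OF V(2)] 1 in \<open>auto intro!: derivative_eq_intros simp: power2_eq_square\<close>)
    qed
    have P': "deriv P w = m * deriv \<phi> w"
      "deriv (deriv P) w = m * deriv (deriv \<phi>) w + 2 / q * (deriv \<phi> w)\<^sup>2"
      using PQ[of "1 / q"] by (simp_all add: P_def)
    have "Q = (\<lambda>z. 1 + m * (\<phi> z - \<phi> w) + m\<^sup>2 / 4 * (\<phi> z - \<phi> w)\<^sup>2)"
      unfolding Q_def by (intro ext) (simp add: power2_eq_square field_simps)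
    then have Q': "deriv Q w = m * deriv \<phi> w"
      "deriv (deriv Q) w = m * deriv (deriv \<phi>) w + m\<^sup>2 / 2 * (deriv \<phi> w)\<^sup>2"
      using PQ[of "m\<^sup>2 / 4"] by simp_all
    note EE' = deriv_product[OF V E E, of "\<lambda>z. E z * E z"]
    note Q'' = deriv_product[OF V EE PV Q]
    have E1: "deriv E w = 0"
      using Q''(1) by (simp add: Q' P' EE' Ew)
    have "2 * deriv (deriv E) w = 2 * ((deriv \<phi> w)\<^sup>2 * (m\<^sup>2 / 4 - 1 / q))"
      using Q''(2) by (simp add: Q' P' EE' Ew E1 algebra_simps)
    then show ?thesis by simp
  qed
  also have "m\<^sup>2 / 4 - 1 / q = 1 / 4 * R\<^sup>2"
  proof -
    have "(1 / x + 1 / y)\<^sup>2 / 4 - 1 / (x * y) = 1 / 4 * ((x - y) / ((- y) * (- x)))\<^sup>2"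
      if "x \<noteq> 0" "y \<noteq> 0" for x y :: complex
      using that by (simp add: field_simps power2_eq_square)
    from this[of "\<phi> w - \<phi> u" "\<phi> w - cnj (\<phi> u)"] q0 show ?thesis
      unfolding m_def q_def R_def by simp
  qed
  finally have "deriv (remove_sings (f_spin_dag \<phi> s u w)) w
      = schwarzian \<phi> w / 6 + (deriv \<phi> w)\<^sup>2 * (1 / 4 * R\<^sup>2)" .
  then show ?thesis
    unfolding corr_T_sigma_def times_divide_eq_right[of "deriv \<phi> w", symmetric] R_def[symmetric]
    by (simp add: algebra_simps)
qed

text \<open>Up to constants, \<open>f_dom\<close> and \<open>f_star\<close> are
  \<open>s z / (\<phi> z - c)\<close> for two values of \<open>c\<close>, so the terms with
  \<open>deriv s\<close> cancel in their Wronskian. The remaining factor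
  \<open>s a * cnj (s a)\<close> cancels against \<open>corr_eps\<close>.\<close>

lemma corr_T_eps_eq:
  assumes U: "open U" "w \<in> U" and \<phi>: "\<phi> holomorphic_on U" "inj_on \<phi> U"
    and s: "s holomorphic_on U" "\<And>z. z \<in> U \<Longrightarrow> (s z)\<^sup>2 = deriv \<phi> z"
    and a: "a \<in> U" "a \<noteq> w" "\<phi> a \<noteq> cnj (\<phi> a)" "\<phi> w \<noteq> cnj (\<phi> a)"
  shows "corr_T_eps \<phi> s a w / corr_eps \<phi> s a = schwarzian \<phi> w / 24 +
    1 / 2 * (deriv \<phi> w * (cnj (\<phi> a) - \<phi> a) / ((cnj (\<phi> a) - \<phi> w) * (\<phi> a - \<phi> w)))\<^sup>2"
proof -
  define x y where "x = \<phi> w - \<phi> a" and "y = \<phi> w - cnj (\<phi> a)"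
  have xy: "x \<noteq> 0" "y \<noteq> 0" "y - x \<noteq> 0"
    using a U \<phi>(2) by (auto simp: x_def y_def inj_on_def)
  have s0: "s a \<noteq> 0"
    using s(2)[OF a(1)] holomorphic_injective_imp_regular[OF \<phi>(1) U(1) \<phi>(2) a(1)] by auto
  note d\<phi> = holomorphic_iterated_derivs(1)[OF U(1) \<phi>(1) U(2)]
  note ds = holomorphic_iterated_derivs(1)[OF U(1) s(1) U(2)]
  have D: "((\<lambda>z. 2 * k * s z / (\<phi> z - c)) has_field_derivative
      2 * k * (deriv s w / (\<phi> w - c) - s w * deriv \<phi> w / (\<phi> w - c)\<^sup>2)) (at w)"
    if "\<phi> w \<noteq> c" for k c
  proof -
    define v where "v = \<phi> w - c"
    have v: "v \<noteq> 0" using that by (simp add: v_def)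
    have "((\<lambda>z. 2 * k * s z / (\<phi> z - c)) has_field_derivative
        (2 * k * deriv s w * v - 2 * k * s w * deriv \<phi> w) / (v * v)) (at w)"
      using v unfolding v_def by (auto intro!: derivative_eq_intros d\<phi> ds)
    also have "(2 * k * deriv s w * v - 2 * k * s w * deriv \<phi> w) / (v * v)
        = 2 * k * (deriv s w / v - s w * deriv \<phi> w / v\<^sup>2)"
      using v by (simp add: field_simps power2_eq_square)
    finally show ?thesis unfolding v_def .
  qed
  have d1: "deriv (f_dom \<phi> s a) w = 2 * s a * (deriv s w / x - s w * deriv \<phi> w / x\<^sup>2)"
    unfolding f_dom_def x_def using xy by (intro DERIV_imp_deriv D) (auto simp: x_def)
  have d2: "deriv (f_star \<phi> s a) w = 2 * cnj (s a) * (deriv s w / y - s w * deriv \<phi> w / y\<^sup>2)"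
    unfolding f_star_def y_def using xy by (intro DERIV_imp_deriv D) (auto simp: y_def)
  have "f_dom \<phi> s a w * deriv (f_star \<phi> s a) w - f_star \<phi> s a w * deriv (f_dom \<phi> s a) w
      = 4 * (s a * cnj (s a)) * ((s w)\<^sup>2 * deriv \<phi> w * (y - x)) / (x\<^sup>2 * y\<^sup>2)"
    unfolding d1 d2 f_dom_def f_star_def x_def[symmetric] y_def[symmetric] using xy
    by (simp add: field_simps power2_eq_square)
  also have "(s w)\<^sup>2 * deriv \<phi> w * (y - x) = (deriv \<phi> w)\<^sup>2 * (y - x)"
    using s(2)[OF U(2)] by (simp add: power2_eq_square)
  finally have W: "f_dom \<phi> s a w * deriv (f_star \<phi> s a) w - f_star \<phi> s a w * deriv (f_dom \<phi> s a) w
      = 4 * (s a * cnj (s a)) * ((deriv \<phi> w)\<^sup>2 * (y - x)) / (x\<^sup>2 * y\<^sup>2)" .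
  have \<epsilon>: "corr_eps \<phi> s a = \<i> * (s a * cnj (s a)) / (y - x)"
    by (simp add: corr_eps_def f_star_def x_def y_def)
  have "corr_T_eps \<phi> s a w / corr_eps \<phi> s a
      = corr_T \<phi> s w + 1 / 2 * (deriv \<phi> w * (y - x) / (x * y))\<^sup>2"
    unfolding corr_T_eps_def W unfolding \<epsilon> using xy s0
    by (simp add: field_simps power2_eq_square)
  also have "deriv \<phi> w * (y - x) / (x * y) =
      - (deriv \<phi> w * (cnj (\<phi> a) - \<phi> a) / ((cnj (\<phi> a) - \<phi> w) * (\<phi> a - \<phi> w)))"
  proof -
    have "cnj (\<phi> a) - \<phi> w = - y" "\<phi> a - \<phi> w = - x" "cnj (\<phi> a) - \<phi> a = - (y - x)"
      by (simp_all add: x_def y_def)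
    then show ?thesis using xy by (simp only:) (simp add: field_simps)
  qed
  finally show ?thesis
    using corr_T_eq[OF U \<phi> s] by simp
qed

section \<open>Change of chart\<close>

lemma conformal_map_compose:
  assumes "conformal_map f U V" "conformal_map g V W"
  shows "conformal_map (\<lambda>z. g (f z)) U W"
  using assms holomorphic_on_compose_gen[of f U g V] bij_betw_trans[of f U V g W]
  by (auto simp: conformal_map_def o_def bij_betw_def)

lemma conformal_map_inverse:
  assumes "conformal_map f U V" "open U"
  shows "\<exists>g. conformal_map g V U \<and> (\<forall>z\<in>U. g (f z) = z) \<and> (\<forall>z\<in>V. f (g z) = z)"
proof -
  have f: "f holomorphic_on U" "inj_on f U" "f ` U = V"
    using assms by (auto simp: conformal_map_def bij_betw_def)
  obtain g where g: "g holomorphic_on (f ` U)" "\<And>z. z \<in> U \<Longrightarrow> g (f z) = z"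
    using holomorphic_has_inverse[OF f(1) assms(2) f(2)] by metis
  have "bij_betw g V U"
    by (rule bij_betwI[of _ _ _ f]) (use f g in auto)
  moreover have "f (g z) = z" if "z \<in> V" for z
    using that f g by auto
  ultimately show ?thesis
    using f g by (auto simp: conformal_map_def)
qed

lemma conformal_map_props:
  assumes "conformal_map f U V" "open U"
  shows "f holomorphic_on U" "inj_on f U" "f ` U = V" "open V"
    "\<And>z. z \<in> U \<Longrightarrow> deriv f z \<noteq> 0"
proof -
  show 1: "f holomorphic_on U" "inj_on f U" "f ` U = V"
    using assms by (auto simp: conformal_map_def bij_betw_def)
  then show "open V" using open_mapping_thm3[OF 1(1) assms(2)] by auto
  show "\<And>z. z \<in> U \<Longrightarrow> deriv f z \<noteq> 0"
    using holomorphic_injective_imp_regular[OF 1(1) assms(2) 1(2)] .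
qed

lemma open_upper_half_plane: "open upper_half_plane"
  unfolding upper_half_plane_def by (rule open_halfspace_Im_gt)

section \<open>The Cayley transform and the automorphisms of disc and half-plane\<close>

lemma cayley_inverse:
  fixes z :: complex
  assumes "z + \<i> \<noteq> 0"
  shows "\<i> * (1 + (z - \<i>) / (z + \<i>)) / (1 - (z - \<i>) / (z + \<i>)) = z"
proof -
  have "1 + (z - \<i>) / (z + \<i>) = 2 * z / (z + \<i>)" "1 - (z - \<i>) / (z + \<i>) = 2 * \<i> / (z + \<i>)"
    using assms by (simp_all add: field_simps)
  then show ?thesis using assms by simp
qed

lemma conformal_map_half_plane_disc:
  "conformal_map (\<lambda>z. (z - \<i>) / (z + \<i>)) upper_half_plane (ball 0 1)"
  "conformal_map (\<lambda>\<zeta>. \<i> * (1 + \<zeta>) / (1 - \<zeta>)) (ball 0 1) upper_half_plane"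
proof -
  have nz: "z + \<i> \<noteq> 0" if "z \<in> upper_half_plane" for z
    using that by (auto simp: upper_half_plane_def complex_eq_iff)
  have nz': "1 - \<zeta> \<noteq> 0" if "\<zeta> \<in> ball 0 1" for \<zeta> :: complex
    using that by auto
  have iff: "cmod (z - \<i>) < cmod (z + \<i>) \<longleftrightarrow> z \<in> upper_half_plane" for z
  proof -
    have "cmod (z - \<i>) < cmod (z + \<i>) \<longleftrightarrow> (cmod (z - \<i>))\<^sup>2 < (cmod (z + \<i>))\<^sup>2"
      by (rule power_mono_iff[symmetric, THEN arg_cong[where f = Not], simplified not_le]) auto
    also have "\<dots> \<longleftrightarrow> 0 < Im z"
    proof -
      have "(cmod (z + \<i>))\<^sup>2 - (cmod (z - \<i>))\<^sup>2 = 4 * Im z"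
        unfolding cmod_power2 by (simp add: power2_eq_square algebra_simps)
      then show ?thesis by linarith
    qed
    finally show ?thesis by (simp add: upper_half_plane_def)
  qed
  have 1: "(z - \<i>) / (z + \<i>) \<in> ball 0 1" if z: "z \<in> upper_half_plane" for z
    using iff[of z] z nz[OF z] by (simp add: norm_divide)
  have 3: "\<i> * (1 + (z - \<i>) / (z + \<i>)) / (1 - (z - \<i>) / (z + \<i>)) = z" if "z \<in> upper_half_plane" for z
    using cayley_inverse nz[OF that] by blast
  have 4: "(\<i> * (1 + \<zeta>) / (1 - \<zeta>) - \<i>) / (\<i> * (1 + \<zeta>) / (1 - \<zeta>) + \<i>) = \<zeta>" if "\<zeta> \<in> ball 0 1" for \<zeta>
    proof -
    have "\<i> * (1 + \<zeta>) / (1 - \<zeta>) - \<i> = 2 * \<i> * \<zeta> / (1 - \<zeta>)"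
      "\<i> * (1 + \<zeta>) / (1 - \<zeta>) + \<i> = 2 * \<i> / (1 - \<zeta>)"
      using nz'[OF that] by (simp_all add: field_simps)
    then show ?thesis using nz'[OF that] by simp
  qed
  have 2: "\<i> * (1 + \<zeta>) / (1 - \<zeta>) \<in> upper_half_plane" if z: "\<zeta> \<in> ball 0 1" for \<zeta>
  proof -
    define w where "w = \<i> * (1 + \<zeta>) / (1 - \<zeta>)"
    have "w + \<i> = 2 * \<i> / (1 - \<zeta>)"
      using nz'[OF z] by (simp add: w_def field_simps)
    then have w: "w + \<i> \<noteq> 0" using nz'[OF z] by simp
    have "cmod ((w - \<i>) / (w + \<i>)) < 1" using 4[OF z] z unfolding w_def by simp
    then have "cmod (w - \<i>) < cmod (w + \<i>)" using w by (simp add: norm_divide)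
    then show ?thesis using iff[of w] unfolding w_def by blast
  qed
  define c c' where "c = (\<lambda>z. (z - \<i>) / (z + \<i>))" and "c' = (\<lambda>\<zeta>. \<i> * (1 + \<zeta>) / (1 - \<zeta>))"
  have "c \<in> upper_half_plane \<rightarrow> ball 0 1" "c' \<in> ball 0 1 \<rightarrow> upper_half_plane"
    "\<And>z. z \<in> upper_half_plane \<Longrightarrow> c' (c z) = z" "\<And>\<zeta>. \<zeta> \<in> ball 0 1 \<Longrightarrow> c (c' \<zeta>) = \<zeta>"
    unfolding c_def c'_def using 1 2 3 4 by blast+
  then have "bij_betw c upper_half_plane (ball 0 1)" "bij_betw c' (ball 0 1) upper_half_plane"
    by (blast intro: bij_betwI)+
  moreover have "c holomorphic_on upper_half_plane" "c' holomorphic_on ball 0 1"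
    unfolding c_def c'_def by (intro holomorphic_intros nz nz'; assumption)+
  ultimately show "conformal_map (\<lambda>z. (z - \<i>) / (z + \<i>)) upper_half_plane (ball 0 1)"
    "conformal_map (\<lambda>\<zeta>. \<i> * (1 + \<zeta>) / (1 - \<zeta>)) (ball 0 1) upper_half_plane"
    unfolding conformal_map_def c_def c'_def by blast+
qed

text \<open>The Schwarz lemma for \<open>B\<close> and for its inverse gives
  \<open>norm (B z) = norm z\<close>; the single point 1/2 is enough to invoke the equality
  case.\<close>

lemma disc_automorphism_fixing_0:
  assumes B: "conformal_map B (ball 0 1) (ball 0 1)" "B 0 = 0"
  obtains \<mu> where "norm \<mu> = 1" "\<And>z. z \<in> ball 0 1 \<Longrightarrow> B z = \<mu> * z"
proof -
  obtain C where "conformal_map C (ball 0 1) (ball 0 1) \<and>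
      (\<forall>z\<in>ball 0 1. C (B z) = z) \<and> (\<forall>z\<in>ball 0 1. B (C z) = z)"
    using conformal_map_inverse[OF B(1) open_ball] by (rule exE)
  then have C: "conformal_map C (ball 0 1) (ball 0 1)" "\<And>z. z \<in> ball 0 1 \<Longrightarrow> C (B z) = z"
    by simp_all
  note Bp = conformal_map_props(1,3)[OF B(1) open_ball] and Cp = conformal_map_props(1,3)[OF C(1) open_ball]
  have C0: "C 0 = 0" using C(2)[of 0] B(2) by simp
  have nB: "norm (B z) < 1" if "norm z < 1" for z
    using imageI[of z "ball 0 1" B] Bp(2) that by simp
  have nC: "norm (C z) < 1" if "norm z < 1" for z
    using imageI[of z "ball 0 1" C] Cp(2) that by simp
  have h: "norm (1 / 2 :: complex) < 1" by (simp add: norm_divide)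
  have "norm (B (1/2)) \<le> norm (1/2 :: complex)"
    by (rule Schwarz_Lemma(1)[OF Bp(1) B(2) nB h])
  moreover have "norm (C (B (1/2))) \<le> norm (B (1/2))"
    by (rule Schwarz_Lemma(1)[OF Cp(1) C0 nC nB[OF h]])
  moreover have "C (B (1/2)) = 1/2"
    using C(2)[of "1/2"] h by simp
  ultimately have "norm (B (1/2)) = norm (1/2 :: complex)" by simp
  then have "\<exists>z. norm z < 1 \<and> z \<noteq> 0 \<and> norm (B z) = norm z"
    using h by (intro exI[of _ "1/2"]) simp
  then have "\<exists>\<alpha>. (\<forall>z. norm z < 1 \<longrightarrow> B z = \<alpha> * z) \<and> norm \<alpha> = 1"
    using Schwarz_Lemma(3)[OF Bp(1) B(2) nB h] by blast
  then show ?thesis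
    using that by (metis mem_ball_0)
qed

text \<open>A real affine map moves \<open>A \<i>\<close> to \<open>\<i>\<close>; in disc
  coordinates the result is a rotation by some \<open>\<mu>\<close>. For
  \<open>\<nu>^2 = \<mu>\<close> this rotation is the Moebius map of the half-plane with matrix
  \<open>[R, I; -I, R]\<close>, where \<open>R\<close> and \<open>I\<close> are the real and
  imaginary part of \<open>\<nu>\<close>. Taking the root is what produces real
  coefficients.\<close>

lemma upper_half_plane_automorphism:
  fixes A :: "complex \<Rightarrow> complex"
  assumes A: "conformal_map A upper_half_plane upper_half_plane"
  obtains \<alpha> \<beta> \<gamma> \<delta> :: real where "\<alpha> * \<delta> - \<beta> * \<gamma> \<noteq> 0"
    "\<And>z. z \<in> upper_half_plane \<Longrightarrow> A z = (complex_of_real \<alpha> * z + complex_of_real \<beta>) / (complex_of_real \<gamma> * z + complex_of_real \<delta>)"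
proof -
  have i: "\<i> \<in> upper_half_plane" by (simp add: upper_half_plane_def)
  define x where "x = Re (A \<i>)"
  define y where "y = Im (A \<i>)"
  have y: "y > 0"
    using A i by (auto simp: y_def conformal_map_def bij_betw_def upper_half_plane_def)
  have Ai: "A \<i> = x + y * \<i>" by (simp add: complex_eq_iff x_def y_def)
  have aff: "conformal_map (\<lambda>z. (z - x) / y) upper_half_plane upper_half_plane"
  proof -
    have "bij_betw (\<lambda>z. (z - x) / y) upper_half_plane upper_half_plane"
      by (rule bij_betwI[of _ _ _ "\<lambda>z::complex. y * z + x"])
         (use y in \<open>auto simp: upper_half_plane_def\<close>)
    then show ?thesis
      using y unfolding conformal_map_def
      by (intro conjI holomorphic_intros) simp_all
  qed
  define B where "B = (\<lambda>\<zeta>. ((A (\<i> * (1 + \<zeta>) / (1 - \<zeta>)) - x) / y - \<i>) / ((A (\<i> * (1 + \<zeta>) / (1 - \<zeta>)) - x) / y + \<i>))"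
  have "conformal_map B (ball 0 1) (ball 0 1)"
    unfolding B_def
    using conformal_map_compose[OF conformal_map_half_plane_disc(2)
        conformal_map_compose[OF A conformal_map_compose[OF aff conformal_map_half_plane_disc(1)]]] .
  moreover have "B 0 = 0"
    using y by (simp add: B_def Ai)
  ultimately obtain \<mu> where \<mu>: "norm \<mu> = 1" "\<And>z. z \<in> ball 0 1 \<Longrightarrow> B z = \<mu> * z"
    using disc_automorphism_fixing_0 by blast
  define \<nu> where "\<nu> = csqrt \<mu>"
  define R where "R = Re \<nu>"
  define I where "I = Im \<nu>"
  have "norm \<nu> ^ 2 = norm (\<nu>\<^sup>2)" by (simp add: norm_power)
  also have "\<dots> = 1" using \<mu>(1) by (simp add: \<nu>_def)
  finally have "norm \<nu> ^ 2 = 1" .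
  then have RI: "R\<^sup>2 + I\<^sup>2 = 1" by (simp add: cmod_power2 R_def I_def)
  show ?thesis
  proof (rule that[of "y * R - x * I" R "y * I + x * R" "- I"])
    show "(y * R - x * I) * R - (y * I + x * R) * (- I) \<noteq> 0"
    proof -
      have "(y * R - x * I) * R - (y * I + x * R) * (- I) = y * (R\<^sup>2 + I\<^sup>2)"
        by (simp add: algebra_simps power2_eq_square)
      then show ?thesis using RI y by simp
    qed
    fix z assume z: "z \<in> upper_half_plane"
    define v where "v = (A z - x) / y"
    have vH: "v \<in> upper_half_plane"
    proof -
      have "A z \<in> upper_half_plane"
        using A z by (auto simp: conformal_map_def bij_betw_def)
      then show ?thesis using y by (simp add: v_def upper_half_plane_def)
    qed
    have nz: "z + \<i> \<noteq> 0" "v + \<i> \<noteq> 0"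
      using z vH by (auto simp: upper_half_plane_def complex_eq_iff)
    have \<zeta>: "(z - \<i>) / (z + \<i>) \<in> ball 0 1"
      using conformal_map_half_plane_disc(1) z by (auto simp: conformal_map_def bij_betw_def)
    have \<zeta>': "\<i> * (1 + (z - \<i>) / (z + \<i>)) / (1 - (z - \<i>) / (z + \<i>)) = z"
      using cayley_inverse nz by blast
    have "(v - \<i>) / (v + \<i>) = \<mu> * ((z - \<i>) / (z + \<i>))"
      using \<mu>(2)[OF \<zeta>] unfolding B_def \<zeta>' v_def .
    then have "(v - \<i>) * (z + \<i>) = \<nu>\<^sup>2 * (z - \<i>) * (v + \<i>)"
      using nz by (simp add: \<nu>_def field_simps)
    then have "cnj \<nu> * ((v - \<i>) * (z + \<i>)) = (cnj \<nu> * \<nu>) * \<nu> * (z - \<i>) * (v + \<i>)"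
      by (simp add: power2_eq_square mult_ac)
    moreover have "cnj \<nu> * \<nu> = 1"
      using RI by (simp add: complex_eq_iff R_def I_def power2_eq_square)
    ultimately have e: "cnj \<nu> * ((v - \<i>) * (z + \<i>)) = \<nu> * (z - \<i>) * (v + \<i>)" by simp
    have \<nu>: "\<nu> = R + I * \<i>" "cnj \<nu> = R - I * \<i>" by (simp_all add: complex_eq_iff R_def I_def)
    have e': "v * (R - I * z) = R * z + I"
    proof -
      \<comment> \<open>With an indeterminate \<open>j\<close> in place of \<open>\<i>\<close> the
        claim is a polynomial identity modulo \<open>j * j = -1\<close>.\<close>
      have "j * j = -1 \<Longrightarrow> (p - q * j) * ((v - j) * (z + j)) - (p + q * j) * (z - j) * (v + j)
          = 2 * j * (v * (p - q * z) - (p * z + q))" for j p q :: complex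
        by algebra
      from this[of \<i> R I] have "2 * \<i> * (v * (R - I * z) - (R * z + I)) = 0"
        using e unfolding \<nu> by simp
      then show ?thesis by simp
    qed
    have nz2: "R - I * z \<noteq> 0"
    proof
      assume "R - I * z = 0"
      then have "R = I * Re z" "I * Im z = 0" by (auto simp: complex_eq_iff)
      then show False using z RI by (auto simp: upper_half_plane_def)
    qed
    then have v: "v = (R * z + I) / (R - I * z)" using e' nz2 by (simp add: eq_divide_eq)
    have "A z = y * v + x" using y by (simp add: v_def)
    also have "\<dots> = (y * (R * z + I) + x * (R - I * z)) / (R - I * z)"
    proof -
      have "y * (n / d) + x = (y * n + x * d) / d" if "d \<noteq> 0" for n d :: complex
        using that by (simp add: field_simps)
      then show ?thesis unfolding v using nz2 by blast
    qed
    also have "y * (R * z + I) + x * (R - I * z) =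
        complex_of_real (y * R - x * I) * z + complex_of_real (y * I + x * R)"
      by (simp add: algebra_simps)
    finally show "A z = (complex_of_real (y * R - x * I) * z + complex_of_real (y * I + x * R)) /
        (complex_of_real (- I) * z + complex_of_real R)"
      by simp
  qed
qed

section \<open>Transition maps between half-plane charts\<close>

lemma half_plane_chart_change:
  fixes \<phi> \<psi> f :: "complex \<Rightarrow> complex"
  assumes \<Omega>: "open \<Omega>" and \<phi>: "conformal_map \<phi> \<Omega> upper_half_plane"
    and \<psi>: "conformal_map \<psi> \<Omega>' upper_half_plane" and f: "conformal_map f \<Omega> \<Omega>'"
  obtains \<alpha> \<beta> \<gamma> \<delta> :: real where "\<alpha> * \<delta> - \<beta> * \<gamma> \<noteq> 0"
    "\<And>z. z \<in> \<Omega> \<Longrightarrow> \<psi> (f z) = (complex_of_real \<alpha> * \<phi> z + complex_of_real \<beta>) / (complex_of_real \<gamma> * \<phi> z + complex_of_real \<delta>)"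
proof -
  obtain g where "conformal_map g upper_half_plane \<Omega> \<and> (\<forall>z\<in>\<Omega>. g (\<phi> z) = z) \<and>
      (\<forall>z\<in>upper_half_plane. \<phi> (g z) = z)"
    using conformal_map_inverse[OF \<phi> \<Omega>] by (rule exE)
  then have g: "conformal_map g upper_half_plane \<Omega>" "\<And>z. z \<in> \<Omega> \<Longrightarrow> g (\<phi> z) = z"
    by simp_all
  have \<phi>H: "\<phi> z \<in> upper_half_plane" if "z \<in> \<Omega>" for z
    using imageI[OF that, of \<phi>] conformal_map_props(3)[OF \<phi> \<Omega>] by simp
  show ?thesis
  proof (rule upper_half_plane_automorphism[OF conformal_map_compose[OF g(1) conformal_map_compose[OF f \<psi>]]])
    fix \<alpha> \<beta> \<gamma> \<delta> :: real
    assume N: "\<alpha> * \<delta> - \<beta> * \<gamma> \<noteq> 0"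
      and A: "\<And>z. z \<in> upper_half_plane \<Longrightarrow> \<psi> (f (g z)) =
        (complex_of_real \<alpha> * z + complex_of_real \<beta>) / (complex_of_real \<gamma> * z + complex_of_real \<delta>)"
    have "\<psi> (f z) = (complex_of_real \<alpha> * \<phi> z + complex_of_real \<beta>) /
        (complex_of_real \<gamma> * \<phi> z + complex_of_real \<delta>)" if "z \<in> \<Omega>" for z
      using A[OF \<phi>H[OF that]] g(2)[OF that] by simp
    then show ?thesis by (rule that[OF N])
  qed
qed

lemma real_moebius_denominator_nonzero:
  fixes \<alpha> \<beta> \<gamma> \<delta> :: real
  assumes "\<alpha> * \<delta> - \<beta> * \<gamma> \<noteq> 0" "Im z \<noteq> 0"
  shows "complex_of_real \<gamma> * z + complex_of_real \<delta> \<noteq> 0"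
  using assms by (auto simp: complex_eq_iff)

text \<open>If \<open>P = W\<close> or \<open>Q = W\<close> then both sides vanish, since \<open>x / 0 = 0\<close>.\<close>

lemma moebius_triple_ratio:
  fixes \<alpha> \<beta> \<gamma> \<delta> W P Q :: complex
  defines "M \<equiv> \<lambda>z. (\<alpha> * z + \<beta>) / (\<gamma> * z + \<delta>)"
  assumes N: "\<alpha> * \<delta> - \<beta> * \<gamma> \<noteq> 0"
    and nz: "\<gamma> * W + \<delta> \<noteq> 0" "\<gamma> * P + \<delta> \<noteq> 0" "\<gamma> * Q + \<delta> \<noteq> 0"
  shows "(\<alpha> * \<delta> - \<beta> * \<gamma>) / (\<gamma> * W + \<delta>)\<^sup>2 * ((M Q - M P) / ((M Q - M W) * (M P - M W)))
    = (Q - P) / ((Q - W) * (P - W))"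
proof -
  have diff: "M x - M y = (\<alpha> * \<delta> - \<beta> * \<gamma>) * (x - y) / ((\<gamma> * x + \<delta>) * (\<gamma> * y + \<delta>))"
    if "\<gamma> * x + \<delta> \<noteq> 0" "\<gamma> * y + \<delta> \<noteq> 0" for x y
    using that by (simp add: M_def divide_simps) (simp add: algebra_simps)
  have gen: "n / w\<^sup>2 * ((n * c / (q * p)) / ((n * a / (q * w)) * (n * b / (p * w)))) = c / (a * b)"
    if "n \<noteq> 0" "w \<noteq> 0" "p \<noteq> 0" "q \<noteq> 0" for n w p q a b c :: complex
    using that by (cases "a = 0 \<or> b = 0") (auto simp: field_simps power2_eq_square)
  show ?thesis
    unfolding diff[OF nz(3,2)] diff[OF nz(3,1)] diff[OF nz(2,1)]
    by (rule gen) (use N nz in auto)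
qed

lemma chart_change_formulas:
  assumes \<Omega>: "open \<Omega>" and \<phi>: "conformal_map \<phi> \<Omega> upper_half_plane"
    and \<psi>: "conformal_map \<psi> \<Omega>' upper_half_plane" and f: "conformal_map f \<Omega> \<Omega>'"
    and w: "w \<in> \<Omega>"
  shows "schwarzian \<phi> w = schwarzian \<psi> (f w) * (deriv f w)\<^sup>2 + schwarzian f w"
    and "\<And>x y. x \<in> \<Omega> \<Longrightarrow> y \<in> \<Omega> \<Longrightarrow>
      deriv \<psi> (f w) * (\<psi> (f y) - \<psi> (f x)) / ((\<psi> (f y) - \<psi> (f w)) * (\<psi> (f x) - \<psi> (f w))) * deriv f w
      = deriv \<phi> w * (\<phi> y - \<phi> x) / ((\<phi> y - \<phi> w) * (\<phi> x - \<phi> w))"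
    and "\<And>x. x \<in> \<Omega> \<Longrightarrow>
      deriv \<psi> (f w) * (cnj (\<psi> (f x)) - \<psi> (f x)) / ((cnj (\<psi> (f x)) - \<psi> (f w)) * (\<psi> (f x) - \<psi> (f w))) * deriv f w
      = deriv \<phi> w * (cnj (\<phi> x) - \<phi> x) / ((cnj (\<phi> x) - \<phi> w) * (\<phi> x - \<phi> w))"
proof -
  note \<phi>p = conformal_map_props[OF \<phi> \<Omega>] and fp = conformal_map_props[OF f \<Omega>]
  note \<psi>p = conformal_map_props[OF \<psi> fp(4)]
  obtain \<alpha> \<beta> \<gamma> \<delta> :: real where N: "\<alpha> * \<delta> - \<beta> * \<gamma> \<noteq> 0"
    and M: "\<And>z. z \<in> \<Omega> \<Longrightarrow> \<psi> (f z) = (complex_of_real \<alpha> * \<phi> z + complex_of_real \<beta>) / (complex_of_real \<gamma> * \<phi> z + complex_of_real \<delta>)"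
    by (rule half_plane_chart_change[OF \<Omega> \<phi> \<psi> f]) (rule that)
  define m where "m = (\<lambda>z. (complex_of_real \<alpha> * z + complex_of_real \<beta>) / (complex_of_real \<gamma> * z + complex_of_real \<delta>))"
  have Mm: "\<psi> (f z) = m (\<phi> z)" if "z \<in> \<Omega>" for z
    unfolding m_def by (rule M[OF that])
  have N': "complex_of_real \<alpha> * complex_of_real \<delta> - complex_of_real \<beta> * complex_of_real \<gamma> \<noteq> 0"
    using N by (metis of_real_diff of_real_mult of_real_eq_0_iff)
  have nz: "complex_of_real \<gamma> * z + complex_of_real \<delta> \<noteq> 0" if "Im z \<noteq> 0" for z
    using real_moebius_denominator_nonzero[OF N that] .
  have Im\<phi>: "Im (\<phi> x) > 0" if "x \<in> \<Omega>" for x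
    using \<phi>p(3) imageI[OF that, of \<phi>] by (simp add: upper_half_plane_def)
  note H = open_upper_half_plane
  have dm: "(m has_field_derivative (complex_of_real \<alpha> * complex_of_real \<delta> - complex_of_real \<beta> * complex_of_real \<gamma>) /
      (complex_of_real \<gamma> * z + complex_of_real \<delta>)\<^sup>2) (at z)" if "Im z > 0" for z
    using nz[of z] that unfolding m_def
    by (auto intro!: derivative_eq_intros simp: power2_eq_square field_simps)
  have mH: "m holomorphic_on upper_half_plane"
    using dm unfolding holomorphic_on_open[OF H] by (auto simp: upper_half_plane_def)
  have dm': "deriv m (\<phi> w) = (complex_of_real \<alpha> * complex_of_real \<delta> - complex_of_real \<beta> * complex_of_real \<gamma>) /
      (complex_of_real \<gamma> * \<phi> w + complex_of_real \<delta>)\<^sup>2"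
    using dm[OF Im\<phi>[OF w]] by (rule DERIV_imp_deriv)
  have dm0: "deriv m (\<phi> w) \<noteq> 0"
    unfolding dm' using N' nz Im\<phi>[OF w] by simp
  have near: "eventually (\<lambda>z. \<psi> (f z) = m (\<phi> z)) (nhds w)"
    using eventually_nhds_in_open[OF \<Omega> w] by eventually_elim (rule Mm)
  have "deriv (\<lambda>z. \<psi> (f z)) w = deriv (\<lambda>z. m (\<phi> z)) w"
    by (rule deriv_cong_ev[OF near refl])
  moreover have "deriv (\<lambda>z. m (\<phi> z)) w = deriv m (\<phi> w) * deriv \<phi> w"
    unfolding dm'
    by (intro DERIV_imp_deriv DERIV_chain2 dm Im\<phi> w holomorphic_derivI[OF \<phi>p(1) \<Omega> w])
  moreover have "deriv (\<lambda>z. \<psi> (f z)) w = deriv \<psi> (f w) * deriv f w"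
    by (intro DERIV_imp_deriv DERIV_chain2 holomorphic_derivI[OF \<psi>p(1) fp(4)] holomorphic_derivI[OF fp(1) \<Omega> w])
       (use fp(3) imageI[OF w, of f] in simp)
  ultimately have chain: "deriv \<psi> (f w) * deriv f w = deriv m (\<phi> w) * deriv \<phi> w" by simp
  \<comment> \<open>As the coefficients are real, conjugate pairs are carried to conjugate
    pairs.\<close>
  have cnjm: "cnj (m z) = m (cnj z)" for z by (simp add: m_def)
  \<comment> \<open>With \<open>P\<close> and \<open>Q\<close> merely nonreal, this covers two
    points of the half-plane as well as a point and its conjugate.\<close>
  have key: "deriv \<psi> (f w) * (m Q - m P) / ((m Q - m (\<phi> w)) * (m P - m (\<phi> w))) * deriv f w
      = deriv \<phi> w * (Q - P) / ((Q - \<phi> w) * (P - \<phi> w))" if "Im P \<noteq> 0" "Im Q \<noteq> 0" for P Q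
  proof -
    have "deriv \<psi> (f w) * (m Q - m P) / ((m Q - m (\<phi> w)) * (m P - m (\<phi> w))) * deriv f w
        = deriv \<phi> w * (deriv m (\<phi> w) * ((m Q - m P) / ((m Q - m (\<phi> w)) * (m P - m (\<phi> w)))))"
      using chain by (simp add: field_simps)
    also have "\<dots> = deriv \<phi> w * ((Q - P) / ((Q - \<phi> w) * (P - \<phi> w)))"
    proof -
      have "deriv m (\<phi> w) * ((m Q - m P) / ((m Q - m (\<phi> w)) * (m P - m (\<phi> w))))
          = (Q - P) / ((Q - \<phi> w) * (P - \<phi> w))"
        unfolding dm'
        using moebius_triple_ratio[OF N' nz nz nz, of "\<phi> w" P Q] that Im\<phi>[OF w]
        unfolding m_def by simp
      then show ?thesis by simp
    qed
    finally show ?thesis by simp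
  qed
  show "deriv \<psi> (f w) * (\<psi> (f y) - \<psi> (f x)) / ((\<psi> (f y) - \<psi> (f w)) * (\<psi> (f x) - \<psi> (f w))) * deriv f w
      = deriv \<phi> w * (\<phi> y - \<phi> x) / ((\<phi> y - \<phi> w) * (\<phi> x - \<phi> w))" if "x \<in> \<Omega>" "y \<in> \<Omega>" for x y
    unfolding Mm[OF that(1)] Mm[OF that(2)] Mm[OF w]
    using Im\<phi>[OF that(1)] Im\<phi>[OF that(2)] by (intro key) simp_all
  show "deriv \<psi> (f w) * (cnj (\<psi> (f x)) - \<psi> (f x)) / ((cnj (\<psi> (f x)) - \<psi> (f w)) * (\<psi> (f x) - \<psi> (f w))) * deriv f w
      = deriv \<phi> w * (cnj (\<phi> x) - \<phi> x) / ((cnj (\<phi> x) - \<phi> w) * (\<phi> x - \<phi> w))" if "x \<in> \<Omega>" for x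
    unfolding Mm[OF that] Mm[OF w] cnjm using Im\<phi>[OF that] by (intro key) simp_all
  \<comment> \<open>The two sides of \<open>\<psi> \<circ> f = m \<circ> \<phi>\<close> are expanded
    by the chain rule, and the Moebius factor contributes nothing.\<close>
  have "schwarzian (\<lambda>z. \<psi> (f z)) w = schwarzian \<psi> (f w) * (deriv f w)\<^sup>2 + schwarzian f w"
    by (rule schwarzian_compose[OF \<Omega> fp(1) fp(4) \<psi>p(1)]) (use fp \<psi>p w in auto)
  moreover have "schwarzian (\<lambda>z. m (\<phi> z)) w = schwarzian m (\<phi> w) * (deriv \<phi> w)\<^sup>2 + schwarzian \<phi> w"
    by (rule schwarzian_compose[OF \<Omega> \<phi>p(1) H mH]) (use \<phi>p w dm0 in auto)
  moreover have "schwarzian m (\<phi> w) = 0"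
    unfolding m_def by (rule schwarzian_moebius[OF N' nz]) (use Im\<phi>[OF w] in simp)
  moreover have "schwarzian (\<lambda>z. \<psi> (f z)) w = schwarzian (\<lambda>z. m (\<phi> z)) w"
    unfolding schwarzian_def using higher_deriv_cong_ev[OF near refl] deriv_cong_ev[OF near refl] by simp
  ultimately show "schwarzian \<phi> w = schwarzian \<psi> (f w) * (deriv f w)\<^sup>2 + schwarzian f w"
    by simp
qed

section \<open>Area and vertical variation\<close>

text \<open>The Jacobian formula for the measure of an image is applied on \<open>real^2\<close>,
  Fubini on pairs of reals; these coordinates and \<open>has_integral_pair_of_r2\<close> mediate
  between the two.\<close>

definition r2_of_complex :: "complex \<Rightarrow> real^2" where
  "r2_of_complex z = vector [Re z, Im z]"

definition complex_of_r2 :: "real^2 \<Rightarrow> complex" where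
  "complex_of_r2 v = Complex (vec_nth v 1) (vec_nth v 2)"

lemma r2_of_complex_nth [simp]: "vec_nth (r2_of_complex z) 1 = Re z" "vec_nth (r2_of_complex z) 2 = Im z"
  by (simp_all add: r2_of_complex_def)

lemma complex_of_r2_sel [simp]: "Re (complex_of_r2 v) = vec_nth v 1" "Im (complex_of_r2 v) = vec_nth v 2"
  by (simp_all add: complex_of_r2_def)

lemma complex_of_r2_of_complex [simp]:
  "complex_of_r2 (r2_of_complex z) = z" "r2_of_complex (complex_of_r2 v) = v"
  by (simp_all add: complex_eq_iff vec_eq_iff forall_2)

lemma bounded_linear_r2_of_complex: "bounded_linear r2_of_complex"
  by (intro linear_conv_bounded_linear[THEN iffD1] linearI) (simp_all add: vec_eq_iff forall_2)

lemma bounded_linear_complex_of_r2: "bounded_linear complex_of_r2"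
  by (intro linear_conv_bounded_linear[THEN iffD1] linearI) (simp_all add: complex_eq_iff)

lemma norm_r2_of_complex [simp]: "norm (r2_of_complex z) = norm z"
  by (simp add: norm_eq_sqrt_inner[of "r2_of_complex z"] inner_vec_def sum_2 cmod_def power2_eq_square)

text \<open>Multiplication by \<open>d\<close> has the matrix
  \<open>[Re d, - Im d; Im d, Re d]\<close>.\<close>

lemma det_complex_mult_r2:
  "det (matrix (\<lambda>h. r2_of_complex (d * complex_of_r2 h))) = (norm d)\<^sup>2"
  unfolding cmod_power2 by (simp add: det_2 matrix_def axis_def power2_eq_square)

lemma has_integral_pair_of_r2:
  fixes f :: "real^2 \<Rightarrow> real"
  assumes "(f has_integral i) (cbox (r2_of_complex (Complex x1 c)) (r2_of_complex (Complex x2 d)))"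
  shows "((\<lambda>p. f (r2_of_complex (Complex (fst p) (snd p)))) has_integral i) (cbox (x1, c) (x2, d))"
proof -
  define g where "g = (\<lambda>p. r2_of_complex (Complex (fst p) (snd p)))"
  define h where "h = (\<lambda>v::real^2. (vec_nth v 1, vec_nth v 2))"
  have hg: "h (g p) = p" and gh: "g (h v) = v" for p v
    by (auto simp: g_def h_def vec_eq_iff forall_2)
  have g: "g ` cbox u v = cbox (g u) (g v)" and h: "h ` cbox a b = cbox (h a) (h b)" for u v a b
  proof -
    have 1: "g p \<in> cbox (g u) (g v) \<longleftrightarrow> p \<in> cbox u v" for p u v
      by (cases p; cases u; cases v) (auto simp: g_def mem_box_cart forall_2 cbox_Pair_eq)
    have "x \<in> g ` cbox u v \<longleftrightarrow> h x \<in> cbox u v" for x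
      using hg gh by (metis image_iff)
    then show "g ` cbox u v = cbox (g u) (g v)"
      using 1[of "h x" u v for x] gh by auto
    have "x \<in> h ` cbox a b \<longleftrightarrow> g x \<in> cbox a b" for x
      using hg gh by (metis image_iff)
    then show "h ` cbox a b = cbox (h a) (h b)"
      using 1[of x "h a" "h b" for x] gh by auto
  qed
  have ex2: "(\<exists>i::2. P i) \<longleftrightarrow> P 1 \<or> P 2" for P
    using forall_2[of "\<lambda>i. \<not> P i"] by blast
  have "((\<lambda>x. f (g x)) has_integral (1 / 1) *\<^sub>R i)
      (h ` cbox (r2_of_complex (Complex x1 c)) (r2_of_complex (Complex x2 d)))"
  proof (rule has_integral_twiddle[OF _ hg gh _ _ _ _ assms])
    show "continuous (at x) g" for x
      unfolding g_def Complex_eq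
      by (intro bounded_linear.continuous[OF bounded_linear_r2_of_complex]
          continuous_intros)
    show "measure lborel (g ` cbox u v) = 1 * measure lborel (cbox u v)" for u v
      unfolding g
      by (cases u; cases v)
         (auto simp: g_def content_Pair content_cbox_if_cart interval_eq_empty_cart ex2 UNIV_2)
    show "\<exists>w z. g ` cbox u v = cbox w z" for u v using g by blast
    show "\<exists>w z. h ` cbox a b = cbox w z" for a b using h by blast
  qed simp
  then show ?thesis unfolding h unfolding g_def h_def by simp
qed

text \<open>The integral is the area of the image of the rectangle.\<close>

lemma injective_holomorphic_area_bound:
  assumes U: "open U" and G: "G holomorphic_on U" "inj_on G U"
    and B: "\<And>z. z \<in> U \<Longrightarrow> norm (G z) \<le> B"
    and box: "\<And>x y. x1 \<le> x \<Longrightarrow> x \<le> x2 \<Longrightarrow> c \<le> y \<Longrightarrow> y \<le> d \<Longrightarrow> Complex x y \<in> U"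
  shows "integral (cbox (x1, c) (x2, d)) (\<lambda>p. (norm (deriv G (Complex (fst p) (snd p))))\<^sup>2)
    \<le> measure lebesgue (cball (0 :: real^2) B)"
proof -
  define S where "S = cbox (r2_of_complex (Complex x1 c)) (r2_of_complex (Complex x2 d))"
  have TU: "complex_of_r2 v \<in> U" if "v \<in> S" for v
    using that box[of "vec_nth v 1" "vec_nth v 2"] by (simp add: S_def mem_box_cart forall_2 complex_of_r2_def)
  define g where "g = (\<lambda>v. r2_of_complex (G (complex_of_r2 v)))"
  define g' where "g' = (\<lambda>v h. r2_of_complex (deriv G (complex_of_r2 v) * complex_of_r2 h))"
  have der: "(g has_derivative g' v) (at v within S)" if "v \<in> S" for v
  proof -
    have "(G has_derivative (*) (deriv G (complex_of_r2 v))) (at (complex_of_r2 v))"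
      using holomorphic_derivI[OF G(1) U TU[OF that]] by (simp add: has_field_derivative_def)
    then have "((\<lambda>v. G (complex_of_r2 v)) has_derivative (\<lambda>h. deriv G (complex_of_r2 v) * complex_of_r2 h)) (at v within S)"
      by (rule has_derivative_compose[OF bounded_linear_imp_has_derivative[OF bounded_linear_complex_of_r2]])
    then show ?thesis
      unfolding g_def g'_def by (rule bounded_linear.has_derivative[OF bounded_linear_r2_of_complex])
  qed
  have inj: "inj_on g S"
    unfolding g_def inj_on_def
    by (metis TU G(2) complex_of_r2_of_complex inj_onD)
  have det: "\<bar>det (matrix (g' v))\<bar> = (norm (deriv G (complex_of_r2 v)))\<^sup>2" for v
    unfolding g'_def det_complex_mult_r2 by simp
  have cont: "continuous_on S (\<lambda>v. (norm (deriv G (complex_of_r2 v)))\<^sup>2)"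
    using TU
    by (intro continuous_intros continuous_on_compose2[OF holomorphic_on_imp_continuous_on[OF holomorphic_deriv[OF G(1) U]]]
        linear_continuous_on bounded_linear_complex_of_r2) auto
  have int: "(\<lambda>v. \<bar>det (matrix (g' v))\<bar>) integrable_on S"
    using integrable_continuous[OF cont[unfolded S_def]] by (simp add: det S_def)
  have "measure lebesgue (g ` S) = integral S (\<lambda>v. \<bar>det (matrix (g' v))\<bar>)"
    by (rule measure_differentiable_image_eq[OF _ der inj int]) (simp_all add: S_def)
  moreover have "measure lebesgue (g ` S) \<le> measure lebesgue (cball (0 :: real^2) B)"
  proof (rule measure_mono_fmeasurable)
    show "g ` S \<subseteq> cball 0 B"
      using B TU by (auto simp: g_def)
    have "continuous_on S g"
      using der has_derivative_continuous_on by blast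
    then have "compact (g ` S)"
      by (rule compact_continuous_image) (simp add: S_def)
    then show "g ` S \<in> sets lebesgue"
      using lmeasurable_compact fmeasurableD by blast
  qed simp
  moreover have "integral (cbox (x1, c) (x2, d)) (\<lambda>p. (norm (deriv G (Complex (fst p) (snd p))))\<^sup>2)
      = integral S (\<lambda>v. \<bar>det (matrix (g' v))\<bar>)"
    using has_integral_pair_of_r2[OF integrable_integral[OF int[unfolded S_def]]]
    by (intro integral_unique) (simp add: det S_def)
  ultimately show ?thesis by simp
qed

text \<open>A weighted form of Cauchy-Schwarz: \<open>norm (deriv G)\<close> is bounded by a
  multiple of its square, whose integral is an area, plus a constant, whose integral is controlled
  by the size of the rectangle. The weights \<open>sqrt h / 2\<close> and
  \<open>1 / (2 * sqrt h)\<close> make both contributions of order \<open>sqrt h\<close>.\<close>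

lemma injective_holomorphic_variation_bound:
  assumes U: "open U" and G: "G holomorphic_on U" "inj_on G U"
    and B: "\<And>z. z \<in> U \<Longrightarrow> norm (G z) \<le> B"
    and le: "x1 \<le> x2" "c \<le> d" "d - c \<le> h" "0 < h"
    and box: "\<And>x y. x1 \<le> x \<Longrightarrow> x \<le> x2 \<Longrightarrow> c \<le> y \<Longrightarrow> y \<le> d \<Longrightarrow> Complex x y \<in> U"
  shows "continuous_on {x1..x2} (\<lambda>x. integral {c..d} (\<lambda>y. norm (deriv G (Complex x y))))"
    "integral {x1..x2} (\<lambda>x. integral {c..d} (\<lambda>y. norm (deriv G (Complex x y))))
      \<le> sqrt h * (measure lebesgue (cball (0 :: real^2) B) + (x2 - x1)) / 2"
proof -
  define D where "D = (\<lambda>p. norm (deriv G (Complex (fst p) (snd p))))"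
  have cD: "continuous_on (cbox (x1, c) (x2, d)) D"
    unfolding D_def using box
    by (intro continuous_intros continuous_on_compose2[OF holomorphic_on_imp_continuous_on[OF holomorphic_deriv[OF G(1) U]]])
       (auto simp: Complex_eq cbox_Pair_eq intro!: continuous_intros)
  have "continuous_on ({x1..x2} \<times> cbox c d) (\<lambda>(x, y). norm (deriv G (Complex x y)))"
    using cD by (simp add: D_def cbox_Pair_eq case_prod_beta')
  from integral_continuous_on_param[OF this]
  show "continuous_on {x1..x2} (\<lambda>x. integral {c..d} (\<lambda>y. norm (deriv G (Complex x y))))"
    by simp
  have iD: "D integrable_on cbox (x1, c) (x2, d)" "(\<lambda>p. (D p)\<^sup>2) integrable_on cbox (x1, c) (x2, d)"
    using cD by (auto intro!: integrable_continuous continuous_intros)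
  have i3: "(\<lambda>p. sqrt h / 2 * (D p)\<^sup>2) integrable_on cbox (x1, c) (x2, d)"
    by (rule integrable_continuous) (intro continuous_intros cD)
  have i4: "(\<lambda>p. sqrt h / 2 * (D p)\<^sup>2 + 1 / (2 * sqrt h)) integrable_on cbox (x1, c) (x2, d)"
    by (intro integrable_add i3 integrable_const)
  have "integral {x1..x2} (\<lambda>x. integral {c..d} (\<lambda>y. norm (deriv G (Complex x y)))) =
      integral (cbox (x1, c) (x2, d)) D"
    using integral_prod_continuous[OF cD] by (simp add: D_def)
  also have "\<dots> \<le> integral (cbox (x1, c) (x2, d)) (\<lambda>p. sqrt h / 2 * (D p)\<^sup>2 + 1 / (2 * sqrt h))"
  proof (rule integral_le[OF iD(1) i4])
    show "D p \<le> sqrt h / 2 * (D p)\<^sup>2 + 1 / (2 * sqrt h)" for p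
    proof -
      \<comment> \<open>The arithmetic-geometric mean inequality in disguise.\<close>
      have "0 \<le> (sqrt h * D p - 1)\<^sup>2 / (2 * sqrt h)" using le by simp
      also have "\<dots> = sqrt h / 2 * (D p)\<^sup>2 + 1 / (2 * sqrt h) - D p"
        using le by (simp add: field_simps power2_eq_square)
      finally show ?thesis by simp
    qed
  qed
  also have "\<dots> = sqrt h / 2 * integral (cbox (x1, c) (x2, d)) (\<lambda>p. (D p)\<^sup>2)
      + measure lborel (cbox (x1, c) (x2, d)) / (2 * sqrt h)"
    by (subst integral_add[OF i3 integrable_const]) simp
  also have "measure lborel (cbox (x1, c) (x2, d)) = (x2 - x1) * (d - c)"
    using le by (simp add: content_Pair)
  also have "\<dots> / (2 * sqrt h) \<le> (x2 - x1) * h / (2 * sqrt h)"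
    using le by (intro divide_right_mono mult_left_mono) auto
  also have "\<dots> = sqrt h / 2 * (x2 - x1)"
  proof -
    have "(x2 - x1) * (q * q) / (2 * q) = q / 2 * (x2 - x1)" if "0 < q" for q
      using that by (simp add: field_simps)
    from this[of "sqrt h"] show ?thesis using le by simp
  qed
  also have "integral (cbox (x1, c) (x2, d)) (\<lambda>p. (D p)\<^sup>2) \<le> measure lebesgue (cball (0 :: real^2) B)"
    unfolding D_def by (rule injective_holomorphic_area_bound[OF U G B box])
  finally show "integral {x1..x2} (\<lambda>x. integral {c..d} (\<lambda>y. norm (deriv G (Complex x y))))
      \<le> sqrt h * (measure lebesgue (cball (0 :: real^2) B) + (x2 - x1)) / 2"
    using le by (simp add: field_simps)
qed

text \<open>In the application \<open>P\<close> is a polynomial in an injective \<open>G\<close>. An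
  area bound is available for \<open>G\<close>, hence the comparison of the derivatives.\<close>

lemma vertical_variation:
  assumes U: "open U" and P: "P holomorphic_on U"
    and seg: "\<And>y. c \<le> y \<Longrightarrow> y \<le> d \<Longrightarrow> Complex x y \<in> U"
    and M: "\<And>z. z \<in> U \<Longrightarrow> norm (deriv P z) \<le> M * norm (deriv G z)" and G: "G holomorphic_on U"
    and y: "c \<le> y" "y \<le> y'" "y' \<le> d" and "0 \<le> M"
  shows "norm (P (Complex x y') - P (Complex x y)) \<le> M * integral {c..d} (\<lambda>y. norm (deriv G (Complex x y)))"
proof -
  have cont: "continuous_on {c..d} (\<lambda>y. norm (deriv G (Complex x y)))"
    using seg
    by (intro continuous_intros continuous_on_compose2[OF holomorphic_on_imp_continuous_on[OF holomorphic_deriv[OF G U]]])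
       (auto simp: Complex_eq intro!: continuous_intros)
  have "((\<lambda>s. P (Complex x s)) has_vector_derivative deriv P (Complex x s) * \<i>) (at s within {y..y'})"
    if "s \<in> {y..y'}" for s
  proof -
    have "((\<lambda>s. P (x + \<i> * complex_of_real s)) has_vector_derivative \<i> * deriv P (Complex x s)) (at s within {y..y'})"
      by (rule field_vector_diff_chain_within[of "\<lambda>s. x + \<i> * complex_of_real s", unfolded o_def])
         (use that y seg holomorphic_derivI[OF P U] in
           \<open>auto intro!: derivative_eq_intros has_vector_derivative_real_field simp: Complex_eq intro: has_field_derivative_at_within\<close>)
    then show ?thesis by (simp add: Complex_eq mult.commute)
  qed
  from fundamental_theorem_of_calculus[OF y(2) this]
  have ft: "((\<lambda>s. deriv P (Complex x s) * \<i>) has_integral P (Complex x y') - P (Complex x y)) {y..y'}" .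
  have i1: "(\<lambda>s. deriv P (Complex x s) * \<i>) integrable_on {y..y'}"
    using ft by (rule has_integral_integrable)
  have i2: "(\<lambda>s. M * norm (deriv G (Complex x s))) integrable_on {y..y'}"
    by (intro integrable_continuous_interval continuous_on_mult_left continuous_on_subset[OF cont]) (use y in auto)
  have i3: "(\<lambda>s. M * norm (deriv G (Complex x s))) integrable_on {c..d}"
    by (intro integrable_continuous_interval continuous_on_mult_left cont)
  have "norm (P (Complex x y') - P (Complex x y)) = norm (integral {y..y'} (\<lambda>s. deriv P (Complex x s) * \<i>))"
    using integral_unique[OF ft] by simp
  also have "\<dots> \<le> integral {y..y'} (\<lambda>s. M * norm (deriv G (Complex x s)))"
  proof (rule integral_norm_bound_integral[OF i1 i2])
    show "norm (deriv P (Complex x s) * \<i>) \<le> M * norm (deriv G (Complex x s))" if "s \<in> {y..y'}" for s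
      using M[OF seg[of s]] that y by (simp add: norm_mult)
  qed
  also have "\<dots> \<le> integral {c..d} (\<lambda>s. M * norm (deriv G (Complex x s)))"
    using y \<open>0 \<le> M\<close> by (intro integral_subset_le i2 i3) auto
  also have "\<dots> = M * integral {c..d} (\<lambda>s. norm (deriv G (Complex x s)))"
    by simp
  finally show ?thesis .
qed

section \<open>Boundary uniqueness in a strip\<close>

definition strip :: "complex set" where
  "strip = {z. 0 < Im z \<and> Im z < pi}"

lemma open_strip: "open strip"
  unfolding strip_def by (intro open_Collect_conj open_halfspace_Im_gt open_halfspace_Im_lt)

lemma convex_strip: "convex strip"
  unfolding strip_def Collect_conj_eq by (intro convex_Int convex_halfspace_Im_gt convex_halfspace_Im_lt)

lemma closure_strip_bottom:
  assumes "0 \<le> Im z" "Im z < pi"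
  shows "z \<in> closure strip"
  unfolding closure_approachable
proof (intro allI impI)
  fix e :: real assume "e > 0"
  define t where "t = min (e / 2) ((pi - Im z) / 2)"
  have t: "0 < t" "t < e" "Im z + t < pi"
    using \<open>e > 0\<close> assms by (auto simp: t_def min_def field_simps)
  have "z + \<i> * t \<in> strip" "dist (z + \<i> * t) z < e"
    using assms t by (auto simp: strip_def dist_norm norm_mult)
  then show "\<exists>y\<in>strip. dist y z < e" by blast
qed

text \<open>A primitive of \<open>R\<close> is Lipschitz, hence extends continuously to the lower edge, where it is
  constant; Schwarz reflection then shows that it is constant everywhere.\<close>

lemma strip_boundary_uniqueness:
  assumes R: "R holomorphic_on strip" and M: "\<And>z. z \<in> strip \<Longrightarrow> norm (R z) \<le> M"
    and x12: "x1 < x2"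
    and int: "\<And>\<eta>. 0 < \<eta> \<Longrightarrow> \<eta> < pi / 2 \<Longrightarrow> integral {x1..x2} (\<lambda>x. norm (R (Complex x \<eta>))) \<le> C * sqrt \<eta>"
    and z: "z \<in> strip"
  shows "R z = 0"
proof -
  obtain Q where Q: "\<And>x. x \<in> strip \<Longrightarrow> (Q has_field_derivative R x) (at x within strip)"
    using holomorphic_convex_primitive'[OF convex_strip open_strip R] by blast
  have Q': "(Q has_field_derivative R x) (at x)" if "x \<in> strip" for x
    using Q[OF that] at_within_open[OF that open_strip] by simp
  have "M-lipschitz_on strip Q"
  proof (rule lipschitz_onI)
    show "dist (Q x) (Q y) \<le> M * dist x y" if "x \<in> strip" "y \<in> strip" for x y
      unfolding dist_norm by (rule field_differentiable_bound[OF convex_strip Q M that])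
    have "norm (R z) \<le> M" using M[OF z] .
    then show "0 \<le> M" using norm_ge_zero[of "R z"] by linarith
  qed
  then obtain q where q: "uniformly_continuous_on (closure strip) q" "\<And>x. x \<in> strip \<Longrightarrow> Q x = q x"
    using uniformly_continuous_on_extension_on_closure[OF lipschitz_on_uniformly_continuous] by metis
  have cq: "continuous_on (closure strip) q"
    using q(1) by (rule uniformly_continuous_imp_continuous)
  \<comment> \<open>The increment of \<open>Q\<close> along height \<open>\<eta>\<close> is an
    integral of \<open>R\<close>, at most \<open>C * sqrt \<eta>\<close>; this tends to 0 with the
    height.\<close>
  have bottom: "q (Complex x 0) = q (Complex x' 0)" if x: "x1 \<le> x" "x \<le> x'" "x' \<le> x2" for x x'
  proof -
    define \<eta> where "\<eta> = (\<lambda>n. inverse (real (Suc n)))"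
    have \<eta>: "0 < \<eta> n" "\<eta> n < pi / 2" "\<eta> n < pi" for n
    proof -
      have "0 < \<eta> n" "\<eta> n \<le> 1" by (auto simp: \<eta>_def divide_simps)
      then show "0 < \<eta> n" "\<eta> n < pi / 2" "\<eta> n < pi" using pi_gt3 by linarith+
    qed
    have \<eta>0: "\<eta> \<longlonglongrightarrow> 0" unfolding \<eta>_def by (rule LIMSEQ_inverse_real_of_nat)
    have lim: "(\<lambda>n. Q (Complex y (\<eta> n))) \<longlonglongrightarrow> q (Complex y 0)" for y
    proof -
      have "(\<lambda>n. q (Complex y (\<eta> n))) \<longlonglongrightarrow> q (Complex y 0)"
      proof (rule continuous_on_tendsto_compose[OF cq])
        show "(\<lambda>n. Complex y (\<eta> n)) \<longlonglongrightarrow> Complex y 0"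
          by (intro tendsto_Complex tendsto_const \<eta>0)
        show "Complex y 0 \<in> closure strip"
          by (rule closure_strip_bottom) auto
        show "\<forall>\<^sub>F n in sequentially. Complex y (\<eta> n) \<in> closure strip"
          using \<eta> by (intro always_eventually allI closure_strip_bottom) (auto intro: less_imp_le)
      qed
      moreover have "q (Complex y (\<eta> n)) = Q (Complex y (\<eta> n))" for n
        using q(2)[of "Complex y (\<eta> n)"] \<eta> by (simp add: strip_def)
      ultimately show ?thesis by simp
    qed
    have est: "norm (Q (Complex x' (\<eta> n)) - Q (Complex x (\<eta> n))) \<le> C * sqrt (\<eta> n)" for n
    proof -
      have st: "Complex s (\<eta> n) \<in> strip" for s
        using \<eta> by (simp add: strip_def)
      have "((\<lambda>s. Q (Complex s (\<eta> n))) has_vector_derivative R (Complex s (\<eta> n))) (at s within {x..x'})" for s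
      proof -
        have "((\<lambda>s. Q (complex_of_real s + \<i> * \<eta> n)) has_vector_derivative 1 * R (Complex s (\<eta> n))) (at s within {x..x'})"
          by (rule field_vector_diff_chain_within[of "\<lambda>s. complex_of_real s + \<i> * \<eta> n", unfolded o_def])
             (use Q'[OF st[of s]] in
               \<open>auto intro!: derivative_eq_intros has_vector_derivative_real_field simp: Complex_eq intro: has_field_derivative_at_within\<close>)
        then show ?thesis by (simp add: Complex_eq)
      qed
      from fundamental_theorem_of_calculus[OF x(2) this]
      have ft: "((\<lambda>s. R (Complex s (\<eta> n))) has_integral Q (Complex x' (\<eta> n)) - Q (Complex x (\<eta> n))) {x..x'}" .
      have cont: "continuous_on A (\<lambda>s. norm (R (Complex s (\<eta> n))))" for A
        using st by (intro continuous_intros continuous_on_compose2[OF holomorphic_on_imp_continuous_on[OF R]])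
           (auto simp: Complex_eq intro!: continuous_intros)
      have i: "(\<lambda>s. norm (R (Complex s (\<eta> n)))) integrable_on {a..b}" for a b
        by (intro integrable_continuous_interval cont)
      have "norm (Q (Complex x' (\<eta> n)) - Q (Complex x (\<eta> n))) = norm (integral {x..x'} (\<lambda>s. R (Complex s (\<eta> n))))"
        using integral_unique[OF ft] by simp
      also have "\<dots> \<le> integral {x..x'} (\<lambda>s. norm (R (Complex s (\<eta> n))))"
        using ft by (intro integral_norm_bound_integral i) (auto intro: has_integral_integrable)
      also have "\<dots> \<le> integral {x1..x2} (\<lambda>s. norm (R (Complex s (\<eta> n))))"
        using x by (intro integral_subset_le i) auto
      also have "\<dots> \<le> C * sqrt (\<eta> n)"
        by (rule int[OF \<eta>(1,2)])
      finally show ?thesis .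
    qed
    have "(\<lambda>n. norm (Q (Complex x' (\<eta> n)) - Q (Complex x (\<eta> n)))) \<longlonglongrightarrow> norm (q (Complex x' 0) - q (Complex x 0))"
      by (intro tendsto_intros lim)
    moreover have "(\<lambda>n. C * sqrt (\<eta> n)) \<longlonglongrightarrow> C * sqrt 0"
      by (intro tendsto_intros \<eta>0)
    ultimately have "norm (q (Complex x' 0) - q (Complex x 0)) \<le> C * sqrt 0"
      by (rule LIMSEQ_le) (use est in auto)
    then show ?thesis by simp
  qed
  define k where "k = q (Complex x1 0)"
  define S where "S = {z. x1 < Re z} \<inter> {z. Re z < x2} \<inter> {z. - pi < Im z} \<inter> {z. Im z < pi}"
  have S: "open S" "convex S"
    unfolding S_def by (intro open_Int convex_Int open_halfspace_Im_gt open_halfspace_Im_lt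
        open_halfspace_Re_gt open_halfspace_Re_lt convex_halfspace_Im_gt convex_halfspace_Im_lt
        convex_halfspace_Re_gt convex_halfspace_Re_lt)+
  \<comment> \<open>Subtracting \<open>k\<close> makes the values on the real axis 0, in particular
    real, as the reflection principle demands.\<close>
  define h where "h = (\<lambda>z. if 0 \<le> Im z then q z - k else cnj (q (cnj z) - k))"
  have SR: "q z = k" if "z \<in> S" "z \<in> \<real>" for z
    using bottom[of x1 "Re z"] that by (auto simp: S_def k_def complex_is_Real_iff complex_eq_iff Complex_eq elim!: Reals_cases)
  have h: "h holomorphic_on S"
    unfolding h_def
  proof (rule Schwarz_reflection[OF S(1)])
    show "cnj ` S \<subseteq> S" by (auto simp: S_def)
    have "q holomorphic_on strip"
      using Q' q(2) open_strip
      by (subst holomorphic_cong[OF refl, of _ q Q]) (auto simp: holomorphic_on_open)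
    then show "(\<lambda>z. q z - k) holomorphic_on S \<inter> {z. 0 < Im z}"
      by (intro holomorphic_intros) (auto elim!: holomorphic_on_subset simp: S_def strip_def)
    have "S \<inter> {z. 0 \<le> Im z} \<subseteq> closure strip"
      using closure_strip_bottom by (auto simp: S_def)
    then show "continuous_on (S \<inter> {z. 0 \<le> Im z}) (\<lambda>z. q z - k)"
      by (intro continuous_intros continuous_on_subset[OF cq])
    show "q z - k \<in> \<real>" if "z \<in> S" "z \<in> \<real>" for z
      using SR[OF that] by simp
  qed
  define m where "m = complex_of_real ((x1 + x2) / 2)"
  have h0: "h w = 0" if "w \<in> S" for w
  proof (rule analytic_continuation[OF h S(1) convex_connected[OF S(2)]])
    show "S \<inter> \<real> \<subseteq> S" by simp
    show "m \<in> S" using x12 by (auto simp: S_def m_def)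
    show "m islimpt (S \<inter> \<real>)"
      unfolding islimpt_approachable
    proof (intro allI impI)
      fix e :: real assume "0 < e"
      define d where "d = min (e / 2) ((x2 - x1) / 4)"
      have "0 < d" "d < e" using \<open>0 < e\<close> x12 by (auto simp: d_def)
      moreover have "d \<le> (x2 - x1) / 4" unfolding d_def by (rule min.cobounded2)
      ultimately have d: "0 < d" "d < e" "d \<le> (x2 - x1) / 4" .
      show "\<exists>x'\<in>S \<inter> \<real>. x' \<noteq> m \<and> dist x' m < e"
        using d by (intro bexI[of _ "m + complex_of_real d"]) (auto simp: S_def m_def dist_norm field_simps)
    qed
    show "h z = 0" if "z \<in> S \<inter> \<real>" for z
      using SR[of z] that by (auto simp: h_def complex_is_Real_iff)
  qed (use that in auto)
  have zero: "R w = 0" if w: "w \<in> S \<inter> {z. 0 < Im z}" for w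
  proof -
    have ws: "w \<in> strip" and op: "open (S \<inter> {z. 0 < Im z})"
      using w S(1) by (auto simp: S_def strip_def intro!: open_Int open_halfspace_Im_gt)
    have "Q v = k" if "v \<in> S \<inter> {z. 0 < Im z}" for v
      using h0[of v] q(2)[of v] that by (auto simp: h_def S_def strip_def)
    then have "(Q has_field_derivative 0) (at w)"
      by (intro has_field_derivative_transform_within_open[OF DERIV_const op w]) simp
    with Q'[OF ws] show ?thesis by (rule DERIV_unique)
  qed
  have "m + \<i> \<in> S \<inter> {z. 0 < Im z}"
    using x12 pi_gt3 by (auto simp: S_def m_def)
  then have ne: "S \<inter> {z. 0 < Im z} \<noteq> {}" by blast
  have op: "open (S \<inter> {z. 0 < Im z})"
    by (intro open_Int S(1) open_halfspace_Im_gt)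
  have sub: "S \<inter> {z. 0 < Im z} \<subseteq> strip"
    by (auto simp: S_def strip_def)
  show ?thesis
    by (rule analytic_continuation_open[OF op open_strip ne convex_connected[OF convex_strip] sub R
          holomorphic_on_const zero z])
qed

text \<open>A vertical line over \<open>[x1, x2]\<close> meets the arc \<open>L\<close> near one of the two edges of the strip, where
  \<open>P\<close> is small; which edge it is may depend on the line, hence the product with the reflection.\<close>

lemma strip_degenerate:
  assumes G: "G holomorphic_on strip" "inj_on G strip" and B: "\<And>z. z \<in> strip \<Longrightarrow> norm (G z) \<le> B"
    and P: "P holomorphic_on strip" and M: "\<And>z. z \<in> strip \<Longrightarrow> norm (P z) \<le> M"
    and P': "\<And>z. z \<in> strip \<Longrightarrow> norm (deriv P z) \<le> M * norm (deriv G z)"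
    and x12: "x1 < x2"
    and arcs: "\<And>e \<eta>. 0 < e \<Longrightarrow> 0 < \<eta> \<Longrightarrow> \<eta> < pi / 2 \<Longrightarrow>
      \<exists>L. compact L \<and> connected L \<and> L \<subseteq> strip \<and> (\<forall>z\<in>L. norm (P z) \<le> e) \<and>
        (\<forall>z\<in>L. x1 \<le> Re z \<and> Re z \<le> x2 \<longrightarrow> Im z < \<eta> \<or> pi - \<eta> < Im z) \<and>
        (\<exists>z\<in>L. Re z \<le> x1) \<and> (\<exists>z\<in>L. x2 \<le> Re z)"
    and z: "z \<in> strip"
  shows "P z * cnj (P (cnj z + \<i> * pi)) = 0"
proof (rule strip_boundary_uniqueness[OF _ _ x12 _ z])
  have refl: "cnj w + \<i> * pi \<in> strip" if "w \<in> strip" for w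
    using that by (auto simp: strip_def)
  have M0: "0 \<le> M" using M[OF z] norm_ge_zero[of "P z"] by linarith
  have "(\<lambda>w. P (w + \<i> * pi)) holomorphic_on cnj ` strip"
    by (rule holomorphic_on_compose_gen[of "\<lambda>w. w + \<i> * pi" _ P, unfolded o_def, OF _ P])
       (auto intro!: holomorphic_intros refl)
  from holomorphic_on_compose_cnj_cnj[OF this open_strip]
  show "(\<lambda>w. P w * cnj (P (cnj w + \<i> * pi))) holomorphic_on strip"
    using P by (intro holomorphic_intros) (auto simp: o_def)
  show "norm (P w * cnj (P (cnj w + \<i> * pi))) \<le> M * M" if "w \<in> strip" for w
    using M[OF that] M[OF refl[OF that]] M0 by (auto simp: norm_mult intro!: mult_mono)
  define A where "A = measure lebesgue (cball (0 :: real^2) B)"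
  fix \<eta> :: real assume \<eta>: "0 < \<eta>" "\<eta> < pi / 2"
  define R where "R = (\<lambda>x. norm (P (Complex x \<eta>) * cnj (P (cnj (Complex x \<eta>) + \<i> * pi))))"
  have st: "Complex x y \<in> strip" if "0 < y" "y < pi" for x y
    using that by (simp add: strip_def)
  have R: "R x = norm (P (Complex x \<eta>)) * norm (P (Complex x (pi - \<eta>)))" for x
    by (simp add: R_def norm_mult Complex_eq algebra_simps)
  have "continuous_on {x1..x2} R"
    unfolding R
    by (intro continuous_intros continuous_on_compose2[OF holomorphic_on_imp_continuous_on[OF P]])
       (use \<eta> in \<open>auto simp: Complex_eq strip_def intro!: continuous_intros\<close>)
  then have iR: "R integrable_on {x1..x2}" by (rule integrable_continuous_interval)
  have "integral {x1..x2} R \<le> M * M * (A + (x2 - x1)) * sqrt \<eta> + e" if "0 < e" for e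
  proof -
    \<comment> \<open>The error \<open>M * e'\<close>, integrated over \<open>{x1..x2}\<close>, is
      then at most \<open>e\<close>; the summand 1 guards against \<open>M = 0\<close>.\<close>
    define e' where "e' = e / (M * (x2 - x1) + 1)"
    have pos: "0 < M * (x2 - x1) + 1" using M0 x12 by (intro add_nonneg_pos mult_nonneg_nonneg) auto
    have e': "0 < e'" "M * (x2 - x1) * e' \<le> e"
      using pos \<open>0 < e\<close> by (auto simp: e'_def field_simps)
    obtain L where L: "compact L" "connected L" "L \<subseteq> strip" "\<And>z. z \<in> L \<Longrightarrow> norm (P z) \<le> e'"
      "\<And>z. z \<in> L \<Longrightarrow> x1 \<le> Re z \<Longrightarrow> Re z \<le> x2 \<Longrightarrow> Im z < \<eta> \<or> pi - \<eta> < Im z"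
      "\<exists>z\<in>L. Re z \<le> x1" "\<exists>z\<in>L. x2 \<le> Re z"
      using arcs[OF e'(1) \<eta>] by metis
    \<comment> \<open>Being compact, \<open>L\<close> keeps a positive distance from both edges. The
      vertical integrals may therefore stop at height \<open>\<delta>\<close>, inside the strip, and
      the bounds obtained for them do not depend on \<open>\<delta>\<close>.\<close>
    have "\<exists>w\<in>L. \<forall>v\<in>L. min (Im w) (pi - Im w) \<le> min (Im v) (pi - Im v)"
      using L(1,6) by (intro continuous_attains_inf continuous_intros) auto
    then obtain w where w: "w \<in> L" "\<And>v. v \<in> L \<Longrightarrow> min (Im w) (pi - Im w) \<le> min (Im v) (pi - Im v)"
      by blast
    define \<delta> where "\<delta> = min \<eta> (min (Im w) (pi - Im w))"
    have \<delta>: "0 < \<delta>" "\<delta> \<le> \<eta>" using w(1) L(3) \<eta> by (auto simp: \<delta>_def strip_def)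
    have \<delta>L: "\<delta> \<le> Im v" "Im v \<le> pi - \<delta>" if "v \<in> L" for v
      using w(2)[OF that] by (auto simp: \<delta>_def)
    define V1 where "V1 = (\<lambda>x. integral {\<delta>..\<eta>} (\<lambda>y. norm (deriv G (Complex x y))))"
    define V2 where "V2 = (\<lambda>x. integral {pi - \<eta>..pi - \<delta>} (\<lambda>y. norm (deriv G (Complex x y))))"
    have V1: "continuous_on {x1..x2} V1" "integral {x1..x2} V1 \<le> sqrt \<eta> * (A + (x2 - x1)) / 2"
      unfolding V1_def A_def
      by (rule injective_holomorphic_variation_bound[OF open_strip G B, where h = \<eta>]; use \<delta> \<eta> x12 in \<open>simp add: strip_def\<close>)+
    have V2: "continuous_on {x1..x2} V2" "integral {x1..x2} V2 \<le> sqrt \<eta> * (A + (x2 - x1)) / 2"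
      unfolding V2_def A_def
      by (rule injective_holomorphic_variation_bound[OF open_strip G B, where h = \<eta>]; use \<delta> \<eta> x12 in \<open>simp add: strip_def\<close>)+
    \<comment> \<open>The integral of a non-integrable function is 0 by convention, so this holds
      for every \<open>x\<close>.\<close>
    have V0: "0 \<le> V1 x" "0 \<le> V2 x" for x
    proof -
      have "0 \<le> integral A f" if "\<And>y. 0 \<le> f y" for f :: "real \<Rightarrow> real" and A
        using that by (cases "f integrable_on A") (auto intro: integral_nonneg simp: not_integrable_integral)
      then show "0 \<le> V1 x" "0 \<le> V2 x" unfolding V1_def V2_def by simp_all
    qed
    \<comment> \<open>\<open>P\<close> is small at a point of \<open>L\<close> over
      \<open>x\<close>, hence nearly so at height \<open>\<eta>\<close> or
      \<open>pi - \<eta>\<close>, whichever edge is close. For the factor at the other height only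
      the bound \<open>M\<close> is available.\<close>
    have bound: "R x \<le> M * (e' + M * V1 x + M * V2 x)" if x: "x \<in> {x1..x2}" for x
    proof -
      have "{x1..x2} \<subseteq> Re ` L"
      proof -
        obtain a b where "a \<in> L" "Re a \<le> x1" "b \<in> L" "x2 \<le> Re b" using L(6,7) by blast
        moreover have "connected (Re ` L)"
          by (intro connected_continuous_image continuous_intros L(2))
        ultimately have "{Re a..Re b} \<subseteq> Re ` L" by (intro connected_contains_Icc) auto
        then show ?thesis using \<open>Re a \<le> x1\<close> \<open>x2 \<le> Re b\<close> by auto
      qed
      then obtain v where v: "v \<in> L" "x = Re v" using x by blast
      have cv: "v = Complex x (Im v)" using v(2) by simp
      have nonneg: "0 \<le> M * V1 x" "0 \<le> M * V2 x" using M0 V0 by auto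
      from L(5)[OF v(1)] x v(2) consider "Im v < \<eta>" | "pi - \<eta> < Im v" by auto
      then show ?thesis
      proof cases
        case 1
        have "norm (P (Complex x \<eta>) - P (Complex x (Im v))) \<le> M * V1 x"
          unfolding V1_def
          by (rule vertical_variation[OF open_strip P _ P' G(1)])
             (use 1 \<delta> \<delta>L[OF v(1)] \<eta> M0 in \<open>auto simp: strip_def\<close>)
        then have "norm (P (Complex x \<eta>)) \<le> e' + M * V1 x"
          using norm_triangle_sub[of "P (Complex x \<eta>)" "P (Complex x (Im v))"] L(4)[OF v(1)] cv by simp
        then have "norm (P (Complex x \<eta>)) \<le> e' + M * V1 x + M * V2 x" using nonneg by linarith
        moreover have "norm (P (Complex x (pi - \<eta>))) \<le> M" using \<eta> by (intro M st) auto
        ultimately show ?thesis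
          unfolding R by (subst mult.commute) (intro mult_mono; use M0 in auto)
      next
        case 2
        have "norm (P (Complex x (Im v)) - P (Complex x (pi - \<eta>))) \<le> M * V2 x"
          unfolding V2_def
          by (rule vertical_variation[OF open_strip P _ P' G(1)])
             (use 2 \<delta> \<delta>L[OF v(1)] \<eta> M0 in \<open>auto simp: strip_def\<close>)
        then have "norm (P (Complex x (pi - \<eta>))) \<le> e' + M * V2 x"
          using norm_triangle_sub[of "P (Complex x (pi - \<eta>))" "P (Complex x (Im v))"] L(4)[OF v(1)] cv
          by (simp add: norm_minus_commute)
        then have "norm (P (Complex x (pi - \<eta>))) \<le> e' + M * V1 x + M * V2 x" using nonneg by linarith
        moreover have "norm (P (Complex x \<eta>)) \<le> M" using \<eta> by (intro M st) auto
        ultimately show ?thesis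
          unfolding R by (intro mult_mono; use M0 in auto)
      qed
    qed
    have iV: "V1 integrable_on {x1..x2}" "V2 integrable_on {x1..x2}"
      using V1 V2 integrable_continuous_interval by blast+
    have hV: "((\<lambda>x. M * (e' + M * V1 x + M * V2 x)) has_integral
        M * (e' * (x2 - x1) + M * integral {x1..x2} V1 + M * integral {x1..x2} V2)) {x1..x2}"
      using has_integral_const_real[of e' x1 x2] x12
      by (intro has_integral_mult_right has_integral_add integrable_integral iV)
         (simp add: mult.commute)
    have "integral {x1..x2} R \<le> M * (e' * (x2 - x1) + M * integral {x1..x2} V1 + M * integral {x1..x2} V2)"
      using bound by (intro has_integral_le[OF integrable_integral[OF iR] hV]) auto
    also have "\<dots> \<le> M * (e' * (x2 - x1) + M * (sqrt \<eta> * (A + (x2 - x1)) / 2) + M * (sqrt \<eta> * (A + (x2 - x1)) / 2))"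
      using mult_left_mono[OF V1(2) M0] mult_left_mono[OF V2(2) M0] M0
      by (intro mult_left_mono) linarith+
    also have "\<dots> = M * M * (A + (x2 - x1)) * sqrt \<eta> + M * (x2 - x1) * e'"
      by (simp add: field_simps)
    also have "\<dots> \<le> M * M * (A + (x2 - x1)) * sqrt \<eta> + e" using e'(2) by simp
    finally show ?thesis .
  qed
  then show "integral {x1..x2} (\<lambda>x. norm (P (Complex x \<eta>) * cnj (P (cnj (Complex x \<eta>) + \<i> * pi))))
      \<le> M * M * (A + (x2 - x1)) * sqrt \<eta>"
    unfolding R_def[symmetric] by (rule field_le_epsilon)
qed

section \<open>Crosscuts and the spherical metric\<close>

lemma norm_stereo: "norm (stereo z) = 1"
proof -
  define q where "q = (norm z)\<^sup>2"
  have q: "0 \<le> q" by (simp add: q_def)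
  have "(norm (stereo z))\<^sup>2 = (2 / (1 + q))\<^sup>2 * q + ((q - 1) / (q + 1))\<^sup>2"
    by (simp add: stereo_def norm_Pair q_def power_mult_distrib power_divide)
  also have "\<dots> = (4 * q + (q - 1)\<^sup>2) / (q + 1)\<^sup>2"
    by (simp add: power_divide add_divide_distrib add.commute)
  also have "4 * q + (q - 1)\<^sup>2 = (q + 1)\<^sup>2"
    by (simp add: power2_eq_square algebra_simps)
  also have "(q + 1)\<^sup>2 / (q + 1)\<^sup>2 = 1"
    using q by simp
  finally show ?thesis
    using abs_square_eq_1[of "norm (stereo z)"] by simp
qed

lemma one_minus_snd_stereo: "1 - snd (stereo z) = 2 / (1 + (norm z)\<^sup>2)"
proof -
  have "1 + (norm z)\<^sup>2 \<noteq> 0" using zero_le_power2[of "norm z"] by linarith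
  then show ?thesis by (simp add: stereo_def field_simps)
qed

text \<open>Projection from the pole \<open>(0, 1)\<close>, which stands for infinity; it inverts
  \<open>stereo\<close> on the rest of the unit sphere.\<close>

definition unstereo :: "complex \<times> real \<Rightarrow> complex" where
  "unstereo p = (1 / (1 - snd p)) *\<^sub>R fst p"

lemma snd_stereo_ne_1: "snd (stereo z) \<noteq> 1"
proof -
  have "1 + (norm z)\<^sup>2 \<noteq> 0" using zero_le_power2[of "norm z"] by linarith
  then show ?thesis using one_minus_snd_stereo[of z] by auto
qed

lemma unstereo_stereo [simp]: "unstereo (stereo z) = z"
proof -
  have "1 + (norm z)\<^sup>2 \<noteq> 0" using zero_le_power2[of "norm z"] by linarith
  then have "1 / (2 / (1 + (norm z)\<^sup>2)) * (2 / (1 + (norm z)\<^sup>2)) = 1" by simp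
  then show ?thesis
    unfolding unstereo_def one_minus_snd_stereo
    by (simp only: stereo_def fst_conv scaleR_scaleR scaleR_one)
qed

lemma stereo_unstereo:
  assumes "norm p = 1" "snd p \<noteq> 1"
  shows "stereo (unstereo p) = p"
proof -
  obtain w t where p: "p = (w, t)" by (cases p)
  have "(norm p)\<^sup>2 = 1" using assms by simp
  then have wt: "(norm w)\<^sup>2 + t\<^sup>2 = 1" by (simp add: p norm_Pair)
  have t: "1 - t \<noteq> 0" using assms by (simp add: p)
  have n: "(norm (unstereo p))\<^sup>2 = (1 + t) / (1 - t)"
  proof -
    have "(norm (unstereo p))\<^sup>2 = (1 - t\<^sup>2) / (1 - t)\<^sup>2"
      using wt by (simp add: unstereo_def p power_divide)
    also have "1 - t\<^sup>2 = (1 + t) * (1 - t)" by (simp add: power2_eq_square algebra_simps)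
    finally show ?thesis using t by (simp add: power2_eq_square)
  qed
  have "1 + (norm (unstereo p))\<^sup>2 = 2 / (1 - t)" "(norm (unstereo p))\<^sup>2 - 1 = 2 * t / (1 - t)"
    unfolding n using t by (simp_all add: field_simps)
  then show ?thesis
    unfolding stereo_def using t by (simp add: p unstereo_def add.commute)
qed

lemma continuous_on_unstereo: "continuous_on {p. snd p \<noteq> 1} unstereo"
  unfolding unstereo_def by (intro continuous_intros) auto

lemma dist_stereo_le_diameter:
  assumes "z \<in> C" "z' \<in> C"
  shows "dist (stereo z) (stereo z') \<le> diameter (stereo ` C)"
proof (rule diameter_bounded_bound)
  show "bounded (stereo ` C)"
    by (rule boundedI[of _ 1]) (auto simp: norm_stereo)
qed (use assms in auto)

text \<open>By compactness of the sphere, points chosen from the sets have a convergent subsequence,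
  and the vanishing diameters carry the whole sets along. A limit at the pole gives the second
  alternative.\<close>

lemma stereo_cluster:
  assumes ne: "\<And>n. C n \<noteq> {}" and diam: "(\<lambda>n. diameter (stereo ` C n)) \<longlonglongrightarrow> 0"
  obtains r :: "nat \<Rightarrow> nat" where "strict_mono r"
    "(\<exists>c. \<forall>e>0. \<forall>\<^sub>F n in sequentially. \<forall>z\<in>C (r n). dist z c < e) \<or>
     (\<forall>K. \<forall>\<^sub>F n in sequentially. \<forall>z\<in>C (r n). K < norm z)"
proof -
  obtain x where x: "\<And>n. x n \<in> C n" using ne by (meson all_not_in_conv)
  have "compact (sphere (0 :: complex \<times> real) 1)" by simp
  then obtain p r where pr: "p \<in> sphere 0 1" "strict_mono r" "((\<lambda>n. stereo (x n)) \<circ> r) \<longlonglongrightarrow> p"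
    unfolding compact_def using norm_stereo by (metis mem_sphere_0)
  have unif: "\<forall>\<^sub>F n in sequentially. \<forall>z\<in>C (r n). dist (stereo z) p < d" if "0 < d" for d
  proof -
    have "\<forall>\<^sub>F n in sequentially. dist (stereo (x (r n))) p < d / 2"
      using tendstoD[OF pr(3), of "d / 2"] that by simp
    moreover have "\<forall>\<^sub>F n in sequentially. diameter (stereo ` C (r n)) < d / 2"
      using order_tendstoD(2)[OF LIMSEQ_subseq_LIMSEQ[OF diam pr(2)], of "d / 2"] that by (simp add: o_def)
    ultimately show ?thesis
    proof eventually_elim
      case (elim n)
      show ?case
      proof
        fix z assume "z \<in> C (r n)"
        then have "dist (stereo z) (stereo (x (r n))) < d / 2"
          using dist_stereo_le_diameter[OF _ x, of z "r n"] elim(2) by simp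
        with elim(1) show "dist (stereo z) p < d"
          using dist_triangle_half_l[of "stereo z" "stereo (x (r n))" d p] by (simp add: dist_commute dist_triangle_half_r)
      qed
    qed
  qed
  show ?thesis
  proof (cases "snd p = 1")
    case True
    have "\<forall>\<^sub>F n in sequentially. \<forall>z\<in>C (r n). K < norm z" for K
    proof -
      \<comment> \<open>This is the value of \<open>1 - snd (stereo z)\<close> for points with
        \<open>norm z = \<bar>K\<bar>\<close>.\<close>
      define d where "d = 2 / (1 + K\<^sup>2)"
      have d: "0 < d" by (simp add: d_def add_pos_nonneg)
      from unif[OF d] show ?thesis
      proof eventually_elim
        case (elim n)
        show ?case
        proof
          fix z assume "z \<in> C (r n)"
          then have "dist (snd (stereo z)) (snd p) < d"
            using elim dist_snd_le[of "stereo z" p] by force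
          then have "1 - snd (stereo z) < d" using True by (simp add: dist_real_def)
          then have "2 / (1 + (norm z)\<^sup>2) < 2 / (1 + K\<^sup>2)"
            unfolding one_minus_snd_stereo d_def .
          moreover have "0 < 1 + (norm z)\<^sup>2" "0 < 1 + K\<^sup>2" by (simp_all add: add_pos_nonneg)
          ultimately have "K\<^sup>2 < (norm z)\<^sup>2" by (simp add: field_simps)
          then show "K < norm z" by (rule power_less_imp_less_base) simp
        qed
      qed
    qed
    then show ?thesis using that pr(2) by blast
  next
    case False
    have op: "open {p :: complex \<times> real. snd p \<noteq> 1}"
      by (intro open_Collect_neq continuous_intros)
    have "isCont unstereo p"
      using continuous_on_unstereo[unfolded continuous_on_eq_continuous_at[OF op]] False by blast
    have "\<forall>\<^sub>F n in sequentially. \<forall>z\<in>C (r n). dist z (unstereo p) < e" if "0 < e" for e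
    proof -
      obtain d where d: "0 < d" "\<And>p'. dist p' p < d \<Longrightarrow> dist (unstereo p') (unstereo p) < e"
        using \<open>isCont unstereo p\<close> \<open>0 < e\<close> unfolding continuous_at_eps_delta by blast
      have "dist z (unstereo p) < e" if "dist (stereo z) p < d" for z
        using d(2)[OF that] by simp
      with unif[OF d(1)] show ?thesis
        by (auto elim!: eventually_mono)
    qed
    then show ?thesis using that pr(2) by blast
  qed
qed

section \<open>Crosscuts and compact subsets\<close>

lemma closed_sphere_minus_stereo:
  assumes "open \<Omega>"
  shows "closed (sphere 0 1 - stereo ` \<Omega>)"
proof -
  have op: "open {p :: complex \<times> real. snd p \<noteq> 1}"
    by (intro open_Collect_neq continuous_intros)
  have "open ({p. snd p \<noteq> 1} \<inter> unstereo -` \<Omega>)"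
    by (rule continuous_open_preimage[OF continuous_on_unstereo op assms])
  moreover have "sphere 0 1 - stereo ` \<Omega> = sphere 0 1 - ({p. snd p \<noteq> 1} \<inter> unstereo -` \<Omega>)"
  proof -
    have "p \<in> stereo ` \<Omega> \<longleftrightarrow> snd p \<noteq> 1 \<and> unstereo p \<in> \<Omega>" if "norm p = 1" for p
      using stereo_unstereo[OF that] snd_stereo_ne_1 unstereo_stereo by (metis image_iff)
    then show ?thesis by (auto simp: snd_stereo_ne_1)
  qed
  ultimately show ?thesis by (simp add: closed_Diff)
qed

lemma sphere_boundary_subset: "sphere_boundary \<Omega> \<subseteq> sphere 0 1 - stereo ` \<Omega>"
proof -
  have "closure (stereo ` \<Omega>) \<subseteq> sphere 0 1"
    by (rule closure_minimal) (auto simp: norm_stereo)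
  then show ?thesis by (auto simp: sphere_boundary_def)
qed

lemma continuous_on_stereo: "continuous_on A stereo"
proof -
  have "1 + (norm z)\<^sup>2 \<noteq> 0" "(norm z)\<^sup>2 + 1 \<noteq> 0" for z :: complex
    using zero_le_power2[of "norm z"] by linarith+
  then show ?thesis
    unfolding stereo_def by (intro continuous_intros) auto
qed

text \<open>The compact closed arc adds to the crosscut only its two end points, which do not come
  from \<open>\<Omega>\<close>; hence the crosscut is closed relative to \<open>\<Omega>\<close>.
  The boundary point in its closure is the initial point of the arc.\<close>

lemma crosscut_props:
  assumes \<Omega>: "open \<Omega>" and C: "crosscut \<Omega> C"
  shows "C \<subseteq> \<Omega>" "C \<noteq> {}" "path_connected C" "closedin (top_of_set \<Omega>) C"
    "\<exists>p\<in>sphere_boundary \<Omega>. p \<in> closure (stereo ` C)"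
proof -
  obtain g where g: "C \<subseteq> \<Omega>" "simple_path g" "g 0 \<in> sphere_boundary \<Omega>" "g 1 \<in> sphere_boundary \<Omega>"
    "stereo ` C = g ` {0<..<1}"
    using C by (auto simp: crosscut_def)
  show "C \<subseteq> \<Omega>" by (rule g)
  have cg: "continuous_on {0..1} g"
    using g(2) by (simp add: simple_path_def path_def)
  have C_eq: "C = unstereo ` g ` {0<..<1}"
    unfolding g(5)[symmetric] by (simp add: image_image)
  show "C \<noteq> {}" unfolding C_eq by simp
  have "continuous_on (g ` {0<..<1}) unstereo"
    unfolding g(5)[symmetric] using snd_stereo_ne_1
    by (intro continuous_on_subset[OF continuous_on_unstereo]) auto
  then show "path_connected C"
    unfolding C_eq
    by (intro path_connected_continuous_image continuous_on_subset[OF cg] convex_imp_path_connected) auto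
  have "C = \<Omega> \<inter> stereo -` (g ` {0..1})"
  proof
    have "g ` {0<..<1} \<subseteq> g ` {0..1}" by (intro image_mono) auto
    then have "stereo z \<in> g ` {0..1}" if "z \<in> C" for z
      using imageI[OF that, of stereo] g(5) by auto
    then show "C \<subseteq> \<Omega> \<inter> stereo -` (g ` {0..1})"
      using g(1) by auto
    show "\<Omega> \<inter> stereo -` (g ` {0..1}) \<subseteq> C"
    proof
      fix z assume "z \<in> \<Omega> \<inter> stereo -` (g ` {0..1})"
      then obtain s where s: "s \<in> {0..1}" "stereo z = g s" "z \<in> \<Omega>" by auto
      have "g 0 \<notin> stereo ` \<Omega>" "g 1 \<notin> stereo ` \<Omega>"
        using g(3,4) by (simp_all add: sphere_boundary_def)
      moreover have "g s \<in> stereo ` \<Omega>"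
        using imageI[OF s(3), of stereo] s(2) by simp
      ultimately have "s \<noteq> 0" "s \<noteq> 1" by metis+
      then have "stereo z \<in> stereo ` C" unfolding g(5) using s by auto
      then show "z \<in> C" by (metis image_iff unstereo_stereo)
    qed
  qed
  moreover have "closed (g ` {0..1})"
    by (intro compact_imp_closed compact_continuous_image cg) simp
  ultimately show "closedin (top_of_set \<Omega>) C"
    using continuous_closedin_preimage[OF continuous_on_stereo] by metis
  have "g 0 \<in> closure (g ` {0<..<1})"
  proof -
    have "g ` closure {0<..<1::real} \<subseteq> closure (g ` {0<..<1})"
      by (rule image_closure_subset) (auto intro: continuous_on_subset[OF cg] closure_subset[THEN subsetD])
    then show ?thesis by auto
  qed
  then show "\<exists>p\<in>sphere_boundary \<Omega>. p \<in> closure (stereo ` C)"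
    using g(3,5) by auto
qed

text \<open>A crosscut has a boundary point in its closure, so one of small diameter is close to the
  complement of \<open>\<Omega>\<close> in the sphere, whereas \<open>K\<close> has a positive
  distance from that complement.\<close>

lemma crosscuts_leave_compacts:
  assumes \<Omega>: "open \<Omega>" and C: "\<And>n. crosscut \<Omega> (C n)"
    and diam: "(\<lambda>n. diameter (stereo ` C n)) \<longlonglongrightarrow> 0" and K: "compact K" "K \<subseteq> \<Omega>"
  shows "\<forall>\<^sub>F n in sequentially. C n \<inter> K = {}"
proof -
  have "compact (stereo ` K)" by (rule compact_continuous_image[OF continuous_on_stereo K(1)])
  moreover have "stereo ` K \<inter> (sphere 0 1 - stereo ` \<Omega>) = {}" using K(2) by auto
  ultimately obtain d where d: "0 < d"
    "\<forall>x\<in>stereo ` K. \<forall>y\<in>sphere 0 1 - stereo ` \<Omega>. d \<le> dist x y"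
    using separate_compact_closed[OF _ closed_sphere_minus_stereo[OF \<Omega>]] by metis
  have "\<forall>\<^sub>F n in sequentially. diameter (stereo ` C n) < d"
    using order_tendstoD(2)[OF diam d(1)] .
  then show ?thesis
  proof eventually_elim
    case (elim n)
    have bd: "bounded (stereo ` C n)"
      by (rule boundedI[of _ 1]) (auto simp: norm_stereo)
    obtain p where p: "p \<in> sphere_boundary \<Omega>" "p \<in> closure (stereo ` C n)"
      using crosscut_props(5)[OF \<Omega> C] by blast
    have "dist (stereo z) p < d" if "z \<in> C n" for z
    proof -
      have "dist (stereo z) p \<le> diameter (closure (stereo ` C n))"
        using that p(2) bounded_closure[OF bd] closure_subset[of "stereo ` C n"]
        by (intro diameter_bounded_bound) auto
      then show ?thesis using elim bd by (simp add: diameter_closure)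
    qed
    moreover have "d \<le> dist (stereo z) p" if "z \<in> K" for z
      using d(2) that p(1) sphere_boundary_subset by blast
    ultimately show ?case by force
  qed
qed

section \<open>Bounded substitutes for the inverse chart, and the crossing argument\<close>

lemma quadratic_bounds:
  fixes G :: "complex \<Rightarrow> complex"
  assumes G: "G holomorphic_on strip" and B: "\<And>z. z \<in> strip \<Longrightarrow> norm (G z) \<le> B"
  obtains M where "\<And>z. z \<in> strip \<Longrightarrow> norm (\<alpha> * (G z)\<^sup>2 + \<beta> * G z + \<gamma>) \<le> M"
    "\<And>z. z \<in> strip \<Longrightarrow> norm (deriv (\<lambda>z. \<alpha> * (G z)\<^sup>2 + \<beta> * G z + \<gamma>) z) \<le> M * norm (deriv G z)"
proof
  define M1 where "M1 = norm \<alpha> * B\<^sup>2 + norm \<beta> * B + norm \<gamma>"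
  define M2 where "M2 = 2 * norm \<alpha> * B + norm \<beta>"
  fix z assume z: "z \<in> strip"
  have B0: "0 \<le> B" using order_trans[OF norm_ge_zero B[OF z]] .
  have M: "0 \<le> M1" "0 \<le> M2" using B0 by (simp_all add: M1_def M2_def)
  have "norm (\<alpha> * (G z)\<^sup>2 + \<beta> * G z + \<gamma>) \<le> norm \<alpha> * (norm (G z))\<^sup>2 + norm \<beta> * norm (G z) + norm \<gamma>"
    by (intro norm_triangle_mono) (simp_all add: norm_mult norm_power)
  also have "\<dots> \<le> M1"
    unfolding M1_def by (intro add_mono mult_left_mono power_mono B z) auto
  finally show "norm (\<alpha> * (G z)\<^sup>2 + \<beta> * G z + \<gamma>) \<le> M1 + M2" using M by simp
  have "deriv (\<lambda>z. \<alpha> * (G z)\<^sup>2 + \<beta> * G z + \<gamma>) z = (2 * \<alpha> * G z + \<beta>) * deriv G z"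
    using holomorphic_derivI[OF G open_strip z]
    by (intro DERIV_imp_deriv) (auto intro!: derivative_eq_intros simp: algebra_simps)
  moreover have "norm (2 * \<alpha> * G z + \<beta>) \<le> M2"
  proof -
    have "norm (2 * \<alpha> * G z + \<beta>) \<le> 2 * norm \<alpha> * norm (G z) + norm \<beta>"
      by (intro norm_triangle_mono) (simp_all add: norm_mult)
    also have "\<dots> \<le> M2" unfolding M2_def by (intro add_mono mult_left_mono B z) auto
    finally show ?thesis .
  qed
  ultimately show "norm (deriv (\<lambda>z. \<alpha> * (G z)\<^sup>2 + \<beta> * G z + \<gamma>) z) \<le> (M1 + M2) * norm (deriv G z)"
    using M by (auto simp: norm_mult intro!: mult_right_mono)
qed

text \<open>The classical square root trick: a square root \<open>S\<close> of \<open>F - p\<close> is injective, and since \<open>S\<close> and \<open>- S\<close>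
  have disjoint ranges it omits a disc around some \<open>q\<close>; take \<open>G = 1 / (S - q)\<close>.\<close>

lemma injective_bounded_substitute:
  assumes F: "F holomorphic_on strip" "inj_on F strip" "p \<notin> F ` strip"
  obtains G q B where "G holomorphic_on strip" "inj_on G strip"
    "\<And>z. z \<in> strip \<Longrightarrow> norm (G z) \<le> B" "\<And>z. z \<in> strip \<Longrightarrow> G z \<noteq> 0"
    "\<And>z. z \<in> strip \<Longrightarrow> (G z)\<^sup>2 * (F z - p) = (q * G z + 1)\<^sup>2"
proof -
  have "simply_connected strip"
    by (rule convex_imp_simply_connected[OF convex_strip])
  then have sqrt: "\<forall>f. f holomorphic_on strip \<and> (\<forall>z\<in>strip. f z \<noteq> 0) \<longrightarrow>
      (\<exists>g. g holomorphic_on strip \<and> (\<forall>z\<in>strip. f z = (g z)\<^sup>2))"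
    using simply_connected_eq_holomorphic_sqrt[OF open_strip] by simp
  have "(\<lambda>z. F z - p) holomorphic_on strip" "\<forall>z\<in>strip. F z - p \<noteq> 0"
    using F by (auto intro!: holomorphic_intros)
  then obtain S where S: "S holomorphic_on strip" "\<And>z. z \<in> strip \<Longrightarrow> F z - p = (S z)\<^sup>2"
    using sqrt[rule_format, of "\<lambda>z. F z - p"] by blast
  have injS: "inj_on S strip"
  proof (rule inj_onI)
    fix z w assume zw: "z \<in> strip" "w \<in> strip" "S z = S w"
    then have "F z - p = F w - p" using S(2) by simp
    then show "z = w" using inj_onD[OF F(2)] zw by simp
  qed
  \<comment> \<open>Equal squares mean equal values of \<open>F\<close>, so \<open>z = w\<close> by
    injectivity and then \<open>S z = 0\<close>; but \<open>F\<close> omits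
    \<open>p\<close>.\<close>
  have neg: "S z \<noteq> - S w" if "z \<in> strip" "w \<in> strip" for z w
  proof
    assume *: "S z = - S w"
    then have "F z - p = F w - p" using S(2) that by simp
    then have "z = w" using F(2) that by (auto simp: inj_on_def)
    then have "S z = 0" using * by (simp add: eq_neg_iff_add_eq_0 flip: mult_2)
    then show False using S(2)[OF that(1)] F(3) that(1) by auto
  qed
  define z0 where "z0 = \<i>"
  have z0: "z0 \<in> strip" using pi_gt3 by (simp add: z0_def strip_def)
  have "open (S ` strip)" by (rule open_mapping_thm3[OF S(1) open_strip injS])
  then obtain r where r: "0 < r" "ball (S z0) r \<subseteq> S ` strip"
    using z0 unfolding open_contains_ball by blast
  define q where "q = - S z0"
  have away: "r \<le> norm (S z - q)" if "z \<in> strip" for z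
  proof (rule ccontr)
    assume "\<not> ?thesis"
    then have "norm (S z0 - - S z) < r" by (simp add: q_def add.commute)
    then have "- S z \<in> S ` strip" using r(2) by (auto simp: dist_norm subset_iff)
    then obtain w where "w \<in> strip" "S w = - S z" by (metis imageE)
    then show False using neg that by metis
  qed
  have nz: "S z - q \<noteq> 0" if "z \<in> strip" for z using away[OF that] r(1) by auto
  show ?thesis
  proof (rule that[of "\<lambda>z. 1 / (S z - q)" "1 / r" q])
    show "(\<lambda>z. 1 / (S z - q)) holomorphic_on strip" by (intro holomorphic_intros S nz)
    show "inj_on (\<lambda>z. 1 / (S z - q)) strip"
      using injS by (auto simp: inj_on_def)
    show "norm (1 / (S z - q)) \<le> 1 / r" if "z \<in> strip" for z
      using away[OF that] r(1) by (simp add: norm_divide frac_le)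
    show "1 / (S z - q) \<noteq> 0" if "z \<in> strip" for z using nz[OF that] by simp
    \<comment> \<open>This is \<open>S = q + 1 / G\<close>, squared. It is how \<open>F\<close> is
      recovered from \<open>G\<close>.\<close>
    show "(1 / (S z - q))\<^sup>2 * (F z - p) = (q * (1 / (S z - q)) + 1)\<^sup>2" if "z \<in> strip" for z
      unfolding S(2)[OF that] power_mult_distrib[symmetric] using nz[OF that]
      by (simp add: field_simps)
  qed
qed

text \<open>A form of Koebe's lemma for the inverse \<open>F\<close> of the chart. If infinitely
  many crosscuts crossed, \<open>F\<close> would be close to one point of the sphere on arcs that
  approach the edges; the degenerate function this yields contradicts the injectivity of
  \<open>F\<close>.\<close>

lemma strip_chart_no_crossing:
  assumes \<Omega>: "open \<Omega>" "\<Omega> \<noteq> UNIV" and \<kappa>: "conformal_map \<kappa> \<Omega> strip"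
    and C: "\<And>n. crosscut \<Omega> (C n)" and diam: "(\<lambda>n. diameter (stereo ` C n)) \<longlonglongrightarrow> 0"
    and x12: "x1 < x2"
  shows "\<forall>\<^sub>F n in sequentially. \<not> ((\<exists>z\<in>C n. Re (\<kappa> z) \<le> x1) \<and> (\<exists>z\<in>C n. x2 \<le> Re (\<kappa> z)))"
proof (rule ccontr)
  define cross where "cross = (\<lambda>n. (\<exists>z\<in>C n. Re (\<kappa> z) \<le> x1) \<and> (\<exists>z\<in>C n. x2 \<le> Re (\<kappa> z)))"
  assume "\<not> ?thesis"
  then have "infinite {n. cross n}"
    \<comment> \<open>Two subsequences are taken in turn: along \<open>r0\<close> all crosscuts
      cross, and along \<open>r1\<close> they moreover cluster at one point of the sphere.\<close>
    unfolding cofinite_eq_sequentially[symmetric] eventually_cofinite cross_def by simp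
  then obtain r0 :: "nat \<Rightarrow> nat" where r0: "strict_mono r0" "\<And>n. cross (r0 n)"
    using infinite_enumerate by blast
  note Cp = crosscut_props[OF \<Omega>(1) C]
  have d0: "(\<lambda>n. diameter (stereo ` C (r0 n))) \<longlonglongrightarrow> 0"
    using LIMSEQ_subseq_LIMSEQ[OF diam r0(1)] by (simp add: o_def)
  obtain r1 :: "nat \<Rightarrow> nat" where r1: "strict_mono r1"
    and cl: "(\<exists>c. \<forall>e>0. \<forall>\<^sub>F n in sequentially. \<forall>z\<in>C (r0 (r1 n)). dist z c < e) \<or>
     (\<forall>K. \<forall>\<^sub>F n in sequentially. \<forall>z\<in>C (r0 (r1 n)). K < norm z)"
    by (rule stereo_cluster[of "\<lambda>n. C (r0 n)", OF Cp(2) d0]) (rule that)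
  define D where "D = (\<lambda>n. C (r0 (r1 n)))"
  have D: "D n \<subseteq> \<Omega>" "path_connected (D n)" "cross (r0 (r1 n))" for n
    using Cp r0(2) by (auto simp: D_def)
  have leave: "\<forall>\<^sub>F n in sequentially. D n \<inter> K = {}" if "compact K" "K \<subseteq> \<Omega>" for K
    using eventually_subseq[OF strict_mono_o[OF r0(1) r1] crosscuts_leave_compacts[OF \<Omega>(1) C diam that]]
    by (simp add: D_def o_def)
  note \<kappa>p = conformal_map_props[OF \<kappa> \<Omega>(1)]
  obtain F where "conformal_map F strip \<Omega> \<and> (\<forall>z\<in>\<Omega>. F (\<kappa> z) = z) \<and> (\<forall>z\<in>strip. \<kappa> (F z) = z)"
    using conformal_map_inverse[OF \<kappa> \<Omega>(1)] by (rule exE)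
  then have Fc: "conformal_map F strip \<Omega>" and F\<kappa>: "\<And>z. z \<in> \<Omega> \<Longrightarrow> F (\<kappa> z) = z"
    by simp_all
  note Fp = conformal_map_props[OF Fc open_strip]
  obtain p where p: "p \<notin> \<Omega>" using \<Omega>(2) by auto
  obtain G q B where G: "G holomorphic_on strip" "inj_on G strip"
    and B: "\<And>z. z \<in> strip \<Longrightarrow> norm (G z) \<le> B" and G0: "\<And>z. z \<in> strip \<Longrightarrow> G z \<noteq> 0"
    and GF: "\<And>z. z \<in> strip \<Longrightarrow> (G z)\<^sup>2 * (F z - p) = (q * G z + 1)\<^sup>2"
    using injective_bounded_substitute[OF Fp(1,2), of p] p Fp(3) by metis
  have \<kappa>s: "\<kappa> z \<in> strip" if "z \<in> \<Omega>" for z using \<kappa>p(3) imageI[OF that, of \<kappa>] by simp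
  \<comment> \<open>\<open>P = G\<^sup>2 (F - c)\<close> if the crosscuts accumulate at the point \<open>c\<close>, and \<open>P = G\<^sup>2\<close> if they do so at
    infinity.\<close>
  have "\<exists>\<alpha> \<beta> \<gamma> c. (\<forall>e>0. \<forall>\<^sub>F n in sequentially. \<forall>z\<in>D n. norm (\<alpha> * (G (\<kappa> z))\<^sup>2 + \<beta> * G (\<kappa> z) + \<gamma>) \<le> e) \<and>
      (\<forall>z\<in>strip. \<alpha> * (G z)\<^sup>2 + \<beta> * G z + \<gamma> = 0 \<longrightarrow> F z = c)"
    using cl
  proof
    assume "\<exists>c. \<forall>e>0. \<forall>\<^sub>F n in sequentially. \<forall>z\<in>C (r0 (r1 n)). dist z c < e"
    then obtain c where c: "\<And>e. 0 < e \<Longrightarrow> \<forall>\<^sub>F n in sequentially. \<forall>z\<in>D n. dist z c < e"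
      unfolding D_def by blast
    \<comment> \<open>The factor \<open>G^2\<close> compensates a possible growth of
      \<open>F\<close>: since \<open>G^2 * (F - p) = (q * G + 1)^2\<close>, the product
      \<open>G^2 * (F - c)\<close> is a polynomial in the bounded function \<open>G\<close>.\<close>
    have P: "(q\<^sup>2 - c + p) * (G z)\<^sup>2 + 2 * q * G z + 1 = (G z)\<^sup>2 * (F z - c)" if "z \<in> strip" for z
      using GF[OF that] by (simp add: algebra_simps power2_eq_square)
    have "\<forall>\<^sub>F n in sequentially. \<forall>z\<in>D n. norm ((q\<^sup>2 - c + p) * (G (\<kappa> z))\<^sup>2 + 2 * q * G (\<kappa> z) + 1) \<le> e"
      if "0 < e" for e
    proof -
      have pos: "0 < B\<^sup>2 + 1" by (simp add: add_nonneg_pos)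
      then have "0 < e / (B\<^sup>2 + 1)" using that by simp
      from c[OF this] show ?thesis
      proof eventually_elim
        case (elim n)
        show ?case
        proof
          fix z assume z: "z \<in> D n"
          then have z\<Omega>: "z \<in> \<Omega>" using D(1) by blast
          have "norm ((G (\<kappa> z))\<^sup>2 * (z - c)) \<le> B\<^sup>2 * (e / (B\<^sup>2 + 1))"
            unfolding norm_mult norm_power using elim z
            by (intro mult_mono power_mono B \<kappa>s z\<Omega>) (auto simp: dist_norm less_imp_le)
          also have "\<dots> \<le> e" using pos \<open>0 < e\<close> by (simp add: field_simps)
          finally show "norm ((q\<^sup>2 - c + p) * (G (\<kappa> z))\<^sup>2 + 2 * q * G (\<kappa> z) + 1) \<le> e"
            unfolding P[OF \<kappa>s[OF z\<Omega>]] F\<kappa>[OF z\<Omega>] .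
        qed
      qed
    qed
    moreover have "F z = c" if "z \<in> strip" "(q\<^sup>2 - c + p) * (G z)\<^sup>2 + 2 * q * G z + 1 = 0" for z
      using that(2) G0[OF that(1)] unfolding P[OF that(1)] by simp
    ultimately show ?thesis by blast
  next
    assume inf: "\<forall>K. \<forall>\<^sub>F n in sequentially. \<forall>z\<in>C (r0 (r1 n)). K < norm z"
    have "\<forall>\<^sub>F n in sequentially. \<forall>z\<in>D n. norm (1 * (G (\<kappa> z))\<^sup>2 + 0 * G (\<kappa> z) + 0) \<le> e" if "0 < e" for e
    proof -
      \<comment> \<open>\<open>G^2 * (F - p) = (q * G + 1)^2\<close> is bounded, so
        \<open>G^2\<close> is small where \<open>F\<close> is large; \<open>K\<close> is that bound
        divided by \<open>e\<close>.\<close>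
      define K where "K = (norm q * B + 1)\<^sup>2 / e"
      have K0: "0 \<le> K" using \<open>0 < e\<close> by (simp add: K_def)
      have "\<forall>\<^sub>F n in sequentially. \<forall>z\<in>D n. norm p + K + 1 < norm z"
        using inf unfolding D_def by blast
      then show ?thesis
      proof eventually_elim
        case (elim n)
        show ?case
        proof
          fix z assume z: "z \<in> D n"
          then have z\<Omega>: "z \<in> \<Omega>" using D(1) by blast
          have zp: "K + 1 \<le> norm (z - p)"
            using elim z norm_triangle_ineq2[of z p] by force
          have "norm ((G (\<kappa> z))\<^sup>2) * (K + 1) \<le> norm ((G (\<kappa> z))\<^sup>2) * norm (z - p)"
            by (intro mult_left_mono zp) simp
          also have "\<dots> = (norm (q * G (\<kappa> z) + 1))\<^sup>2"
            using GF[OF \<kappa>s[OF z\<Omega>]] F\<kappa>[OF z\<Omega>] by (metis norm_mult norm_power)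
          also have "\<dots> \<le> (norm q * B + 1)\<^sup>2"
          proof (rule power_mono)
            have "norm (q * G (\<kappa> z) + 1) \<le> norm q * norm (G (\<kappa> z)) + 1"
              using norm_triangle_ineq[of "q * G (\<kappa> z)" 1] by (simp add: norm_mult)
            also have "\<dots> \<le> norm q * B + 1" by (intro add_right_mono mult_left_mono B \<kappa>s z\<Omega>) simp
            finally show "norm (q * G (\<kappa> z) + 1) \<le> norm q * B + 1" .
          qed simp
          also have "\<dots> = e * K" using \<open>0 < e\<close> by (simp add: K_def)
          also have "\<dots> \<le> e * (K + 1)" using \<open>0 < e\<close> by simp
          finally show "norm (1 * (G (\<kappa> z))\<^sup>2 + 0 * G (\<kappa> z) + 0) \<le> e"
            using K0 by simp
        qed
      qed
    qed
    \<comment> \<open>Without zeros the clause about \<open>c\<close> is vacuous, so any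
      \<open>c\<close> will do.\<close>
    moreover have "1 * (G z)\<^sup>2 + 0 * G z + 0 \<noteq> 0" if "z \<in> strip" for z
      using G0[OF that] by simp
    ultimately show ?thesis by blast
  qed
  then obtain \<alpha> \<beta> \<gamma> c where small: "\<And>e. 0 < e \<Longrightarrow> \<forall>\<^sub>F n in sequentially. \<forall>z\<in>D n.
        norm (\<alpha> * (G (\<kappa> z))\<^sup>2 + \<beta> * G (\<kappa> z) + \<gamma>) \<le> e"
    and zero: "\<And>z. z \<in> strip \<Longrightarrow> \<alpha> * (G z)\<^sup>2 + \<beta> * G z + \<gamma> = 0 \<Longrightarrow> F z = c"
    by blast
  define P where "P = (\<lambda>z. \<alpha> * (G z)\<^sup>2 + \<beta> * G z + \<gamma>)"
  have P: "P holomorphic_on strip" unfolding P_def by (intro holomorphic_intros G)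
  obtain M where M': "\<And>z. z \<in> strip \<Longrightarrow> norm (\<alpha> * (G z)\<^sup>2 + \<beta> * G z + \<gamma>) \<le> M"
    "\<And>z. z \<in> strip \<Longrightarrow> norm (deriv (\<lambda>z. \<alpha> * (G z)\<^sup>2 + \<beta> * G z + \<gamma>) z) \<le> M * norm (deriv G z)"
    by (rule quadratic_bounds[OF G(1) B, of \<alpha> \<beta> \<gamma>]) (assumption, rule that)
  have M: "norm (P z) \<le> M" "norm (deriv P z) \<le> M * norm (deriv G z)" if "z \<in> strip" for z
    using M'[OF that] by (simp_all add: P_def)
  have arcs: "\<exists>L. compact L \<and> connected L \<and> L \<subseteq> strip \<and> (\<forall>z\<in>L. norm (P z) \<le> e) \<and>
        (\<forall>z\<in>L. x1 \<le> Re z \<and> Re z \<le> x2 \<longrightarrow> Im z < \<eta> \<or> pi - \<eta> < Im z) \<and>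
        (\<exists>z\<in>L. Re z \<le> x1) \<and> (\<exists>z\<in>L. x2 \<le> Re z)" if e: "0 < e" and \<eta>: "0 < \<eta>" "\<eta> < pi / 2" for e \<eta>
  proof -
    \<comment> \<open>The part of the rectangle away from the edges. Its image under
      \<open>F\<close> is compact in \<open>\<Omega>\<close>, so late crosscuts miss it and can
      cross only near the edges.\<close>
    define K where "K = cbox (Complex x1 \<eta>) (Complex x2 (pi - \<eta>))"
    have K: "K \<subseteq> strip" using \<eta> by (auto simp: K_def strip_def in_cbox_complex_iff)
    have "compact (F ` K)"
      by (intro compact_continuous_image holomorphic_on_imp_continuous_on[OF holomorphic_on_subset[OF Fp(1) K]])
         (simp add: K_def)
    moreover have "F ` K \<subseteq> \<Omega>" using K Fp(3) by blast
    ultimately have "\<forall>\<^sub>F n in sequentially. D n \<inter> F ` K = {}" by (rule leave)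
    with small[OF e] have "\<forall>\<^sub>F n in sequentially. D n \<inter> F ` K = {} \<and> (\<forall>z\<in>D n. norm (P (\<kappa> z)) \<le> e)"
      unfolding P_def by (rule eventually_conj[rotated])
    then obtain n where n: "D n \<inter> F ` K = {}" "\<And>z. z \<in> D n \<Longrightarrow> norm (P (\<kappa> z)) \<le> e"
      using eventually_happens'[OF sequentially_bot] by blast
    obtain y y' where y: "y \<in> D n" "Re (\<kappa> y) \<le> x1" "y' \<in> D n" "x2 \<le> Re (\<kappa> y')"
      using D(3)[of n] by (auto simp: cross_def D_def)
    obtain g where g: "path g" "path_image g \<subseteq> D n" "pathstart g = y" "pathfinish g = y'"
      using D(2)[of n] y unfolding path_connected_def by blast
    have g\<Omega>: "path_image g \<subseteq> \<Omega>" using g(2) D(1) by blast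
    have c\<kappa>: "continuous_on (path_image g) \<kappa>"
      using holomorphic_on_imp_continuous_on[OF holomorphic_on_subset[OF \<kappa>p(1) g\<Omega>]] .
    show ?thesis
    proof (intro exI[of _ "\<kappa> ` path_image g"] conjI)
      show "compact (\<kappa> ` path_image g)"
        by (intro compact_continuous_image c\<kappa> compact_path_image g)
      show "connected (\<kappa> ` path_image g)"
        by (intro connected_continuous_image c\<kappa> connected_path_image g)
      show "\<kappa> ` path_image g \<subseteq> strip" using \<kappa>s g\<Omega> by blast
      show "\<forall>z\<in>\<kappa> ` path_image g. norm (P z) \<le> e" using n(2) g(2) by blast
      show "\<forall>z\<in>\<kappa> ` path_image g. x1 \<le> Re z \<and> Re z \<le> x2 \<longrightarrow> Im z < \<eta> \<or> pi - \<eta> < Im z"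
      proof (intro ballI impI, rule ccontr)
        fix w assume w: "w \<in> \<kappa> ` path_image g" "x1 \<le> Re w \<and> Re w \<le> x2" "\<not> (Im w < \<eta> \<or> pi - \<eta> < Im w)"
        then obtain v where v: "v \<in> path_image g" "w = \<kappa> v" by blast
        have "w \<in> K" using w by (auto simp: K_def in_cbox_complex_iff)
        moreover have "F w = v" using v g\<Omega> F\<kappa> by blast
        ultimately have "v \<in> F ` K" by blast
        then show False using n(1) v(1) g(2) by blast
      qed
      show "\<exists>z\<in>\<kappa> ` path_image g. Re z \<le> x1"
        using y(2) pathstart_in_path_image[of g] g(3) by (intro bexI[of _ "\<kappa> y"]) auto
      show "\<exists>z\<in>\<kappa> ` path_image g. x2 \<le> Re z"
        using y(4) pathfinish_in_path_image[of g] g(4) by (intro bexI[of _ "\<kappa> y'"]) auto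
    qed
  qed
  have deg: "P z * cnj (P (cnj z + \<i> * pi)) = 0" if "z \<in> strip" for z
    by (rule strip_degenerate[OF G B P M x12 arcs that])
  have alt: "F z = c \<or> F (cnj z + \<i> * pi) = c" if "z \<in> strip" for z
  proof -
    have "cnj z + \<i> * pi \<in> strip" using that by (auto simp: strip_def)
    moreover have "P z = 0 \<or> P (cnj z + \<i> * pi) = 0" using deg[OF that] by simp
    ultimately show ?thesis using zero that unfolding P_def by blast
  qed
  \<comment> \<open>Pigeonhole: by injectivity \<open>F\<close> takes the value \<open>c\<close> at
    no more than one of the points \<open>v k\<close> and at no more than one of their reflections
    \<open>v' k\<close>, which cannot serve the three indices 0, 1 and 2.\<close>
  define v where "v = (\<lambda>k. complex_of_real k + \<i>)"
  define v' where "v' = (\<lambda>k. cnj (v k) + \<i> * pi)"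
  have v: "v k \<in> strip" "v' k \<in> strip" for k
    using pi_gt3 by (auto simp: v_def v'_def strip_def)
  have i: "k = l" if "F (v k) = c" "F (v l) = c" for k l
    using inj_onD[OF Fp(2), of "v k" "v l"] that v by (simp add: v_def)
  have i': "k = l" if "F (v' k) = c" "F (v' l) = c" for k l
    using inj_onD[OF Fp(2), of "v' k" "v' l"] that v by (simp add: v'_def v_def)
  have "F (v k) = c \<or> F (v' k) = c" for k
    using alt[OF v(1)] by (simp add: v'_def)
  from this[of 0] this[of 1] this[of 2] show False
    using i[of 0 1] i[of 0 2] i[of 1 2] i'[of 0 1] i'[of 0 2] i'[of 1 2] by auto
qed

section \<open>Inner domains and limits along prime ends\<close>

text \<open>If \<open>closure V\<close> did not meet \<open>C\<close>, the component
  \<open>V\<close> would be open and closed in the connected set \<open>\<Omega>\<close>, hence all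
  of it.\<close>

lemma component_Un_cut_connected:
  fixes \<Omega> C :: "complex set"
  assumes \<Omega>: "open \<Omega>" "connected \<Omega>" and C: "closedin (top_of_set \<Omega>) C" "connected C" "C \<noteq> {}"
    and V: "V \<in> components (\<Omega> - C)"
  shows "connected (V \<union> C)"
proof -
  have C\<Omega>: "C \<subseteq> \<Omega>" using C(1) closedin_imp_subset by blast
  have oC: "open (\<Omega> - C)"
    using C(1) \<Omega>(1) by (metis closedin_def openin_open_eq topspace_euclidean_subtopology)
  have Vp: "open V" "connected V" "V \<noteq> {}" "V \<subseteq> \<Omega> - C"
    using V open_components[OF oC V] in_components_connected in_components_nonempty in_components_subset
    by blast+
  have "closure V \<inter> C \<noteq> {}"
  proof
    assume disj: "closure V \<inter> C = {}"
    obtain T where T: "closed T" "V = (\<Omega> - C) \<inter> T"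
      using closedin_component[OF V] unfolding closedin_closed by blast
    then have "closure V \<subseteq> T" by (intro closure_minimal) auto
    then have "V = (\<Omega> - C) \<inter> closure V"
      using T(2) closure_subset[of V] by blast
    then have "V = \<Omega> \<inter> closure V" using disj by blast
    then have "closedin (top_of_set \<Omega>) V" by (metis closedin_closed_Int closed_closure)
    moreover have "openin (top_of_set \<Omega>) V" using Vp \<Omega>(1) by (auto simp: openin_open_eq)
    ultimately have "V = \<Omega>" using \<Omega>(2) Vp(3) unfolding connected_clopen by blast
    then show False using Vp(4) C(3) C\<Omega> by blast
  qed
  then obtain p where p: "p \<in> closure V" "p \<in> C" by blast
  have "connected (insert p V)"
    by (rule connected_intermediate_closure[OF Vp(2)]) (use p closure_subset in auto)
  then have "connected (insert p V \<union> C)"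
    using C(2) p by (intro connected_Un) auto
  moreover have "insert p V \<union> C = V \<union> C" using p by blast
  ultimately show ?thesis by simp
qed

text \<open>Distinct components are disjoint and \<open>C (Suc n)\<close> is nonempty, so the union
  in \<open>inner_domain\<close> is over a single component.\<close>

lemma inner_domain_eq:
  assumes "separates_in \<Omega> (C n) (C 0) (C (Suc n))" "C (Suc n) \<noteq> {}"
  obtains W where "W \<in> components (\<Omega> - C n)" "inner_domain \<Omega> C n \<in> components (\<Omega> - C n)"
    "W \<inter> inner_domain \<Omega> C n = {}" "C 0 \<subseteq> W" "C (Suc n) \<subseteq> inner_domain \<Omega> C n"
proof -
  obtain W V where WV: "W \<in> components (\<Omega> - C n)" "V \<in> components (\<Omega> - C n)" "W \<noteq> V"
    "C 0 \<subseteq> W" "C (Suc n) \<subseteq> V"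
    using assms(1) unfolding separates_in_def by blast
  have "V' = V" if "V' \<in> components (\<Omega> - C n)" "C (Suc n) \<subseteq> V'" for V'
    using components_nonoverlap[OF that(1) WV(2)] that(2) WV(5) assms(2) by blast
  then have "{V' \<in> components (\<Omega> - C n). C (Suc n) \<subseteq> V'} = {V}" using WV by blast
  then have "inner_domain \<Omega> C n = V" by (simp add: inner_domain_def)
  moreover have "W \<inter> V = {}" using components_nonoverlap[OF WV(1,2)] WV(3) by blast
  ultimately show ?thesis using that WV by blast
qed

lemma null_chain_props:
  assumes \<Omega>: "open \<Omega>" and C: "null_chain \<Omega> C"
  shows "\<And>n. crosscut \<Omega> (C n)" "\<And>n. C n \<inter> C (Suc n) = {}"
    "\<And>n. 1 \<le> n \<Longrightarrow> separates_in \<Omega> (C n) (C 0) (C (Suc n))" "(\<lambda>n. diameter (stereo ` C n)) \<longlonglongrightarrow> 0"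
proof -
  show "\<And>n. crosscut \<Omega> (C n)" "\<And>n. 1 \<le> n \<Longrightarrow> separates_in \<Omega> (C n) (C 0) (C (Suc n))"
    "(\<lambda>n. diameter (stereo ` C n)) \<longlonglongrightarrow> 0"
    using C by (simp_all add: null_chain_def)
  have cl: "closure (stereo ` C n) \<inter> closure (stereo ` C (Suc n)) = {}" for n
    using C by (simp add: null_chain_def)
  show "C n \<inter> C (Suc n) = {}" for n
    using cl[of n] closure_subset[of "stereo ` C n"] closure_subset[of "stereo ` C (Suc n)"] by auto
qed

text \<open>Sides are told apart by \<open>C 0\<close>. If the inner domain of index
  \<open>k + 1\<close> met \<open>C k\<close>, then \<open>C k\<close> together with the component
  containing \<open>C 0\<close> would be a connected set missing \<open>C (k + 1)\<close>; it would
  lie in that inner domain and bring \<open>C 0\<close> with it, against separation. Hence the inner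
  domain and its crosscut stay on one side of \<open>C k\<close>.\<close>

lemma inner_domain_antimono:
  assumes \<Omega>: "open \<Omega>" "connected \<Omega>" and C: "null_chain \<Omega> C" and mn: "1 \<le> m" "m \<le> n"
  shows "inner_domain \<Omega> C n \<subseteq> inner_domain \<Omega> C m"
  using mn(2)
proof (induction n rule: dec_induct)
  case (step k)
  note Cp = null_chain_props[OF \<Omega>(1) C]
  note cc = crosscut_props[OF \<Omega>(1) Cp(1)]
  have con: "connected (C j)" for j using cc(3) path_connected_imp_connected by blast
  have k: "1 \<le> k" "1 \<le> Suc k" using step mn by auto
  obtain W where W: "W \<in> components (\<Omega> - C k)" "inner_domain \<Omega> C k \<in> components (\<Omega> - C k)"
    "W \<inter> inner_domain \<Omega> C k = {}" "C 0 \<subseteq> W" "C (Suc k) \<subseteq> inner_domain \<Omega> C k"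
    by (rule inner_domain_eq[OF Cp(3)[OF k(1)] cc(2)]) (rule that)
  obtain W' where W': "W' \<in> components (\<Omega> - C (Suc k))" "inner_domain \<Omega> C (Suc k) \<in> components (\<Omega> - C (Suc k))"
    "W' \<inter> inner_domain \<Omega> C (Suc k) = {}" "C 0 \<subseteq> W'" "C (Suc (Suc k)) \<subseteq> inner_domain \<Omega> C (Suc k)"
    by (rule inner_domain_eq[OF Cp(3)[OF k(2)] cc(2)]) (rule that)
  have sub: "W \<subseteq> \<Omega> - C k" "inner_domain \<Omega> C (Suc k) \<subseteq> \<Omega> - C (Suc k)"
    using W(1) W'(2) in_components_subset by blast+
  have "C k \<inter> inner_domain \<Omega> C (Suc k) = {}"
  proof (rule ccontr)
    assume meet: "C k \<inter> inner_domain \<Omega> C (Suc k) \<noteq> {}"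
    have "connected (W \<union> C k)"
      by (rule component_Un_cut_connected[OF \<Omega> cc(4) con cc(2) W(1)])
    moreover have "W \<union> C k \<subseteq> \<Omega> - C (Suc k)"
      using sub(1) W(3,5) Cp(2)[of k] cc(1)[of k] by blast
    ultimately have "W \<union> C k \<subseteq> inner_domain \<Omega> C (Suc k)"
      using components_maximal[OF W'(2)] meet by blast
    then show False using W(4) W'(3,4) cc(2)[of 0] by blast
  qed
  then have "inner_domain \<Omega> C (Suc k) \<union> C (Suc k) \<subseteq> \<Omega> - C k"
    using sub(2) Cp(2)[of k] cc(1)[of "Suc k"] by blast
  moreover have "connected (inner_domain \<Omega> C (Suc k) \<union> C (Suc k))"
    by (rule component_Un_cut_connected[OF \<Omega> cc(4) con cc(2) W'(2)])
  ultimately have "inner_domain \<Omega> C (Suc k) \<union> C (Suc k) \<subseteq> inner_domain \<Omega> C k"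
    using components_maximal[OF W(2)] W(5) cc(2)[of "Suc k"] by blast
  then show ?case using step.IH by blast
qed simp

text \<open>A connected set that touches \<open>C 0\<close> and misses \<open>C n\<close> stays on
  the side of \<open>C 0\<close>. Applied to preimages of discs or their complements, this locates
  inner domains without describing the image of a crosscut.\<close>

lemma inner_domain_avoids:
  assumes \<Omega>: "open \<Omega>" and C: "null_chain \<Omega> C" and n: "1 \<le> n"
    and E: "connected E" "E \<subseteq> \<Omega>" "E \<inter> C n = {}" "z \<in> E" "z \<in> C 0"
  shows "inner_domain \<Omega> C n \<inter> E = {}"
proof -
  note Cp = null_chain_props[OF \<Omega> C]
  note cc = crosscut_props[OF \<Omega> Cp(1)]
  obtain W where W: "W \<in> components (\<Omega> - C n)" "W \<inter> inner_domain \<Omega> C n = {}" "C 0 \<subseteq> W"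
    by (rule inner_domain_eq[OF Cp(3)[OF n] cc(2)]) (rule that)
  have "E \<subseteq> W"
    by (rule components_maximal[OF W(1) E(1)]) (use E W(3) in auto)
  then show ?thesis using W(2) by blast
qed

section \<open>Half-annuli in the logarithmic chart\<close>

lemma conformal_map_Ln: "conformal_map Ln upper_half_plane strip"
proof -
  have 1: "Ln z \<in> strip" if "z \<in> upper_half_plane" for z
  proof -
    have "z \<noteq> 0" "0 < Im z" using that by (auto simp: upper_half_plane_def)
    then show ?thesis using Im_Ln_pos_lt_imp[of z] by (auto simp: strip_def)
  qed
  have 2: "exp w \<in> upper_half_plane" if "w \<in> strip" for w
    using that sin_gt_zero[of "Im w"] by (auto simp: strip_def upper_half_plane_def Im_exp)
  have "bij_betw Ln upper_half_plane strip"
  proof (rule bij_betwI[of _ _ _ exp])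
    show "exp (Ln z) = z" if "z \<in> upper_half_plane" for z
      using that by (intro exp_Ln) (auto simp: upper_half_plane_def)
    show "Ln (exp w) = w" if "w \<in> strip" for w
      using that by (intro Ln_exp) (auto simp: strip_def)
  qed (use 1 2 in auto)
  moreover have "Ln holomorphic_on upper_half_plane"
    by (intro holomorphic_on_Ln) (auto simp: upper_half_plane_def complex_nonpos_Reals_iff)
  ultimately show ?thesis by (simp add: conformal_map_def)
qed

text \<open>The set is not convex, but it is a translate of the image of a convex half-strip under
  the exponential.\<close>

lemma connected_half_plane_outside_disc:
  fixes t :: real
  assumes "0 < r"
  shows "connected {z \<in> upper_half_plane. r \<le> norm (z - t)}"
proof -
  have "{z \<in> upper_half_plane. r \<le> norm (z - t)} = (\<lambda>w. t + exp w) ` (strip \<inter> {w. ln r \<le> Re w})"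
  proof (intro set_eqI iffI)
    fix z assume z: "z \<in> {z \<in> upper_half_plane. r \<le> norm (z - t)}"
    then have H: "z - t \<in> upper_half_plane" by (simp add: upper_half_plane_def)
    then have nz: "z - t \<noteq> 0" by (auto simp: upper_half_plane_def)
    have "Ln (z - t) \<in> strip"
      using conformal_map_Ln H by (auto simp: conformal_map_def bij_betw_def)
    moreover have "ln r \<le> Re (Ln (z - t))" using z assms nz by simp
    moreover have "z = complex_of_real t + exp (Ln (z - t))" using nz by simp
    ultimately show "z \<in> (\<lambda>w. t + exp w) ` (strip \<inter> {w. ln r \<le> Re w})" by blast
  next
    fix z assume "z \<in> (\<lambda>w. t + exp w) ` (strip \<inter> {w. ln r \<le> Re w})"
    then obtain w where w: "z = complex_of_real t + exp w" "w \<in> strip" "ln r \<le> Re w" by blast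
    have "0 < Im (exp w)" using w(2) sin_gt_zero[of "Im w"] by (auto simp: strip_def Im_exp)
    moreover have "r \<le> exp (Re w)" using w(3) assms by (metis exp_le_cancel_iff exp_ln)
    ultimately show "z \<in> {z \<in> upper_half_plane. r \<le> norm (z - t)}"
      by (simp add: w(1) upper_half_plane_def norm_exp_eq_Re)
  qed
  moreover have "connected (strip \<inter> {w. ln r \<le> Re w})"
    by (intro convex_connected convex_Int convex_strip convex_halfspace_Re_ge)
  ultimately show ?thesis
    by (simp only:) (intro connected_continuous_image continuous_intros)
qed

lemma connected_half_plane_inside_disc:
  "connected {z \<in> upper_half_plane. norm z \<le> R}"
proof -
  have "{z \<in> upper_half_plane. norm z \<le> R} = {z. 0 < Im z} \<inter> cball 0 R"
    by (auto simp: upper_half_plane_def)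
  then show ?thesis
    by (simp only:) (intro convex_connected convex_Int convex_halfspace_Im_gt convex_cball)
qed

text \<open>The real part of \<open>Ln (\<phi> z - t)\<close> is the logarithm of the distance to
  \<open>t\<close>, so the half-annulus between the radii \<open>r1\<close> and \<open>r2\<close>
  becomes a rectangle across the strip.\<close>

lemma half_plane_chart_no_crossing:
  fixes t :: real
  assumes \<Omega>: "open \<Omega>" "\<Omega> \<noteq> UNIV" and \<phi>: "conformal_map \<phi> \<Omega> upper_half_plane"
    and C: "null_chain \<Omega> C" and r: "0 < r1" "r1 < r2"
  shows "\<forall>\<^sub>F n in sequentially. (\<forall>z\<in>C n. r1 < norm (\<phi> z - t)) \<or> (\<forall>z\<in>C n. norm (\<phi> z - t) < r2)"
proof -
  note Cp = null_chain_props[OF \<Omega>(1) C]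
  have shift: "conformal_map (\<lambda>z. z - t) upper_half_plane upper_half_plane"
    unfolding conformal_map_def
  proof
    show "bij_betw (\<lambda>z. z - t) upper_half_plane upper_half_plane"
      by (rule bij_betwI[of _ _ _ "\<lambda>z::complex. z + t"]) (auto simp: upper_half_plane_def)
  qed (intro holomorphic_intros)
  have \<kappa>: "conformal_map (\<lambda>z. Ln (\<phi> z - t)) \<Omega> strip"
    using conformal_map_compose[OF conformal_map_compose[OF \<phi> shift] conformal_map_Ln] .
  have nz: "\<phi> z - t \<noteq> 0" if "z \<in> \<Omega>" for z
    using conformal_map_props(3)[OF \<phi> \<Omega>(1)] imageI[OF that, of \<phi>] by (auto simp: upper_half_plane_def)
  have "ln r1 < ln r2" using r by simp
  from strip_chart_no_crossing[OF \<Omega> \<kappa> Cp(1,4) this] show ?thesis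
  proof eventually_elim
    case (elim n)
    have C\<Omega>: "C n \<subseteq> \<Omega>" by (rule crosscut_props(1)[OF \<Omega>(1) Cp(1)])
    have "Re (Ln (\<phi> z - t)) = ln (norm (\<phi> z - t))" "0 < norm (\<phi> z - t)" if "z \<in> C n" for z
      using nz[of z] that C\<Omega> by auto
    then have "Re (Ln (\<phi> z - t)) \<le> ln r1 \<longleftrightarrow> norm (\<phi> z - t) \<le> r1"
      "ln r2 \<le> Re (Ln (\<phi> z - t)) \<longleftrightarrow> r2 \<le> norm (\<phi> z - t)" if "z \<in> C n" for z
      using that r by simp_all
    with elim show ?case by (metis not_le)
  qed
qed

text \<open>One well-placed crosscut suffices for each neighbourhood of the limit: if its image lies
  near \<open>t\<close>, or far out, then so does the image of its inner domain, which is cut off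
  from \<open>C 0\<close>, and inner domains generate the filter.\<close>

lemma prime_end_chart_limit:
  assumes \<Omega>: "open \<Omega>" "\<Omega> \<noteq> UNIV" and \<phi>: "conformal_map \<phi> \<Omega> upper_half_plane" and b: "prime_end \<Omega> b"
  shows "b \<noteq> bot" "eventually (\<lambda>x. x \<in> \<Omega>) b"
    "(\<exists>t::real. (\<phi> \<longlongrightarrow> complex_of_real t) b) \<or> filterlim \<phi> at_infinity b"
proof -
  note \<phi>p = conformal_map_props[OF \<phi> \<Omega>(1)]
  obtain g where "conformal_map g upper_half_plane \<Omega> \<and> (\<forall>z\<in>\<Omega>. g (\<phi> z) = z) \<and> (\<forall>z\<in>upper_half_plane. \<phi> (g z) = z)"
    using conformal_map_inverse[OF \<phi> \<Omega>(1)] by (rule exE)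
  then have gc: "conformal_map g upper_half_plane \<Omega>" and g: "\<And>z. z \<in> \<Omega> \<Longrightarrow> g (\<phi> z) = z"
    "\<And>z. z \<in> upper_half_plane \<Longrightarrow> \<phi> (g z) = z"
    by simp_all
  note oH = open_upper_half_plane
  note gp = conformal_map_props[OF gc oH]
  have g\<Omega>: "g z \<in> \<Omega>" if "z \<in> upper_half_plane" for z using gp(3) imageI[OF that, of g] by simp
  have \<phi>H: "\<phi> z \<in> upper_half_plane" if "z \<in> \<Omega>" for z using \<phi>p(3) imageI[OF that, of \<phi>] by simp
  have con: "connected \<Omega>"
    unfolding gp(3)[symmetric]
    by (intro connected_continuous_image holomorphic_on_imp_continuous_on gp(1) convex_connected)
       (simp add: upper_half_plane_def convex_halfspace_Im_gt)
  obtain C where C: "null_chain \<Omega> C" and b_eq: "b = (INF n\<in>{1..}. principal (inner_domain \<Omega> C n))"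
    using b unfolding prime_end_def by blast
  define I where "I = inner_domain \<Omega> C"
  note Cp = null_chain_props[OF \<Omega>(1) C]
  note cc = crosscut_props[OF \<Omega>(1) Cp(1)]
  have I: "I n \<subseteq> \<Omega>" "I n \<noteq> {}" if "1 \<le> n" for n
  proof -
    have "I n \<in> components (\<Omega> - C n)"
      unfolding I_def by (rule inner_domain_eq[OF Cp(3)[OF that] cc(2)])
    then show "I n \<subseteq> \<Omega>" "I n \<noteq> {}"
      using in_components_subset in_components_nonempty by blast+
  qed
  \<comment> \<open>Since the inner domains decrease, they form a base of the filter and not merely
    a subbase.\<close>
  have ev: "eventually P b \<longleftrightarrow> (\<exists>n\<ge>1. \<forall>x\<in>I n. P x)" for P
  proof -
    have "eventually P b \<longleftrightarrow> (\<exists>n\<in>{1..}. eventually P (principal (inner_domain \<Omega> C n)))"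
      unfolding b_eq
    proof (rule eventually_INF_base)
      fix m n :: nat assume mn: "m \<in> {1..}" "n \<in> {1..}"
      have "inner_domain \<Omega> C (max m n) \<subseteq> inner_domain \<Omega> C m \<inter> inner_domain \<Omega> C n"
        using inner_domain_antimono[OF \<Omega>(1) con C] mn by (simp add: le_max_iff_disj)
      then show "\<exists>x\<in>{1..}. principal (inner_domain \<Omega> C x)
          \<le> inf (principal (inner_domain \<Omega> C m)) (principal (inner_domain \<Omega> C n))"
        using mn by (intro bexI[of _ "max m n"]) (auto simp: le_max_iff_disj)
    qed auto
    then show ?thesis by (auto simp: eventually_principal I_def)
  qed
  show "b \<noteq> bot"
  proof
    assume "b = bot"
    then have "eventually (\<lambda>_. False) b" by simp
    then show False unfolding ev using I(2) by blast
  qed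
  show "eventually (\<lambda>x. x \<in> \<Omega>) b"
    unfolding ev using I(1)[of 1] by (intro exI[of _ 1]) auto
  obtain z0 where z0: "z0 \<in> C 0" using cc(2) by blast
  then have z0\<Omega>: "z0 \<in> \<Omega>" using cc(1) by blast
  have avoid: "\<phi> z \<notin> E" if n: "1 \<le> n" and E: "connected E" "E \<subseteq> upper_half_plane" "\<phi> z0 \<in> E"
      "\<And>z. z \<in> C n \<Longrightarrow> \<phi> z \<notin> E" and z: "z \<in> I n" for n E z
  proof
    assume zE: "\<phi> z \<in> E"
    have "I n \<inter> g ` E = {}"
      unfolding I_def
    proof (rule inner_domain_avoids[OF \<Omega>(1) C n])
      show "connected (g ` E)"
        by (intro connected_continuous_image E(1)
            holomorphic_on_imp_continuous_on[OF holomorphic_on_subset[OF gp(1) E(2)]])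
      show "g ` E \<subseteq> \<Omega>" using g\<Omega> E(2) by blast
      show "g ` E \<inter> C n = {}" using E(2,4) g(2) by fastforce
      show "z0 \<in> g ` E" using E(3) g(1)[OF z0\<Omega>] by (metis imageI)
    qed (rule z0)
    moreover have "z \<in> \<Omega>" using I(1)[OF n] z by blast
    then have "z \<in> g ` E" using zE g(1) by (metis imageI)
    ultimately show False using z by blast
  qed
  show "(\<exists>t::real. (\<phi> \<longlongrightarrow> complex_of_real t) b) \<or> filterlim \<phi> at_infinity b"
  \<comment> \<open>If the image crosscuts reach arbitrarily far infinitely often, the limit is
    infinity. Otherwise they eventually lie in a fixed disc and have a finite accumulation
    point.\<close>
  proof (cases "\<forall>R. \<exists>\<^sub>F n in sequentially. \<exists>z\<in>C n. R \<le> norm (\<phi> z)")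
    case True
    have "eventually (\<lambda>x. R \<le> norm (\<phi> x)) b" for R
    proof -
      \<comment> \<open>The disc of radius \<open>R'\<close> contains \<open>\<phi> z0\<close>,
        which marks the side of \<open>C 0\<close>. A point at distance at least
        \<open>R' + 1\<close> rules out one half of the no-crossing dichotomy for the radii
        \<open>R'\<close> and \<open>R' + 1\<close>.\<close>
      define R' where "R' = max R (norm (\<phi> z0)) + 1"
      have R': "R \<le> R'" "norm (\<phi> z0) \<le> R'" "0 < R'"
        using norm_ge_zero[of "\<phi> z0"] max.cobounded1[of R "norm (\<phi> z0)"]
          max.cobounded2[of "norm (\<phi> z0)" R] unfolding R'_def by linarith+
      have "\<exists>\<^sub>F n in sequentially. \<exists>z\<in>C n. R' + 1 \<le> norm (\<phi> z)" using True by blast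
      moreover have "\<forall>\<^sub>F n in sequentially. 1 \<le> n \<and>
          ((\<forall>z\<in>C n. R' < norm (\<phi> z)) \<or> (\<forall>z\<in>C n. norm (\<phi> z) < R' + 1))"
        using half_plane_chart_no_crossing[OF \<Omega> \<phi> C R'(3), of "R' + 1" 0]
        by (intro eventually_conj eventually_ge_at_top) simp
      ultimately have "\<exists>\<^sub>F n in sequentially. (\<exists>z\<in>C n. R' + 1 \<le> norm (\<phi> z)) \<and> 1 \<le> n \<and>
          ((\<forall>z\<in>C n. R' < norm (\<phi> z)) \<or> (\<forall>z\<in>C n. norm (\<phi> z) < R' + 1))"
        by (rule frequently_eventually_frequently)
      then obtain n where n0: "\<exists>z\<in>C n. R' + 1 \<le> norm (\<phi> z)" and n1: "1 \<le> n"
        and dich: "(\<forall>z\<in>C n. R' < norm (\<phi> z)) \<or> (\<forall>z\<in>C n. norm (\<phi> z) < R' + 1)"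
        using frequently_ex by blast
      have n: "1 \<le> n" "\<And>z. z \<in> C n \<Longrightarrow> R' < norm (\<phi> z)"
        using n1 dich n0 by (auto simp: not_less[symmetric])
      have "R' < norm (\<phi> z)" if "z \<in> I n" for z
      proof -
        have "\<phi> z \<notin> {z \<in> upper_half_plane. norm z \<le> R'}"
          by (rule avoid[OF n(1) connected_half_plane_inside_disc _ _ _ that])
             (use \<phi>H[OF z0\<Omega>] R'(2) n(2) in \<open>auto simp: not_le\<close>)
        moreover have "\<phi> z \<in> upper_half_plane" using \<phi>H I(1)[OF n(1)] that by blast
        ultimately show ?thesis by simp
      qed
      then show ?thesis unfolding ev using n(1) R'(1) by (intro exI[of _ n]) force
    qed
    then show ?thesis by (simp add: filterlim_at_infinity[of 0] eventually_mono)
  next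
    case False
    then obtain R where R: "\<forall>\<^sub>F n in sequentially. \<forall>z\<in>C n. norm (\<phi> z) < R"
      by (auto simp: not_frequently not_le)
    obtain x where x: "\<And>n. x n \<in> C n" using cc(2) by (meson all_not_in_conv)
    have x\<Omega>: "x n \<in> \<Omega>" for n using x cc(1) by blast
    obtain N where N: "\<And>n. N \<le> n \<Longrightarrow> norm (\<phi> (x n)) < R"
      using R x unfolding eventually_sequentially by blast
    have "compact (cball (0::complex) R)" by simp
    moreover have "\<forall>n. \<phi> (x (n + N)) \<in> cball 0 R" using N by (simp add: less_imp_le)
    ultimately obtain l r where lr: "strict_mono r" "((\<lambda>n. \<phi> (x (n + N))) \<circ> r) \<longlonglongrightarrow> l"
      unfolding compact_def by metis
    define \<rho> where "\<rho> = (\<lambda>n. r n + N)"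
    have \<rho>: "strict_mono \<rho>" "(\<lambda>n. \<phi> (x (\<rho> n))) \<longlonglongrightarrow> l"
      using lr by (auto simp: \<rho>_def strict_mono_def o_def)
    have "0 \<le> Im l"
    proof (rule tendsto_lowerbound[OF tendsto_Im[OF \<rho>(2)]])
      show "\<forall>\<^sub>F n in sequentially. 0 \<le> Im (\<phi> (x (\<rho> n)))"
        using \<phi>H[OF x\<Omega>] by (intro always_eventually) (auto simp: upper_half_plane_def less_imp_le)
    qed simp
    \<comment> \<open>A limit inside the half-plane would have a compact neighbourhood there, whose
      preimage the crosscuts leave.\<close>
    moreover have "\<not> 0 < Im l"
    proof
      assume "0 < Im l"
      then have "l \<in> upper_half_plane" by (simp add: upper_half_plane_def)
      then obtain d where d: "0 < d" "cball l d \<subseteq> upper_half_plane"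
        using oH unfolding open_contains_cball by blast
      have "compact (g ` cball l d)"
        by (intro compact_continuous_image compact_cball
            holomorphic_on_imp_continuous_on[OF holomorphic_on_subset[OF gp(1) d(2)]])
      moreover have "g ` cball l d \<subseteq> \<Omega>" using d(2) g\<Omega> by blast
      ultimately have "\<forall>\<^sub>F n in sequentially. C n \<inter> g ` cball l d = {}"
        by (rule crosscuts_leave_compacts[OF \<Omega>(1) Cp(1,4)])
      from eventually_subseq[OF \<rho>(1) this] tendstoD[OF \<rho>(2) d(1)]
      have "\<forall>\<^sub>F n in sequentially. False"
      proof eventually_elim
        case (elim n)
        have "x (\<rho> n) \<in> g ` cball l d"
          using elim(2) g(1)[OF x\<Omega>] by (metis dist_commute image_eqI less_imp_le mem_cball)
        then show ?case using elim(1) x by blast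
      qed
      then show False by simp
    qed
    ultimately have "l = complex_of_real (Re l)" by (simp add: complex_eq_iff)
    then obtain t :: real where t: "l = complex_of_real t" by blast
    have "(\<phi> \<longlongrightarrow> complex_of_real t) b"
    proof (rule tendstoI)
      fix e' :: real assume e': "0 < e'"
      \<comment> \<open>The bound by \<open>Im (\<phi> z0)\<close> keeps \<open>\<phi> z0\<close>
        out of the open disc of radius \<open>e\<close> about the real point
        \<open>t\<close>.\<close>
      define e where "e = min e' (Im (\<phi> z0))"
      have e: "0 < e" "e \<le> e'" "e \<le> Im (\<phi> z0)"
        using e' \<phi>H[OF z0\<Omega>] by (auto simp: e_def upper_half_plane_def)
      have "\<forall>\<^sub>F n in sequentially. (\<forall>z\<in>C (\<rho> n). e / 2 < norm (\<phi> z - t)) \<or> (\<forall>z\<in>C (\<rho> n). norm (\<phi> z - t) < e)"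
        using e by (intro eventually_subseq[OF \<rho>(1)] half_plane_chart_no_crossing[OF \<Omega> \<phi> C]) auto
      moreover have "\<forall>\<^sub>F n in sequentially. dist (\<phi> (x (\<rho> n))) t < e / 2"
        using tendstoD[OF \<rho>(2), of "e / 2"] e t by simp
      moreover have "\<forall>\<^sub>F n in sequentially. 1 \<le> \<rho> n"
        by (rule eventually_subseq[OF \<rho>(1) eventually_ge_at_top])
      ultimately have "\<forall>\<^sub>F n in sequentially. 1 \<le> \<rho> n \<and> (\<forall>z\<in>C (\<rho> n). norm (\<phi> z - t) < e)"
      proof eventually_elim
        case (elim n)
        then show ?case using x[of "\<rho> n"] by (force simp: dist_norm)
      qed
      then obtain n where n: "1 \<le> n" "\<And>z. z \<in> C n \<Longrightarrow> norm (\<phi> z - t) < e"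
        using eventually_happens'[OF sequentially_bot] by blast
      have "dist (\<phi> z) t < e'" if "z \<in> I n" for z
      proof -
        have "Im (\<phi> z0) \<le> norm (\<phi> z0 - t)"
          using abs_Im_le_cmod[of "\<phi> z0 - t"] by simp
        then have "\<phi> z \<notin> {z \<in> upper_half_plane. e \<le> norm (z - t)}"
          by (intro avoid[OF n(1) connected_half_plane_outside_disc[OF e(1)] _ _ _ that])
             (use \<phi>H[OF z0\<Omega>] e(3) n(2) in \<open>auto simp: not_le\<close>)
        moreover have "\<phi> z \<in> upper_half_plane" using \<phi>H I(1)[OF n(1)] that by blast
        ultimately show ?thesis using e(2) by (simp add: dist_norm)
      qed
      then show "\<forall>\<^sub>F x in b. dist (\<phi> x) (complex_of_real t) < e'"
        unfolding ev using n(1) by blast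
    qed
    then show ?thesis by blast
  qed
qed

section \<open>Covariance\<close>

text \<open>\<open>1 / (\<phi> - W)\<close> has a finite limit in both cases,
  \<open>1 / (t - W)\<close> or 0; with it, a boundary value at infinity needs no separate
  treatment.\<close>

lemma boundary_limit_inverse:
  fixes \<phi> :: "complex \<Rightarrow> complex"
  assumes "(\<exists>t::real. (\<phi> \<longlongrightarrow> complex_of_real t) b) \<or> filterlim \<phi> at_infinity b"
  obtains k where "k holomorphic_on upper_half_plane"
    "\<And>W. W \<in> upper_half_plane \<Longrightarrow> ((\<lambda>x. inverse (\<phi> x - W)) \<longlongrightarrow> k W) b"
    "\<And>W. W \<in> upper_half_plane \<Longrightarrow> eventually (\<lambda>x. \<phi> x \<noteq> W) b"
  using assms
proof
  assume "\<exists>t::real. (\<phi> \<longlongrightarrow> complex_of_real t) b"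
  then obtain t :: real where t: "(\<phi> \<longlongrightarrow> complex_of_real t) b" by blast
  have nz: "complex_of_real t - W \<noteq> 0" if "W \<in> upper_half_plane" for W
    using that by (auto simp: upper_half_plane_def)
  show thesis
  proof
    show "(\<lambda>W. inverse (complex_of_real t - W)) holomorphic_on upper_half_plane"
      by (intro holomorphic_intros nz)
    show "((\<lambda>x. inverse (\<phi> x - W)) \<longlongrightarrow> inverse (complex_of_real t - W)) b"
      if "W \<in> upper_half_plane" for W
      using nz[OF that] by (intro tendsto_intros t)
    show "eventually (\<lambda>x. \<phi> x \<noteq> W) b" if "W \<in> upper_half_plane" for W
      using tendsto_imp_eventually_ne[OF t] nz[OF that] by auto
  qed
next
  assume inf: "filterlim \<phi> at_infinity b"
  have lim: "filterlim (\<lambda>x. \<phi> x - W) at_infinity b" for W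
    using tendsto_add_filterlim_at_infinity'[OF inf tendsto_const[of "- W"]] by simp
  show thesis
  proof
    show "(\<lambda>W. 0 :: complex) holomorphic_on upper_half_plane" by simp
    show "((\<lambda>x. inverse (\<phi> x - W)) \<longlongrightarrow> 0) b" for W
      by (rule tendsto_inverse_0[THEN filterlim_compose, OF lim])
    show "eventually (\<lambda>x. \<phi> x \<noteq> W) b" for W
      using filterlim_at_infinity_imp_eventually_ne[OF inf] .
  qed
qed

text \<open>By partial fractions the ratio is
  \<open>1 / (\<phi> x - W) - 1 / (\<phi> x' - W)\<close>, where the two boundary variables are
  separated.\<close>

lemma boundary_term_tendsto:
  fixes \<phi> k k' :: "complex \<Rightarrow> complex"
  assumes k: "((\<lambda>x. inverse (\<phi> x - W)) \<longlongrightarrow> l) b" "eventually (\<lambda>x. \<phi> x \<noteq> W) b"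
    and k': "((\<lambda>x. inverse (\<phi> x - W)) \<longlongrightarrow> l') b'" "eventually (\<lambda>x. \<phi> x \<noteq> W) b'"
  shows "((\<lambda>(x, x'). 1 / 2 * (d * (\<phi> x' - \<phi> x) / ((\<phi> x' - W) * (\<phi> x - W)))\<^sup>2)
    \<longlongrightarrow> 1 / 2 * (d * (l - l'))\<^sup>2) (b \<times>\<^sub>F b')"
proof (rule Lim_transform_eventually)
  show "((\<lambda>p. 1 / 2 * (d * (inverse (\<phi> (fst p) - W) - inverse (\<phi> (snd p) - W)))\<^sup>2)
      \<longlongrightarrow> 1 / 2 * (d * (l - l'))\<^sup>2) (b \<times>\<^sub>F b')"
    by (intro tendsto_intros filterlim_compose[OF k(1) filterlim_fst] filterlim_compose[OF k'(1) filterlim_snd])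
  \<comment> \<open>The partial fraction identity can fail where a denominator is 0, because of the
    convention \<open>x / 0 = 0\<close>.\<close>
  have "eventually (\<lambda>p. \<phi> (fst p) \<noteq> W) (b \<times>\<^sub>F b')" "eventually (\<lambda>p. \<phi> (snd p) \<noteq> W) (b \<times>\<^sub>F b')"
    using eventually_compose_filterlim[OF k(2) filterlim_fst]
      eventually_compose_filterlim[OF k'(2) filterlim_snd] by auto
  then show "eventually (\<lambda>p. 1 / 2 * (d * (inverse (\<phi> (fst p) - W) - inverse (\<phi> (snd p) - W)))\<^sup>2
      = (case p of (x, x') \<Rightarrow> 1 / 2 * (d * (\<phi> x' - \<phi> x) / ((\<phi> x' - W) * (\<phi> x - W)))\<^sup>2)) (b \<times>\<^sub>F b')"
  proof eventually_elim
    case (elim p)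
    then have "inverse (\<phi> (fst p) - W) - inverse (\<phi> (snd p) - W)
        = (\<phi> (snd p) - \<phi> (fst p)) / ((\<phi> (snd p) - W) * (\<phi> (fst p) - W))"
      by (simp add: inverse_eq_divide diff_frac_eq mult.commute)
    then show ?case by (simp add: case_prod_beta)
  qed
qed

theorem proposition4p17:
  fixes \<Omega> \<Omega>' :: "complex set"
    and f \<phi> s \<psi> t :: "complex \<Rightarrow> complex"
    and b b' :: "complex filter"
    and a u :: complex
  assumes domain: "open \<Omega>" "simply_connected \<Omega>" "\<Omega> \<noteq> UNIV"
    and prime_ends: "prime_end \<Omega> b" "prime_end \<Omega> b'" "b \<noteq> b'"
    and points: "a \<in> \<Omega>" "u \<in> \<Omega>"
    and map: "conformal_map f \<Omega> \<Omega>'"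
    and charts: "half_plane_chart \<Omega> \<phi> s" "half_plane_chart \<Omega>' \<psi> t"
  shows
    "corr_T \<phi> s holomorphic_on \<Omega> \<and>
     (\<forall>w\<in>\<Omega>. corr_T \<phi> s w =
        corr_T \<psi> t (f w) * (deriv f w)\<^sup>2 + 1 / 24 * schwarzian f w)
     \<and>
     corr_T_bdry \<phi> s b b' holomorphic_on \<Omega> \<and>
     (\<forall>w\<in>\<Omega>. corr_T_bdry \<phi> s b b' w =
        corr_T_bdry \<psi> t (filtermap f b) (filtermap f b') (f w) * (deriv f w)\<^sup>2
          + 1 / 24 * schwarzian f w)
     \<and>
     (\<lambda>w. corr_T_eps \<phi> s a w / corr_eps \<phi> s a) holomorphic_on \<Omega> - {a} \<and>
     (\<forall>w\<in>\<Omega> - {a}. corr_T_eps \<phi> s a w / corr_eps \<phi> s a =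
        corr_T_eps \<psi> t (f a) (f w) / corr_eps \<psi> t (f a) * (deriv f w)\<^sup>2
          + 1 / 24 * schwarzian f w)
     \<and>
     (\<lambda>w. corr_T_sigma \<phi> s u w / corr_sigma \<phi> u) holomorphic_on \<Omega> - {u} \<and>
     (\<forall>w\<in>\<Omega> - {u}. corr_T_sigma \<phi> s u w / corr_sigma \<phi> u =
        corr_T_sigma \<psi> t (f u) (f w) / corr_sigma \<psi> (f u) * (deriv f w)\<^sup>2
          + 1 / 24 * schwarzian f w)"
proof -
  note \<Omega> = domain(1)
  have \<phi>: "conformal_map \<phi> \<Omega> upper_half_plane" and s: "s holomorphic_on \<Omega>" "\<And>z. z \<in> \<Omega> \<Longrightarrow> (s z)\<^sup>2 = deriv \<phi> z"
    and \<psi>: "conformal_map \<psi> \<Omega>' upper_half_plane" and t: "t holomorphic_on \<Omega>'" "\<And>z. z \<in> \<Omega>' \<Longrightarrow> (t z)\<^sup>2 = deriv \<psi> z"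
    using charts by (auto simp: half_plane_chart_def)
  note fp = conformal_map_props[OF map \<Omega>] and \<phi>p = conformal_map_props[OF \<phi> \<Omega>]
  note \<psi>p = conformal_map_props[OF \<psi> fp(4)]
  note change = chart_change_formulas[OF \<Omega> \<phi> \<psi> map]
  have f\<Omega>: "f z \<in> \<Omega>'" and \<phi>H: "\<phi> z \<in> upper_half_plane" if "z \<in> \<Omega>" for z
    using fp(3) \<phi>p(3) imageI[OF that, of f] imageI[OF that, of \<phi>] by auto
  have \<psi>H: "\<psi> z \<in> upper_half_plane" if "z \<in> \<Omega>'" for z
    using \<psi>p(3) imageI[OF that, of \<psi>] by auto
  have cnj_ne: "W \<noteq> cnj P" if "W \<in> upper_half_plane" "P \<in> upper_half_plane" for W P
    using that by (auto simp: upper_half_plane_def complex_eq_iff)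
  have fne: "f z \<noteq> f w" if "z \<in> \<Omega>" "w \<in> \<Omega>" "z \<noteq> w" for z w
    using fp(2) that by (auto simp: inj_on_def)
  have \<phi>ne: "\<phi> z \<noteq> \<phi> w" if "z \<in> \<Omega>" "w \<in> \<Omega>" "z \<noteq> w" for z w
    using \<phi>p(2) that by (auto simp: inj_on_def)
  have \<psi>ne: "\<psi> z \<noteq> \<psi> w" if "z \<in> \<Omega>'" "w \<in> \<Omega>'" "z \<noteq> w" for z w
    using \<psi>p(2) that by (auto simp: inj_on_def)

  have T\<phi>: "corr_T \<phi> s w = schwarzian \<phi> w / 24" if "w \<in> \<Omega>" for w
    by (rule corr_T_eq[OF \<Omega> that \<phi>p(1,2) s])
  have T\<psi>: "corr_T \<psi> t w = schwarzian \<psi> w / 24" if "w \<in> \<Omega>'" for w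
    by (rule corr_T_eq[OF fp(4) that \<psi>p(1,2) t])
  have d\<phi>: "deriv \<phi> holomorphic_on \<Omega>"
    by (rule holomorphic_deriv[OF \<phi>p(1) \<Omega>])
  have S\<phi>: "schwarzian \<phi> holomorphic_on \<Omega>"
    unfolding schwarzian_def by (intro holomorphic_intros d\<phi> holomorphic_higher_deriv \<phi>p \<Omega>)
  have T_hol: "corr_T \<phi> s holomorphic_on \<Omega>"
    by (rule holomorphic_transform[of "\<lambda>w. schwarzian \<phi> w / 24"]) (auto intro!: holomorphic_intros S\<phi> simp: T\<phi>)
  have T_cov: "corr_T \<phi> s w = corr_T \<psi> t (f w) * (deriv f w)\<^sup>2 + 1 / 24 * schwarzian f w" if "w \<in> \<Omega>" for w
    using change(1)[OF that] T\<phi>[OF that] T\<psi>[OF f\<Omega>[OF that]] by (simp add: field_simps)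

  note pe = prime_end_chart_limit[OF domain(1,3) \<phi>]
  obtain k where k: "k holomorphic_on upper_half_plane"
    "\<And>W. W \<in> upper_half_plane \<Longrightarrow> ((\<lambda>x. inverse (\<phi> x - W)) \<longlongrightarrow> k W) b"
    "\<And>W. W \<in> upper_half_plane \<Longrightarrow> eventually (\<lambda>x. \<phi> x \<noteq> W) b"
    by (rule boundary_limit_inverse[OF pe(3)[OF prime_ends(1)]]) (rule that)
  obtain k' where k': "k' holomorphic_on upper_half_plane"
    "\<And>W. W \<in> upper_half_plane \<Longrightarrow> ((\<lambda>x. inverse (\<phi> x - W)) \<longlongrightarrow> k' W) b'"
    "\<And>W. W \<in> upper_half_plane \<Longrightarrow> eventually (\<lambda>x. \<phi> x \<noteq> W) b'"
    by (rule boundary_limit_inverse[OF pe(3)[OF prime_ends(2)]]) (rule that)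
  define L where "L = (\<lambda>w. 1 / 2 * (deriv \<phi> w * (k (\<phi> w) - k' (\<phi> w)))\<^sup>2)"
  \<comment> \<open>\<open>Lim\<close> is determined by convergence only along a nontrivial
    filter.\<close>
  have nb: "b \<times>\<^sub>F b' \<noteq> bot"
    using pe(1) prime_ends by (simp add: prod_filter_eq_bot)
  have lim: "((\<lambda>(x, x'). 1 / 2 * (deriv \<phi> w * (\<phi> x' - \<phi> x) / ((\<phi> x' - \<phi> w) * (\<phi> x - \<phi> w)))\<^sup>2) \<longlongrightarrow> L w)
      (b \<times>\<^sub>F b')" if "w \<in> \<Omega>" for w
    unfolding L_def by (intro boundary_term_tendsto k(2,3) k'(2,3) \<phi>H that)
  have B\<phi>: "corr_T_bdry \<phi> s b b' w = corr_T \<phi> s w + L w" if "w \<in> \<Omega>" for w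
    using tendsto_Lim[OF nb lim[OF that]] by (simp add: corr_T_bdry_def)
  have L_hol: "L holomorphic_on \<Omega>"
    unfolding L_def using \<phi>p(1,3)
    by (intro holomorphic_intros d\<phi> holomorphic_on_compose_gen[of \<phi> \<Omega> k, unfolded o_def, OF _ k(1)]
        holomorphic_on_compose_gen[of \<phi> \<Omega> k', unfolded o_def, OF _ k'(1)]) auto
  have B_hol: "corr_T_bdry \<phi> s b b' holomorphic_on \<Omega>"
    by (rule holomorphic_transform[of "\<lambda>w. corr_T \<phi> s w + L w"]) (auto intro!: holomorphic_intros T_hol L_hol simp: B\<phi>)
  have B_cov: "corr_T_bdry \<phi> s b b' w = corr_T_bdry \<psi> t (filtermap f b) (filtermap f b') (f w) * (deriv f w)\<^sup>2
          + 1 / 24 * schwarzian f w" if w: "w \<in> \<Omega>" for w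
  proof -
    \<comment> \<open>The limit along the image filters is carried over from \<open>b\<close> and
      \<open>b'\<close> by the change of chart, under which the two expressions differ by the factor
      \<open>(deriv f w)^2\<close> at all interior points.\<close>
    have "((\<lambda>(x, x'). 1 / 2 * (deriv \<psi> (f w) * (\<psi> x' - \<psi> x) / ((\<psi> x' - \<psi> (f w)) * (\<psi> x - \<psi> (f w))))\<^sup>2)
        \<longlongrightarrow> L w / (deriv f w)\<^sup>2) (filtermap (map_prod f f) (b \<times>\<^sub>F b'))"
      unfolding filterlim_filtermap
    proof (rule Lim_transform_eventually)
      show "((\<lambda>p. (case p of (x, x') \<Rightarrow> 1 / 2 * (deriv \<phi> w * (\<phi> x' - \<phi> x) / ((\<phi> x' - \<phi> w) * (\<phi> x - \<phi> w)))\<^sup>2)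
          / (deriv f w)\<^sup>2) \<longlongrightarrow> L w / (deriv f w)\<^sup>2) (b \<times>\<^sub>F b')"
        using fp(5)[OF w] by (intro tendsto_divide lim[OF w] tendsto_const) simp
      have "eventually (\<lambda>p. fst p \<in> \<Omega> \<and> snd p \<in> \<Omega>) (b \<times>\<^sub>F b')"
        using eventually_compose_filterlim[OF pe(2)[OF prime_ends(1)] filterlim_fst]
          eventually_compose_filterlim[OF pe(2)[OF prime_ends(2)] filterlim_snd]
        by (rule eventually_conj)
      then show "eventually (\<lambda>p. (case p of (x, x') \<Rightarrow> 1 / 2 * (deriv \<phi> w * (\<phi> x' - \<phi> x) / ((\<phi> x' - \<phi> w) * (\<phi> x - \<phi> w)))\<^sup>2)
          / (deriv f w)\<^sup>2 = (case map_prod f f p of (x, x') \<Rightarrow>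
            1 / 2 * (deriv \<psi> (f w) * (\<psi> x' - \<psi> x) / ((\<psi> x' - \<psi> (f w)) * (\<psi> x - \<psi> (f w))))\<^sup>2)) (b \<times>\<^sub>F b')"
      proof eventually_elim
        case (elim p)
        have "1 / 2 * Y\<^sup>2 / d\<^sup>2 = 1 / 2 * X\<^sup>2" if "X * d = Y" "d \<noteq> 0" for X Y d :: complex
          using that by (auto simp: power_mult_distrib)
        from this[OF change(2)[OF w, of "fst p" "snd p"] fp(5)[OF w]] elim show ?case
          by (simp only: case_prod_beta fst_map_prod snd_map_prod)
      qed
    qed
    then have lim': "((\<lambda>(x, x'). 1 / 2 * (deriv \<psi> (f w) * (\<psi> x' - \<psi> x) / ((\<psi> x' - \<psi> (f w)) * (\<psi> x - \<psi> (f w))))\<^sup>2)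
        \<longlongrightarrow> L w / (deriv f w)\<^sup>2) (filtermap f b \<times>\<^sub>F filtermap f b')"
      by (simp add: prod_filtermap1 prod_filtermap2 filtermap_filtermap map_prod_def apfst_def apsnd_def case_prod_beta')
    have "filtermap f b \<times>\<^sub>F filtermap f b' \<noteq> bot"
      using pe(1) prime_ends by (simp add: prod_filter_eq_bot filtermap_bot_iff)
    from tendsto_Lim[OF this lim']
    have "corr_T_bdry \<psi> t (filtermap f b) (filtermap f b') (f w) = corr_T \<psi> t (f w) + L w / (deriv f w)\<^sup>2"
      by (simp add: corr_T_bdry_def)
    then show ?thesis
      using B\<phi>[OF w] T_cov[OF w] fp(5)[OF w] by (simp add: field_simps)
  qed

  define J where "J = (\<lambda>p w. (deriv \<phi> w * (cnj (\<phi> p) - \<phi> p) / ((cnj (\<phi> p) - \<phi> w) * (\<phi> p - \<phi> w)))\<^sup>2)"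
  define J' where "J' = (\<lambda>p w. (deriv \<psi> w * (cnj (\<psi> p) - \<psi> p) / ((cnj (\<psi> p) - \<psi> w) * (\<psi> p - \<psi> w)))\<^sup>2)"
  have JJ': "J' (f p) (f w) * (deriv f w)\<^sup>2 = J p w" if "p \<in> \<Omega>" "w \<in> \<Omega>" for p w
    unfolding J_def J'_def power_mult_distrib[symmetric] change(3)[OF that(2,1)] ..
  have J_hol: "J p holomorphic_on \<Omega> - {p}" if p: "p \<in> \<Omega>" for p
  proof -
    have "(cnj (\<phi> p) - \<phi> w) * (\<phi> p - \<phi> w) \<noteq> 0" if "w \<in> \<Omega> - {p}" for w
      using \<phi>ne[of p w] cnj_ne[OF \<phi>H \<phi>H, of w p] that p by auto
    moreover have "\<phi> holomorphic_on \<Omega> - {p}" "deriv \<phi> holomorphic_on \<Omega> - {p}"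
      using \<phi>p(1) d\<phi> by (auto intro: holomorphic_on_subset)
    ultimately show ?thesis
      unfolding J_def using \<Omega> by (intro holomorphic_intros) (simp_all add: open_delete)
  qed
  have S_hol: "schwarzian \<phi> holomorphic_on \<Omega> - {p}" for p
    using S\<phi> by (rule holomorphic_on_subset) auto
  \<comment> \<open>Used with \<open>c = 1 / 2\<close> for the energy insertion and
    \<open>c = 1 / 16\<close> for the spin insertion.\<close>
  have cov: "schwarzian \<phi> w / 24 + c * J p w =
      (schwarzian \<psi> (f w) / 24 + c * J' (f p) (f w)) * (deriv f w)\<^sup>2 + 1 / 24 * schwarzian f w"
    if "p \<in> \<Omega>" "w \<in> \<Omega>" for c p w
    using change(1)[OF that(2)] JJ'[OF that] by (simp add: field_simps)

  have E\<phi>: "corr_T_eps \<phi> s a w / corr_eps \<phi> s a = schwarzian \<phi> w / 24 + 1 / 2 * J a w"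
    if "w \<in> \<Omega> - {a}" for w
    unfolding J_def using that cnj_ne \<phi>H points
    by (intro corr_T_eps_eq[OF \<Omega> _ \<phi>p(1,2) s]) auto
  have E\<psi>: "corr_T_eps \<psi> t (f a) (f w) / corr_eps \<psi> t (f a) = schwarzian \<psi> (f w) / 24 + 1 / 2 * J' (f a) (f w)"
    if "w \<in> \<Omega> - {a}" for w
    unfolding J'_def using that cnj_ne \<psi>H points f\<Omega> fne[of a w]
    by (intro corr_T_eps_eq[OF fp(4) _ \<psi>p(1,2) t]) auto
  have E_hol: "(\<lambda>w. corr_T_eps \<phi> s a w / corr_eps \<phi> s a) holomorphic_on \<Omega> - {a}"
    by (rule holomorphic_transform[of "\<lambda>w. schwarzian \<phi> w / 24 + 1 / 2 * J a w"])
       (auto intro!: holomorphic_intros S_hol J_hol points simp: E\<phi>)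

  have \<sigma>: "corr_sigma \<phi> u \<noteq> 0" "corr_sigma \<psi> (f u) \<noteq> 0"
    using \<phi>p(5)[OF points(2)] \<psi>p(5)[OF f\<Omega>[OF points(2)]] \<phi>H[OF points(2)] \<psi>H[OF f\<Omega>[OF points(2)]]
    by (auto simp: corr_sigma_def upper_half_plane_def)
  have \<Sigma>\<phi>: "corr_T_sigma \<phi> s u w / corr_sigma \<phi> u = schwarzian \<phi> w / 24 + 1 / 16 * J u w"
    if w: "w \<in> \<Omega> - {u}" for w
  proof -
    have "\<phi> w \<noteq> \<phi> u" "\<phi> w \<noteq> cnj (\<phi> u)"
      using \<phi>ne[of w u] cnj_ne \<phi>H w points by auto
    with corr_T_sigma_eq[OF \<Omega> _ \<phi>p(1,2) s, of w u] w \<sigma> show ?thesis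
      by (simp add: J_def)
  qed
  have \<Sigma>\<psi>: "corr_T_sigma \<psi> t (f u) (f w) / corr_sigma \<psi> (f u) = schwarzian \<psi> (f w) / 24 + 1 / 16 * J' (f u) (f w)"
    if w: "w \<in> \<Omega> - {u}" for w
  proof -
    have "\<psi> (f w) \<noteq> \<psi> (f u)" "\<psi> (f w) \<noteq> cnj (\<psi> (f u))"
      using \<psi>ne[of "f w" "f u"] fne[of w u] f\<Omega> cnj_ne \<psi>H w points by auto
    with corr_T_sigma_eq[OF fp(4) _ \<psi>p(1,2) t, of "f w" "f u"] w \<sigma> f\<Omega> show ?thesis
      by (simp add: J'_def)
  qed
  have \<Sigma>_hol: "(\<lambda>w. corr_T_sigma \<phi> s u w / corr_sigma \<phi> u) holomorphic_on \<Omega> - {u}"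
    by (rule holomorphic_transform[of "\<lambda>w. schwarzian \<phi> w / 24 + 1 / 16 * J u w"])
       (auto intro!: holomorphic_intros S_hol J_hol points simp: \<Sigma>\<phi>)
  show ?thesis
  proof (intro conjI ballI)
    fix w assume w: "w \<in> \<Omega> - {a}"
    show "corr_T_eps \<phi> s a w / corr_eps \<phi> s a = corr_T_eps \<psi> t (f a) (f w) / corr_eps \<psi> t (f a) * (deriv f w)\<^sup>2
          + 1 / 24 * schwarzian f w"
      unfolding E\<phi>[OF w] E\<psi>[OF w] using w by (intro cov points) simp
  next
    fix w assume w: "w \<in> \<Omega> - {u}"
    show "corr_T_sigma \<phi> s u w / corr_sigma \<phi> u = corr_T_sigma \<psi> t (f u) (f w) / corr_sigma \<psi> (f u) * (deriv f w)\<^sup>2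
          + 1 / 24 * schwarzian f w"
      unfolding \<Sigma>\<phi>[OF w] \<Sigma>\<psi>[OF w] using w by (intro cov points) simp
  qed (use T_hol T_cov B_hol B_cov E_hol \<Sigma>_hol in blast)+
qed

end
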